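(* Let $k$ be an algebraically closed field. Let $G$ and $H'$ be affine algebraic group schemes over $k$ acting on a $k$-algebra $A$, and assume that these actions commute. Assume furthermore that $G$ is a connected reductive algebraic group and that $A$ is a commutative domain with $A^G=k$. Let $H$ be a closed subgroup scheme of $G$ and let $a\in A$. If $Aa$ is stable under $H$ and $H'$, then $a$ is a semi-invariant for $H$ and $H'$.
   Context: An algebraic group is a reduced linear algebraic group over an algebraically closed field; a reductive group is an algebraic group with trivial unipotent radical. Group schemes need not be reduced. A module for an affine group scheme $H$ over $k$ is a right $k[H]$-comodule. $H$ acts on a $k$-algebra $A$ if $A$ is an $H$-module such that for each commutative $k$-algebra $R$ the group $H(R)$ acts by automorphisms of the algebra $R\otimes A$ (equivalently the comodule map $A\to A\otimes k[H]$ is an algebra homomorphism). A subspace is stable under $H$ if it is an $H$-submodule. An element of an $H$-module is a semi-invariant if it spans a submodule. $A^G$ denotes the algebra of $G$-invariants. *)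

theory Defs
  imports
    "HOL-Analysis.Abstract_Topology"
    "HOL-Algebra.Coset"
    "HOL-Computational_Algebra.Polynomial"
    "HOL-Library.Function_Algebras"
begin

section \<open>Tensor products over a field\<close>

text \<open>
  A vector space over \<open>'k\<close> is a type together with a scalar multiplication. Since the scalar
  multiplication is a term, \<open>V \<otimes> W\<close> is modelled as a subspace of a type depending only on the
  types of scalars and vectors: \<open>v \<otimes> w\<close> is the functional sending a bilinear form \<open>\<beta>\<close> on
  \<open>V \<times> W\<close> to \<open>\<beta> v w\<close>, and \<open>V \<otimes> W\<close> is the span of these. Over a field this is the usual tensor
  product; its universal property is proved below (\<open>tensor_lift_pure\<close>, \<open>linear_tensor_lift\<close>,
  \<open>tensor_lift_unique\<close>). All maps out of a tensor product are defined by \<open>tensor_lift\<close>,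
  the linear extension of \<open>v \<otimes> w \<mapsto> f v w\<close>. The additive structure on functionals is pointwise;
  the pointwise product plays no role.
\<close>

type_synonym ('k, 'v, 'w) tensor = "('v \<Rightarrow> 'w \<Rightarrow> 'k) \<Rightarrow> 'k"
type_synonym ('k, 'u, 'v, 'w) tensor3 = "('u \<Rightarrow> 'v \<Rightarrow> 'w \<Rightarrow> 'k) \<Rightarrow> 'k"

definition fun_scale :: "'k::field \<Rightarrow> ('x \<Rightarrow> 'k) \<Rightarrow> 'x \<Rightarrow> 'k"
  where "fun_scale c t = (\<lambda>x. c * t x)"

definition bilinear_map ::
  "('k::field \<Rightarrow> 'v::ab_group_add \<Rightarrow> 'v) \<Rightarrow> ('k \<Rightarrow> 'w::ab_group_add \<Rightarrow> 'w) \<Rightarrow>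
   ('k \<Rightarrow> 'u::ab_group_add \<Rightarrow> 'u) \<Rightarrow> ('v \<Rightarrow> 'w \<Rightarrow> 'u) \<Rightarrow> bool"
  where "bilinear_map sV sW sU f \<longleftrightarrow>
    (\<forall>w. Vector_Spaces.linear sV sU (\<lambda>v. f v w)) \<and> (\<forall>v. Vector_Spaces.linear sW sU (f v))"

definition trilinear_form ::
  "('k::field \<Rightarrow> 'u::ab_group_add \<Rightarrow> 'u) \<Rightarrow> ('k \<Rightarrow> 'v::ab_group_add \<Rightarrow> 'v) \<Rightarrow>
   ('k \<Rightarrow> 'w::ab_group_add \<Rightarrow> 'w) \<Rightarrow> ('u \<Rightarrow> 'v \<Rightarrow> 'w \<Rightarrow> 'k) \<Rightarrow> bool"
  where "trilinear_form sU sV sW f \<longleftrightarrow>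
    (\<forall>v w. Vector_Spaces.linear sU (*) (\<lambda>u. f u v w)) \<and>
    (\<forall>u w. Vector_Spaces.linear sV (*) (\<lambda>v. f u v w)) \<and>
    (\<forall>u v. Vector_Spaces.linear sW (*) (f u v))"

definition pure_tensor ::
  "('k::field \<Rightarrow> 'v::ab_group_add \<Rightarrow> 'v) \<Rightarrow> ('k \<Rightarrow> 'w::ab_group_add \<Rightarrow> 'w) \<Rightarrow>
   'v \<Rightarrow> 'w \<Rightarrow> ('k, 'v, 'w) tensor"
  where "pure_tensor sV sW v w = (\<lambda>\<beta>. if bilinear_map sV sW (*) \<beta> then \<beta> v w else 0)"

text \<open>
  \<open>(U \<otimes> V) \<otimes> W\<close> and \<open>U \<otimes> (V \<otimes> W)\<close> are both identified with the threefold tensor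
  product, modelled in the same way by trilinear forms.
\<close>

definition pure_tensor3 ::
  "('k::field \<Rightarrow> 'u::ab_group_add \<Rightarrow> 'u) \<Rightarrow> ('k \<Rightarrow> 'v::ab_group_add \<Rightarrow> 'v) \<Rightarrow>
   ('k \<Rightarrow> 'w::ab_group_add \<Rightarrow> 'w) \<Rightarrow> 'u \<Rightarrow> 'v \<Rightarrow> 'w \<Rightarrow> ('k, 'u, 'v, 'w) tensor3"
  where "pure_tensor3 sU sV sW u v w = (\<lambda>\<tau>. if trilinear_form sU sV sW \<tau> then \<tau> u v w else 0)"

text \<open>The image of \<open>S \<otimes> W\<close> in \<open>V \<otimes> W\<close>, for a subspace \<open>S\<close> of \<open>V\<close>.\<close>

definition tensor_subspace ::
  "('k::field \<Rightarrow> 'v::ab_group_add \<Rightarrow> 'v) \<Rightarrow> ('k \<Rightarrow> 'w::ab_group_add \<Rightarrow> 'w) \<Rightarrow>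
   'v set \<Rightarrow> ('k, 'v, 'w) tensor set"
  where "tensor_subspace sV sW S = module.span fun_scale {pure_tensor sV sW v w |v w. v \<in> S}"

definition tensor_space ::
  "('k::field \<Rightarrow> 'v::ab_group_add \<Rightarrow> 'v) \<Rightarrow> ('k \<Rightarrow> 'w::ab_group_add \<Rightarrow> 'w) \<Rightarrow>
   ('k, 'v, 'w) tensor set"
  where "tensor_space sV sW = tensor_subspace sV sW UNIV"

definition tensor_lift ::
  "('k::field \<Rightarrow> 'v::ab_group_add \<Rightarrow> 'v) \<Rightarrow> ('k \<Rightarrow> 'w::ab_group_add \<Rightarrow> 'w) \<Rightarrow>
   ('v \<Rightarrow> 'w \<Rightarrow> 'u::ab_group_add) \<Rightarrow> ('k, 'v, 'w) tensor \<Rightarrow> 'u"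
  where "tensor_lift sV sW f t =
    (THE u. \<exists>xs. t = (\<Sum>(v, w)\<leftarrow>xs. pure_tensor sV sW v w) \<and> u = (\<Sum>(v, w)\<leftarrow>xs. f v w))"

definition tensor_mult ::
  "('k::field \<Rightarrow> 'a::comm_ring_1 \<Rightarrow> 'a) \<Rightarrow> ('k \<Rightarrow> 'b::comm_ring_1 \<Rightarrow> 'b) \<Rightarrow>
   ('k, 'a, 'b) tensor \<Rightarrow> ('k, 'a, 'b) tensor \<Rightarrow> ('k, 'a, 'b) tensor"
  where "tensor_mult sA sB s t =
    tensor_lift sA sB (\<lambda>a b. tensor_lift sA sB (\<lambda>a' b'. pure_tensor sA sB (a * a') (b * b')) t) s"

lemma vector_space_fun_scale: "vector_space (fun_scale :: 'k::field \<Rightarrow> ('x \<Rightarrow> 'k) \<Rightarrow> 'x \<Rightarrow> 'k)"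
  by standard (auto simp: fun_scale_def fun_eq_iff algebra_simps)

lemma vector_space_field: "vector_space ((*) :: 'k::field \<Rightarrow> 'k \<Rightarrow> 'k)"
  by standard (auto simp: algebra_simps)

lemma bilinear_pure_tensor:
  assumes "vector_space sV" "vector_space sW"
  shows "bilinear_map sV sW fun_scale (pure_tensor sV sW)"
proof -
  interpret V: vector_space sV by fact
  interpret W: vector_space sW by fact
  interpret F: vector_space fun_scale by (rule vector_space_fun_scale)
  interpret VF: vector_space_pair sV "fun_scale :: _ \<Rightarrow> (_ \<Rightarrow> _) \<Rightarrow> _" ..
  interpret WF: vector_space_pair sW "fun_scale :: _ \<Rightarrow> (_ \<Rightarrow> _) \<Rightarrow> _" ..
  have l: "\<beta> (x + y) w = \<beta> x w + \<beta> y w" "\<beta> (sV c x) w = c * \<beta> x w"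
      "\<beta> x (w + w') = \<beta> x w + \<beta> x w'" "\<beta> x (sW c w) = c * \<beta> x w"
    if "bilinear_map sV sW (*) \<beta>" for \<beta> x y w w' c
    using that unfolding bilinear_map_def
    by (auto simp: linear_iff_module_hom module_hom.add module_hom.scale
        dest!: spec[where x=w] spec[where x=x]
        dest: module_hom.add[where f="\<lambda>v. \<beta> v w"] module_hom.scale[where f="\<lambda>v. \<beta> v w"])
  show ?thesis
    unfolding bilinear_map_def linear_iff_module_hom module_hom_iff
    by (auto simp: pure_tensor_def fun_eq_iff fun_scale_def l V.module_axioms W.module_axioms
        F.module_axioms)
qed

lemma linear_functional_separates:
  assumes "vector_space sU" "u \<noteq> 0"
  shows "\<exists>\<phi>. Vector_Spaces.linear sU (*) \<phi> \<and> \<phi> u \<noteq> (0::'k::field)"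
proof -
  interpret U: vector_space sU by fact
  interpret K: vector_space "(*) :: 'k \<Rightarrow> 'k \<Rightarrow> 'k" by (rule vector_space_field)
  interpret UK: vector_space_pair sU "(*) :: 'k \<Rightarrow> 'k \<Rightarrow> 'k" ..
  have "\<not> U.dependent {u}" using assms(2) by simp
  from UK.linear_independent_extend[OF this, of "\<lambda>_. 1"] show ?thesis by auto
qed

lemma sum_list_fun_apply: "(\<Sum>x\<leftarrow>xs. f x) \<beta> = (\<Sum>x\<leftarrow>xs. f x \<beta>)"
  by (induction xs) auto

lemma linear_sum_list:
  assumes "Vector_Spaces.linear sU sV \<phi>"
  shows "\<phi> (\<Sum>x\<leftarrow>xs. f x) = (\<Sum>x\<leftarrow>xs. \<phi> (f x))"
proof -
  interpret \<phi>: Vector_Spaces.linear sU sV \<phi> by fact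
  show ?thesis by (induction xs) (auto simp: \<phi>.add)
qed

lemma tensor_space_obtain_list:
  assumes "vector_space sV" "vector_space sW" "t \<in> tensor_space sV sW"
  obtains xs where "t = (\<Sum>(v, w)\<leftarrow>xs. pure_tensor sV sW v w)"
proof -
  interpret F: vector_space fun_scale by (rule vector_space_fun_scale)
  have "\<exists>xs. t = (\<Sum>(v, w)\<leftarrow>xs. pure_tensor sV sW v w)"
    using assms(3) unfolding tensor_space_def tensor_subspace_def
  proof (induction rule: F.span_induct_alt)
    case base
    show ?case by (rule exI[of _ "[]"]) simp
  next
    case (step c x y)
    then obtain v w xs where x: "x = pure_tensor sV sW v w"
      and y: "y = (\<Sum>(v, w)\<leftarrow>xs. pure_tensor sV sW v w)" by auto
    have "fun_scale c x = pure_tensor sV sW (sV c v) w"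
      using bilinear_pure_tensor[OF assms(1,2)] x
      by (auto simp: bilinear_map_def linear_iff_module_hom module_hom_iff)
    then show ?case using y by (intro exI[of _ "(sV c v, w) # xs"]) auto
  qed
  then show ?thesis using that by blast
qed

lemma tensor_lift_sum_list:
  fixes sU :: "'k::field \<Rightarrow> 'u::ab_group_add \<Rightarrow> 'u"
  assumes "vector_space sU" "bilinear_map sV sW sU f"
  shows "tensor_lift sV sW f (\<Sum>(v, w)\<leftarrow>xs. pure_tensor sV sW v w) = (\<Sum>(v, w)\<leftarrow>xs. f v w)"
  unfolding tensor_lift_def
proof (rule the_equality)
  show "\<exists>ys. (\<Sum>(v, w)\<leftarrow>xs. pure_tensor sV sW v w) = (\<Sum>(v, w)\<leftarrow>ys. pure_tensor sV sW v w) \<and>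
    (\<Sum>(v, w)\<leftarrow>xs. f v w) = (\<Sum>(v, w)\<leftarrow>ys. f v w)" by blast
next
  fix u
  assume "\<exists>ys. (\<Sum>(v, w)\<leftarrow>xs. pure_tensor sV sW v w) = (\<Sum>(v, w)\<leftarrow>ys. pure_tensor sV sW v w) \<and>
    u = (\<Sum>(v, w)\<leftarrow>ys. f v w)"
  then obtain ys where
    eq: "(\<Sum>(v, w)\<leftarrow>xs. pure_tensor sV sW v w) = (\<Sum>(v, w)\<leftarrow>ys. pure_tensor sV sW v w)"
    and u: "u = (\<Sum>(v, w)\<leftarrow>ys. f v w)" by blast
  show "u = (\<Sum>(v, w)\<leftarrow>xs. f v w)"
  proof (rule ccontr)
    assume "u \<noteq> (\<Sum>(v, w)\<leftarrow>xs. f v w)"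
    then have "u - (\<Sum>(v, w)\<leftarrow>xs. f v w) \<noteq> 0" by simp
    from linear_functional_separates[OF assms(1) this] obtain \<phi> where
      \<phi>: "Vector_Spaces.linear sU (*) \<phi>" "\<phi> (u - (\<Sum>(v, w)\<leftarrow>xs. f v w)) \<noteq> 0" by blast
    interpret \<phi>: Vector_Spaces.linear sU "(*)" \<phi> by fact
    have bil: "bilinear_map sV sW (*) (\<lambda>v w. \<phi> (f v w))"
      using assms(2) \<phi>(1) unfolding bilinear_map_def
      by (auto intro: Vector_Spaces.linear_compose[unfolded o_def])
    have ev: "(\<Sum>(v, w)\<leftarrow>zs. pure_tensor sV sW v w) (\<lambda>v w. \<phi> (f v w)) = \<phi> (\<Sum>(v, w)\<leftarrow>zs. f v w)"
      for zs
      by (simp add: linear_sum_list[OF \<phi>(1)] sum_list_fun_apply pure_tensor_def bil split_def)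
    have "\<phi> u = \<phi> (\<Sum>(v, w)\<leftarrow>xs. f v w)"
      unfolding u ev[symmetric] eq ..
    then show False using \<phi>(2) by (simp add: \<phi>.diff)
  qed
qed

lemma tensor_lift_pure:
  fixes sU :: "'k::field \<Rightarrow> 'u::ab_group_add \<Rightarrow> 'u"
  assumes "vector_space sU" "bilinear_map sV sW sU f"
  shows "tensor_lift sV sW f (pure_tensor sV sW v w) = f v w"
  using tensor_lift_sum_list[OF assms, of "[(v, w)]"] by simp

lemma linear_tensor_lift:
  fixes sU :: "'k::field \<Rightarrow> 'u::ab_group_add \<Rightarrow> 'u"
  assumes V: "vector_space sV" and W: "vector_space sW" and U: "vector_space sU"
    and f: "bilinear_map sV sW sU f"
    and s: "s \<in> tensor_space sV sW" and t: "t \<in> tensor_space sV sW"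
  shows "tensor_lift sV sW f (s + t) = tensor_lift sV sW f s + tensor_lift sV sW f t"
    and "tensor_lift sV sW f (fun_scale c s) = sU c (tensor_lift sV sW f s)"
proof -
  obtain xs where xs: "s = (\<Sum>(v, w)\<leftarrow>xs. pure_tensor sV sW v w)"
    by (rule tensor_space_obtain_list[OF V W s])
  obtain ys where ys: "t = (\<Sum>(v, w)\<leftarrow>ys. pure_tensor sV sW v w)"
    by (rule tensor_space_obtain_list[OF V W t])
  have "s + t = (\<Sum>(v, w)\<leftarrow>xs @ ys. pure_tensor sV sW v w)" using xs ys by simp
  then show "tensor_lift sV sW f (s + t) = tensor_lift sV sW f s + tensor_lift sV sW f t"
    unfolding xs ys by (simp only: tensor_lift_sum_list[OF U f]) simp
  interpret F: vector_space fun_scale by (rule vector_space_fun_scale)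
  interpret U: vector_space sU by fact
  have p: "fun_scale c (pure_tensor sV sW v w) = pure_tensor sV sW (sV c v) w"
    "sU c (f v w) = f (sV c v) w" for v w
    using bilinear_pure_tensor[OF V W] f
    by (auto simp: bilinear_map_def linear_iff_module_hom module_hom_iff)
  have "fun_scale c s = (\<Sum>(v, w)\<leftarrow>map (\<lambda>(v, w). (sV c v, w)) xs. pure_tensor sV sW v w)"
    unfolding xs
  proof (induction xs)
    case Nil
    show ?case by (simp only: list.map sum_list.Nil F.scale_zero_right)
  next
    case (Cons x xs)
    then show ?case
      by (simp only: list.map sum_list.Cons F.scale_right_distrib split_def fst_conv snd_conv p)
  qed
  moreover have "sU c (\<Sum>(v, w)\<leftarrow>xs. f v w) = (\<Sum>(v, w)\<leftarrow>map (\<lambda>(v, w). (sV c v, w)) xs. f v w)"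
    by (induction xs) (auto simp: U.scale_right_distrib p)
  ultimately show "tensor_lift sV sW f (fun_scale c s) = sU c (tensor_lift sV sW f s)"
    by (simp only: xs tensor_lift_sum_list[OF U f])
qed

lemma tensor_lift_unique:
  fixes sU :: "'k::field \<Rightarrow> 'u::ab_group_add \<Rightarrow> 'u"
  assumes V: "vector_space sV" and W: "vector_space sW" and U: "vector_space sU"
    and f: "bilinear_map sV sW sU f"
    and h: "\<And>s t. s \<in> tensor_space sV sW \<Longrightarrow> t \<in> tensor_space sV sW \<Longrightarrow> h (s + t) = h s + h t"
    and hp: "\<And>v w. h (pure_tensor sV sW v w) = f v w"
    and t: "t \<in> tensor_space sV sW"
  shows "h t = tensor_lift sV sW f t"
proof -
  interpret F: vector_space fun_scale by (rule vector_space_fun_scale)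
  obtain xs where xs: "t = (\<Sum>(v, w)\<leftarrow>xs. pure_tensor sV sW v w)"
    by (rule tensor_space_obtain_list[OF V W t])
  have p: "pure_tensor sV sW v w \<in> tensor_space sV sW" for v w
    unfolding tensor_space_def tensor_subspace_def by (auto intro: F.span_base)
  have mem: "(\<Sum>(v, w)\<leftarrow>ys. pure_tensor sV sW v w) \<in> tensor_space sV sW" for ys
  proof (induction ys)
    case Nil
    show ?case using F.span_zero by (simp only: list.map sum_list.Nil tensor_space_def tensor_subspace_def)
  next
    case (Cons y ys)
    then show ?case using F.span_add p[of "fst y" "snd y"]
      by (simp only: list.map sum_list.Cons split_def tensor_space_def tensor_subspace_def)
  qed
  have "h (\<Sum>(v, w)\<leftarrow>ys. pure_tensor sV sW v w) = (\<Sum>(v, w)\<leftarrow>ys. f v w)" for ys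
  proof (induction ys)
    case Nil
    show ?case using h[OF mem mem, of "[]" "[]"]
      by (simp only: list.map sum_list.Nil add_0_left add_cancel_right_right)
  next
    case (Cons y ys)
    then show ?case using h[OF p mem, of "fst y" "snd y" ys]
      by (simp only: list.map sum_list.Cons split_def hp)
  qed
  then show ?thesis unfolding xs by (simp only: tensor_lift_sum_list[OF U f])
qed

lemma tensor_lift_form:
  assumes V: "vector_space sV" and W: "vector_space sW"
    and \<beta>: "bilinear_map sV sW (*) \<beta>" and t: "t \<in> tensor_space sV sW"
  shows "tensor_lift sV sW \<beta> t = t \<beta>"
proof -
  obtain xs where xs: "t = (\<Sum>(v, w)\<leftarrow>xs. pure_tensor sV sW v w)"
    by (rule tensor_space_obtain_list[OF V W t])
  show ?thesis
    unfolding xs tensor_lift_sum_list[OF vector_space_field \<beta>]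
    by (simp add: sum_list_fun_apply pure_tensor_def \<beta> split_def)
qed


section \<open>Commutative algebras\<close>

locale comm_algebra = vector_space scale
  for scale :: "'k::field \<Rightarrow> 'a::comm_ring_1 \<Rightarrow> 'a" +
  assumes scale_mult_left: "scale c x * y = scale c (x * y)"

definition algebra_hom ::
  "('k::field \<Rightarrow> 'a::comm_ring_1 \<Rightarrow> 'a) \<Rightarrow> ('k \<Rightarrow> 'b::comm_ring_1 \<Rightarrow> 'b) \<Rightarrow> ('a \<Rightarrow> 'b) \<Rightarrow> bool"
  where "algebra_hom sA sB f \<longleftrightarrow>
    Vector_Spaces.linear sA sB f \<and> f 1 = 1 \<and> (\<forall>x y. f (x * y) = f x * f y)"

text \<open>
  \<open>A \<otimes> B\<close> is not a type of class \<open>comm_ring_1\<close>, so homomorphisms into it are treated separately.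
\<close>

definition algebra_hom_tensor ::
  "('k::field \<Rightarrow> 'c::comm_ring_1 \<Rightarrow> 'c) \<Rightarrow> ('k \<Rightarrow> 'a::comm_ring_1 \<Rightarrow> 'a) \<Rightarrow>
   ('k \<Rightarrow> 'b::comm_ring_1 \<Rightarrow> 'b) \<Rightarrow> ('c \<Rightarrow> ('k, 'a, 'b) tensor) \<Rightarrow> bool"
  where "algebra_hom_tensor sC sA sB f \<longleftrightarrow>
    range f \<subseteq> tensor_space sA sB \<and> Vector_Spaces.linear sC fun_scale f \<and>
    f 1 = pure_tensor sA sB 1 1 \<and> (\<forall>x y. f (x * y) = tensor_mult sA sB (f x) (f y))"

definition subalgebra :: "('k::field \<Rightarrow> 'a::comm_ring_1 \<Rightarrow> 'a) \<Rightarrow> 'a set \<Rightarrow> bool"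
  where "subalgebra sA B \<longleftrightarrow>
    module.subspace sA B \<and> 1 \<in> B \<and> (\<forall>x\<in>B. \<forall>y\<in>B. x * y \<in> B)"

definition finitely_generated_algebra :: "('k::field \<Rightarrow> 'a::comm_ring_1 \<Rightarrow> 'a) \<Rightarrow> bool"
  where "finitely_generated_algebra sA \<longleftrightarrow> (\<exists>F. finite F \<and> subalgebra sA hull F = UNIV)"


section \<open>Affine group schemes and their modules\<close>

text \<open>
  An affine group scheme \<open>G\<close> over \<open>k\<close> is given by its coordinate ring \<open>k[G]\<close>, a commutative Hopf
  algebra: the type \<open>'g\<close> with scalar multiplication, comultiplication \<open>k[G] \<rightarrow> k[G] \<otimes> k[G]\<close>,
  counit and antipode.
\<close>

record ('k, 'g) group_scheme =
  gscale :: "'k \<Rightarrow> 'g \<Rightarrow> 'g"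
  comult :: "'g \<Rightarrow> ('k, 'g, 'g) tensor"
  counit :: "'g \<Rightarrow> 'k"
  antipode :: "'g \<Rightarrow> 'g"

definition is_comodule ::
  "('k::field, 'g::comm_ring_1) group_scheme \<Rightarrow> ('k \<Rightarrow> 'm::ab_group_add \<Rightarrow> 'm) \<Rightarrow>
   ('m \<Rightarrow> ('k, 'm, 'g) tensor) \<Rightarrow> bool"
  where "is_comodule G sM \<rho> \<longleftrightarrow>
    vector_space sM \<and>
    range \<rho> \<subseteq> tensor_space sM (gscale G) \<and>
    Vector_Spaces.linear sM fun_scale \<rho> \<and>
    \<comment> \<open>\<open>(\<rho> \<otimes> id) \<circ> \<rho> = (id \<otimes> \<Delta>) \<circ> \<rho>\<close>\<close>
    (\<forall>x. tensor_lift sM (gscale G)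
           (\<lambda>m g. tensor_lift sM (gscale G)
              (\<lambda>m' g'. pure_tensor3 sM (gscale G) (gscale G) m' g' g) (\<rho> m)) (\<rho> x) =
         tensor_lift sM (gscale G)
           (\<lambda>m g. tensor_lift (gscale G) (gscale G)
              (\<lambda>g' g''. pure_tensor3 sM (gscale G) (gscale G) m g' g'') (comult G g)) (\<rho> x)) \<and>
    \<comment> \<open>\<open>(id \<otimes> \<epsilon>) \<circ> \<rho> = id\<close>\<close>
    (\<forall>x. tensor_lift sM (gscale G) (\<lambda>m g. sM (counit G g) m) (\<rho> x) = x)"

text \<open>
  Coassociativity and the right counit law say that \<open>k[G]\<close> is a comodule over itself.
\<close>

definition affine_group_scheme :: "('k::field, 'g::comm_ring_1) group_scheme \<Rightarrow> bool"
  where "affine_group_scheme G \<longleftrightarrow>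
    comm_algebra (gscale G) \<and>
    algebra_hom_tensor (gscale G) (gscale G) (gscale G) (comult G) \<and>
    algebra_hom (gscale G) (*) (counit G) \<and>
    algebra_hom (gscale G) (gscale G) (antipode G) \<and>
    is_comodule G (gscale G) (comult G) \<and>
    (\<forall>f. tensor_lift (gscale G) (gscale G) (\<lambda>x y. gscale G (counit G x) y) (comult G f) = f) \<and>
    (\<forall>f. tensor_lift (gscale G) (gscale G) (\<lambda>x y. antipode G x * y) (comult G f) =
         gscale G (counit G f) 1) \<and>
    (\<forall>f. tensor_lift (gscale G) (gscale G) (\<lambda>x y. x * antipode G y) (comult G f) =
         gscale G (counit G f) 1)"

definition affine_algebraic_group_scheme ::
  "('k::field, 'g::comm_ring_1) group_scheme \<Rightarrow> bool"
  where "affine_algebraic_group_scheme G \<longleftrightarrow>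
    affine_group_scheme G \<and> finitely_generated_algebra (gscale G)"

text \<open>
  A closed subgroup scheme of \<open>G\<close> is a group scheme \<open>H\<close> with a closed immersion
  \<open>H \<rightarrow> G\<close> that is a homomorphism of group schemes, i.e.\ with a surjective map
  \<open>\<pi> : k[G] \<rightarrow> k[H]\<close> of Hopf algebras.
\<close>

definition closed_subgroup_scheme ::
  "('k::field, 'h::comm_ring_1) group_scheme \<Rightarrow> ('g::comm_ring_1 \<Rightarrow> 'h) \<Rightarrow>
   ('k, 'g) group_scheme \<Rightarrow> bool"
  where "closed_subgroup_scheme H \<pi> G \<longleftrightarrow>
    affine_group_scheme H \<and> surj \<pi> \<and> algebra_hom (gscale G) (gscale H) \<pi> \<and>
    (\<forall>f. comult H (\<pi> f) =
         tensor_lift (gscale G) (gscale G)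
           (\<lambda>x y. pure_tensor (gscale H) (gscale H) (\<pi> x) (\<pi> y)) (comult G f)) \<and>
    (\<forall>f. counit H (\<pi> f) = counit G f) \<and>
    (\<forall>f. antipode H (\<pi> f) = \<pi> (antipode G f))"

text \<open>The restriction of a \<open>G\<close>-module to \<open>H\<close> is \<open>(id \<otimes> \<pi>) \<circ> \<rho>\<close>.\<close>

definition restrict_comodule ::
  "('k::field, 'h::comm_ring_1) group_scheme \<Rightarrow> ('g::comm_ring_1 \<Rightarrow> 'h) \<Rightarrow>
   ('k, 'g) group_scheme \<Rightarrow> ('k \<Rightarrow> 'm::ab_group_add \<Rightarrow> 'm) \<Rightarrow>
   ('m \<Rightarrow> ('k, 'm, 'g) tensor) \<Rightarrow> 'm \<Rightarrow> ('k, 'm, 'h) tensor"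
  where "restrict_comodule H \<pi> G sM \<rho> x =
    tensor_lift sM (gscale G) (\<lambda>m g. pure_tensor sM (gscale H) m (\<pi> g)) (\<rho> x)"

definition acts_on_algebra ::
  "('k::field, 'g::comm_ring_1) group_scheme \<Rightarrow> ('k \<Rightarrow> 'a::comm_ring_1 \<Rightarrow> 'a) \<Rightarrow>
   ('a \<Rightarrow> ('k, 'a, 'g) tensor) \<Rightarrow> bool"
  where "acts_on_algebra G sA \<rho> \<longleftrightarrow>
    comm_algebra sA \<and> is_comodule G sA \<rho> \<and> algebra_hom_tensor sA sA (gscale G) \<rho>"

text \<open>
  Both sides below are the maps \<open>M \<rightarrow> M \<otimes> k[G] \<otimes> k[H]\<close> obtained by applying the
  two coactions in either order.
\<close>

definition commuting_comodules ::
  "('k::field, 'g::comm_ring_1) group_scheme \<Rightarrow> ('k, 'h::comm_ring_1) group_scheme \<Rightarrow>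
   ('k \<Rightarrow> 'm::ab_group_add \<Rightarrow> 'm) \<Rightarrow> ('m \<Rightarrow> ('k, 'm, 'g) tensor) \<Rightarrow>
   ('m \<Rightarrow> ('k, 'm, 'h) tensor) \<Rightarrow> bool"
  where "commuting_comodules G H sM \<rho> \<sigma> \<longleftrightarrow>
    (\<forall>x. tensor_lift sM (gscale H)
           (\<lambda>m h. tensor_lift sM (gscale G)
              (\<lambda>m' g. pure_tensor3 sM (gscale G) (gscale H) m' g h) (\<rho> m)) (\<sigma> x) =
         tensor_lift sM (gscale G)
           (\<lambda>m g. tensor_lift sM (gscale H)
              (\<lambda>m' h. pure_tensor3 sM (gscale G) (gscale H) m' g h) (\<sigma> m)) (\<rho> x))"

definition is_submodule ::
  "('k::field, 'g::comm_ring_1) group_scheme \<Rightarrow> ('k \<Rightarrow> 'm::ab_group_add \<Rightarrow> 'm) \<Rightarrow>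
   ('m \<Rightarrow> ('k, 'm, 'g) tensor) \<Rightarrow> 'm set \<Rightarrow> bool"
  where "is_submodule G sM \<rho> W \<longleftrightarrow>
    module.subspace sM W \<and> \<rho> ` W \<subseteq> tensor_subspace sM (gscale G) W"

definition semi_invariant ::
  "('k::field, 'g::comm_ring_1) group_scheme \<Rightarrow> ('k \<Rightarrow> 'm::ab_group_add \<Rightarrow> 'm) \<Rightarrow>
   ('m \<Rightarrow> ('k, 'm, 'g) tensor) \<Rightarrow> 'm \<Rightarrow> bool"
  where "semi_invariant G sM \<rho> m \<longleftrightarrow> is_submodule G sM \<rho> (module.span sM {m})"

definition invariants ::
  "('k::field, 'g::comm_ring_1) group_scheme \<Rightarrow> ('k \<Rightarrow> 'm::ab_group_add \<Rightarrow> 'm) \<Rightarrow>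
   ('m \<Rightarrow> ('k, 'm, 'g) tensor) \<Rightarrow> 'm set"
  where "invariants G sM \<rho> = {m. \<rho> m = pure_tensor sM (gscale G) m 1}"


section \<open>Reductive groups\<close>

text \<open>
  The group of \<open>k\<close>-points: algebra homomorphisms \<open>k[G] \<rightarrow> k\<close> under convolution.
\<close>

definition points :: "('k::field, 'g::comm_ring_1) group_scheme \<Rightarrow> ('g \<Rightarrow> 'k) monoid"
  where "points G =
    \<lparr>carrier = {p. algebra_hom (gscale G) (*) p},
     monoid.mult = (\<lambda>p q f. tensor_lift (gscale G) (gscale G) (\<lambda>x y. p x * q y) (comult G f)),
     monoid.one = counit G\<rparr>"

text \<open>The Zariski topology, generated by the distinguished open sets.\<close>

definition zariski_topology :: "('k::field, 'g::comm_ring_1) group_scheme \<Rightarrow> ('g \<Rightarrow> 'k) topology"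
  where "zariski_topology G =
    topology_generated_by {{p \<in> carrier (points G). p f \<noteq> 0} |f. True}"

definition right_translation ::
  "('k::field, 'g::comm_ring_1) group_scheme \<Rightarrow> ('g \<Rightarrow> 'k) \<Rightarrow> 'g \<Rightarrow> 'g"
  where "right_translation G p f =
    tensor_lift (gscale G) (gscale G) (\<lambda>x y. gscale G (p y) x) (comult G f)"

text \<open>
  A point is unipotent if its right translation acts locally unipotently on \<open>k[G]\<close>
  (right translations are always locally finite).
\<close>

definition unipotent_point ::
  "('k::field, 'g::comm_ring_1) group_scheme \<Rightarrow> ('g \<Rightarrow> 'k) \<Rightarrow> bool"
  where "unipotent_point G p \<longleftrightarrow>
    (\<forall>f. \<exists>n. ((\<lambda>x. right_translation G p x - x) ^^ n) f = 0)"

text \<open>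
  The unipotent radical is the largest connected closed normal unipotent subgroup of \<open>G(k)\<close>.
  A largest one exists, so it is the union of all of them.
\<close>

definition unipotent_radical ::
  "('k::field, 'g::comm_ring_1) group_scheme \<Rightarrow> ('g \<Rightarrow> 'k) set"
  where "unipotent_radical G =
    \<Union>{U. U \<lhd> points G \<and> closedin (zariski_topology G) U \<and>
        connectedin (zariski_topology G) U \<and> (\<forall>p\<in>U. unipotent_point G p)}"

definition algebraic_group :: "('k::alg_closed_field, 'g::comm_ring_1) group_scheme \<Rightarrow> bool"
  where "algebraic_group G \<longleftrightarrow>
    affine_algebraic_group_scheme G \<and> (\<forall>f::'g. \<forall>n. f ^ n = 0 \<longrightarrow> f = 0)"

definition reductive_group :: "('k::alg_closed_field, 'g::comm_ring_1) group_scheme \<Rightarrow> bool"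
  where "reductive_group G \<longleftrightarrow>
    algebraic_group G \<and> unipotent_radical G = {\<one>\<^bsub>points G\<^esub>}"

definition connected_group :: "('k::alg_closed_field, 'g::comm_ring_1) group_scheme \<Rightarrow> bool"
  where "connected_group G \<longleftrightarrow> connected_space (zariski_topology G)"

end

theory Submission
  imports Defs
begin

text \<open>
  Let \<open>E\<close> be the operator on \<open>A\<close> given by a linear form on \<open>k[H']\<close> or \<open>k[H]\<close>. As \<open>A a\<close> is stable,
  \<open>E a = u a\<close>, and the point is that \<open>u \<in> k\<close>. Put \<open>x = \<rho> a\<close> and \<open>y = \<rho> u\<close> in \<open>A \<otimes> k[G]\<close>, so that
  \<open>x y = \<rho> (E a)\<close>.

  For \<open>H'\<close>, which commutes with \<open>G\<close>, the coefficients of \<open>x y\<close> in \<open>k[G]\<close> lie in the span of those of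
  \<open>x\<close>. Extend a valuation of \<open>Frac k[G]\<close> with residue field \<open>k\<close> to \<open>A \<otimes> k[G]\<close> by taking the minimum over
  the coefficients of independent elements of \<open>A\<close>. The leading coefficients of \<open>x\<close> and \<open>y\<close> have
  nonzero product in the domain \<open>A\<close>, so the valuation is multiplicative, and \<open>y\<close> has no coefficient
  with a pole. This holds for all valuations, whence \<open>y \<in> A \<otimes> k\<close> and \<open>u \<in> A\<^sup>G = k\<close>.
  For \<open>H \<subseteq> G\<close> it is the coefficients of \<open>x y\<close> in \<open>A\<close> that lie in the span of those of \<open>x\<close>, and the
  argument with the roles of \<open>A\<close> and \<open>k[G]\<close> exchanged gives \<open>y \<in> k \<otimes> k[G]\<close> and \<open>u \<in> k\<close>.
\<close>

section \<open>Total rings of quotients\<close>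

text \<open>A valuation enters only through its ring and its residue map to k, encoded as a relation
  (\<open>place\<close>); least values are found by comparing quotients, so no value group appears.
  The residue field must be k itself: only then is a leading coefficient a k-linear combination of
  independent elements, hence nonzero. A place with a pole at a given q outside k is obtained by
  sending 1/q to 0, which is consistent because q is not algebraic over the algebraically closed k,
  and by extending as far as possible. The side carrying the place needs a field of fractions and
  the other side must have no zero divisors. Both A and k[G] play both parts, so k[G] has to be a
  domain. This is where connectedness and reducedness of G enter, by way of the Nullstellensatz. As
  H and H' may be non-reduced, their k-points do not describe stability, so arbitrary linear forms
  on the coordinate rings act instead. Statements about coefficients lying in a span are used in
  dual form: a form that kills the coefficients of x kills those of x y.\<close>

text \<open>
  Coordinate rings are only known to be domains under hypotheses, so their types are not of class
  \<open>idom\<close>. We therefore localise any commutative ring at its regular elements.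
\<close>

definition regular :: "'a::comm_ring_1 \<Rightarrow> bool"
  where "regular b \<longleftrightarrow> (\<forall>x. x * b = 0 \<longrightarrow> x = 0)"

lemma regular_1 [simp]: "regular 1"
  by (simp add: regular_def)

lemma regular_mult: "regular a \<Longrightarrow> regular b \<Longrightarrow> regular (a * b)"
  unfolding regular_def by (metis mult.assoc)

lemma regular_cancel: "regular b \<Longrightarrow> x * b = y * b \<longleftrightarrow> x = y"
  unfolding regular_def
  by (metis eq_iff_diff_eq_0 left_diff_distrib)

text \<open>The relation is only partial: a pair with a zero divisor as denominator is not related
  even to itself, so it does not enter the quotient. Regularity is what makes cross multiplication
  transitive.\<close>

definition quotrel :: "'a::comm_ring_1 \<times> 'a \<Rightarrow> 'a \<times> 'a \<Rightarrow> bool"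
  where "quotrel p q \<longleftrightarrow> regular (snd p) \<and> regular (snd q) \<and> fst p * snd q = fst q * snd p"

lemma part_equivp_quotrel: "part_equivp (quotrel :: 'a::comm_ring_1 \<times> 'a \<Rightarrow> _)"
proof (rule part_equivpI)
  show "\<exists>x::'a \<times> 'a. quotrel x x"
    by (rule exI[of _ "(0, 1)"]) (simp add: quotrel_def)
  show "symp (quotrel :: 'a \<times> 'a \<Rightarrow> _)"
    by (auto simp: symp_def quotrel_def)
  show "transp (quotrel :: 'a \<times> 'a \<Rightarrow> _)"
  proof (rule transpI)
    fix p q r :: "'a \<times> 'a"
    assume pq: "quotrel p q" and qr: "quotrel q r"
    have "(fst p * snd r) * snd q = (fst r * snd p) * snd q"
      using pq qr unfolding quotrel_def by (metis mult.assoc mult.commute)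
    then show "quotrel p r"
      using pq qr regular_cancel unfolding quotrel_def by blast
  qed
qed

quotient_type (overloaded) 'a total_quotient = "'a::comm_ring_1 \<times> 'a" / partial: quotrel
  by (rule part_equivp_quotrel)

instantiation total_quotient :: (comm_ring_1) comm_ring_1
begin

lift_definition zero_total_quotient :: "'a total_quotient" is "(0, 1)"
  by (simp add: quotrel_def)

lift_definition one_total_quotient :: "'a total_quotient" is "(1, 1)"
  by (simp add: quotrel_def)

lift_definition plus_total_quotient :: "'a total_quotient \<Rightarrow> 'a total_quotient \<Rightarrow> 'a total_quotient"
  is "\<lambda>(a, b) (c, d). (a * d + c * b, b * d)"
proof (clarsimp simp: quotrel_def regular_mult)
  fix a b a' b' c d c' d' :: 'a
  assume 1: "a * b' = a' * b" and 2: "c * d' = c' * d"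
  have "(a * d + c * b) * (b' * d') = (a * b') * (d * d') + (c * d') * (b * b')"
    by (simp add: algebra_simps)
  also have "\<dots> = (a' * d' + c' * b') * (b * d)"
    unfolding 1 2 by (simp add: algebra_simps)
  finally show "(a * d + c * b) * (b' * d') = (a' * d' + c' * b') * (b * d)" .
qed

lift_definition uminus_total_quotient :: "'a total_quotient \<Rightarrow> 'a total_quotient"
  is "\<lambda>(a, b). (- a, b)"
  by (clarsimp simp: quotrel_def)

lift_definition times_total_quotient :: "'a total_quotient \<Rightarrow> 'a total_quotient \<Rightarrow> 'a total_quotient"
  is "\<lambda>(a, b) (c, d). (a * c, b * d)"
proof (clarsimp simp: quotrel_def regular_mult)
  fix a b a' b' c d c' d' :: 'a
  assume 1: "a * b' = a' * b" and 2: "c * d' = c' * d"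
  have "a * c * (b' * d') = (a * b') * (c * d')"
    by (simp add: algebra_simps)
  also have "\<dots> = a' * c' * (b * d)"
    unfolding 1 2 by (simp add: algebra_simps)
  finally show "a * c * (b' * d') = a' * c' * (b * d)" .
qed

definition minus_total_quotient :: "'a total_quotient \<Rightarrow> 'a total_quotient \<Rightarrow> 'a total_quotient"
  where "x - y = x + - (y :: 'a total_quotient)"

instance
proof
  fix x y z :: "'a total_quotient"
  show "x + y + z = x + (y + z)"
    by transfer (auto simp: quotrel_def regular_mult algebra_simps)
  show "x + y = y + x"
    by transfer (auto simp: quotrel_def regular_mult algebra_simps)
  show "0 + x = x"
    by transfer (auto simp: quotrel_def)
  show "- x + x = 0"
    by transfer (auto simp: quotrel_def regular_mult algebra_simps)
  show "x - y = x + - y"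
    by (rule minus_total_quotient_def)
  show "x * y * z = x * (y * z)"
    by transfer (auto simp: quotrel_def regular_mult algebra_simps)
  show "x * y = y * x"
    by transfer (auto simp: quotrel_def regular_mult algebra_simps)
  show "1 * x = x"
    by transfer (auto simp: quotrel_def)
  show "(x + y) * z = x * z + y * z"
    by transfer (auto simp: quotrel_def regular_mult algebra_simps)
  show "(0::'a total_quotient) \<noteq> 1"
    by transfer (auto simp: quotrel_def)
qed

end

lift_definition to_quot :: "'a::comm_ring_1 \<Rightarrow> 'a total_quotient" is "\<lambda>a. (a, 1)"
  by (simp add: quotrel_def)

lemma to_quot_0 [simp]: "to_quot 0 = 0"
  by transfer (simp add: quotrel_def)

lemma to_quot_1 [simp]: "to_quot 1 = 1"
  by transfer (simp add: quotrel_def)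

lemma to_quot_add: "to_quot (a + b) = to_quot a + to_quot b"
  by transfer (simp add: quotrel_def)

lemma to_quot_mult: "to_quot (a * b) = to_quot a * to_quot b"
  by transfer (simp add: quotrel_def)

lemma to_quot_eq_0_iff [simp]: "to_quot a = 0 \<longleftrightarrow> a = 0"
  by transfer (simp add: quotrel_def)

lemma total_quotient_inverse:
  assumes dom: "\<forall>a b :: 'a::comm_ring_1. a * b = 0 \<longrightarrow> a = 0 \<or> b = 0"
    and "x \<noteq> (0 :: 'a total_quotient)"
  shows "\<exists>y. x * y = 1"
  using assms(2)
proof transfer
  fix x :: "'a \<times> 'a"
  assume x: "quotrel x x" "\<not> quotrel x (0, 1)"
  then have "fst x \<noteq> 0"
    by (auto simp: quotrel_def)
  then have "regular (fst x)"
    using dom unfolding regular_def by blast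
  moreover have "regular (snd x)"
    using x by (simp add: quotrel_def)
  ultimately show "\<exists>y\<in>{y. quotrel y y}.
      quotrel ((case x of (a, b) \<Rightarrow> \<lambda>(c, d). (a * c, b * d)) y) (1, 1)"
    by (intro bexI[of _ "(snd x, fst x)"]) (auto simp: quotrel_def regular_mult algebra_simps split: prod.splits)
qed

section \<open>Partial homomorphisms to an algebraically closed field\<close>

text \<open>The k-algebra structure is given by its structure map, which serves both for a field of
  fractions (places) and for an arbitrary coordinate ring (Nullstellensatz).\<close>

locale algebra_map =
  fixes \<iota> :: "'k::alg_closed_field \<Rightarrow> 'r::comm_ring_1"
  assumes map_add: "\<iota> (c + d) = \<iota> c + \<iota> d"
    and map_mult: "\<iota> (c * d) = \<iota> c * \<iota> d"
    and map_one [simp]: "\<iota> 1 = 1"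
begin

lemma map_zero [simp]: "\<iota> 0 = 0"
  using map_add[of 0 0] by simp

lemma map_uminus: "\<iota> (- c) = - \<iota> c"
  using map_add[of c "- c"] by (simp add: eq_neg_iff_add_eq_0 add.commute)

lemma map_eq_0_iff [simp]: "\<iota> c = 0 \<longleftrightarrow> c = 0"
proof
  assume "\<iota> c = 0"
  then show "c = 0"
    using map_mult[of c "inverse c"] by (cases "c = 0") auto
qed simp

lemma map_sum: "\<iota> (\<Sum>i\<in>A. f i) = (\<Sum>i\<in>A. \<iota> (f i))"
  by (induction A rule: infinite_finite_induct) (auto simp: map_add)

lemma map_poly_mult: "map_poly \<iota> (p * q) = map_poly \<iota> p * map_poly \<iota> q"
  by (rule poly_eqI) (simp add: coeff_map_poly coeff_mult map_sum map_mult)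

text \<open>
  A homomorphism to \<open>k\<close> from a subring of \<open>'r\<close>, possibly only defined modulo an ideal, is
  represented by its graph.
\<close>

definition graph_closed :: "('r \<times> 'k) set \<Rightarrow> bool"
  where "graph_closed \<Gamma> \<longleftrightarrow> (\<forall>c. (\<iota> c, c) \<in> \<Gamma>) \<and>
    (\<forall>x c y d. (x, c) \<in> \<Gamma> \<longrightarrow> (y, d) \<in> \<Gamma> \<longrightarrow> (x + y, c + d) \<in> \<Gamma> \<and> (x * y, c * d) \<in> \<Gamma>)"

lemma graph_closed_map: "graph_closed \<Gamma> \<Longrightarrow> (\<iota> c, c) \<in> \<Gamma>"
  by (simp add: graph_closed_def)

lemma graph_closed_0: "graph_closed \<Gamma> \<Longrightarrow> (0, 0) \<in> \<Gamma>"
  using graph_closed_map[of \<Gamma> 0] by simp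

lemma graph_closed_1: "graph_closed \<Gamma> \<Longrightarrow> (1, 1) \<in> \<Gamma>"
  using graph_closed_map[of \<Gamma> 1] by simp

lemma graph_closed_add: "graph_closed \<Gamma> \<Longrightarrow> (x, c) \<in> \<Gamma> \<Longrightarrow> (y, d) \<in> \<Gamma> \<Longrightarrow> (x + y, c + d) \<in> \<Gamma>"
  by (simp add: graph_closed_def)

lemma graph_closed_mult: "graph_closed \<Gamma> \<Longrightarrow> (x, c) \<in> \<Gamma> \<Longrightarrow> (y, d) \<in> \<Gamma> \<Longrightarrow> (x * y, c * d) \<in> \<Gamma>"
  by (simp add: graph_closed_def)

lemma graph_closed_diff:
  assumes "graph_closed \<Gamma>" "(x, c) \<in> \<Gamma>" "(y, d) \<in> \<Gamma>"
  shows "(x - y, c - d) \<in> \<Gamma>"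
proof -
  have "(\<iota> (- 1) * y, - 1 * d) \<in> \<Gamma>"
    using assms by (intro graph_closed_mult graph_closed_map)
  from graph_closed_add[OF assms(1,2) this] show ?thesis
    by (simp add: map_uminus)
qed

lemma graph_closed_power: "graph_closed \<Gamma> \<Longrightarrow> (x, c) \<in> \<Gamma> \<Longrightarrow> (x ^ n, c ^ n) \<in> \<Gamma>"
  by (induction n) (auto intro: graph_closed_1 graph_closed_mult)

lemma graph_closed_sum:
  assumes "graph_closed \<Gamma>" "\<And>i. i \<in> A \<Longrightarrow> (f i, g i) \<in> \<Gamma>"
  shows "((\<Sum>i\<in>A. f i), (\<Sum>i\<in>A. g i)) \<in> \<Gamma>"
  using assms(2)
  by (induction A rule: infinite_finite_induct)
    (auto intro: graph_closed_0[OF assms(1)] graph_closed_add[OF assms(1)])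

definition paired :: "('r \<times> 'k) set \<Rightarrow> 'r poly \<Rightarrow> 'k poly \<Rightarrow> bool"
  where "paired \<Gamma> P p \<longleftrightarrow> (\<forall>i. (coeff P i, coeff p i) \<in> \<Gamma>)"

lemma paired_add: "graph_closed \<Gamma> \<Longrightarrow> paired \<Gamma> P p \<Longrightarrow> paired \<Gamma> Q q \<Longrightarrow> paired \<Gamma> (P + Q) (p + q)"
  by (simp add: paired_def graph_closed_add)

lemma paired_diff: "graph_closed \<Gamma> \<Longrightarrow> paired \<Gamma> P p \<Longrightarrow> paired \<Gamma> Q q \<Longrightarrow> paired \<Gamma> (P - Q) (p - q)"
  by (simp add: paired_def graph_closed_diff)

lemma paired_mult: "graph_closed \<Gamma> \<Longrightarrow> paired \<Gamma> P p \<Longrightarrow> paired \<Gamma> Q q \<Longrightarrow> paired \<Gamma> (P * Q) (p * q)"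
  by (simp add: paired_def coeff_mult graph_closed_sum graph_closed_mult)

lemma paired_map_poly: "graph_closed \<Gamma> \<Longrightarrow> paired \<Gamma> (map_poly \<iota> p) p"
  by (simp add: paired_def coeff_map_poly graph_closed_map)

lemma paired_const: "graph_closed \<Gamma> \<Longrightarrow> (x, c) \<in> \<Gamma> \<Longrightarrow> paired \<Gamma> [:x:] [:c:]"
  by (auto simp: paired_def coeff_pCons graph_closed_0 split: nat.split)

text \<open>The attempt to extend \<Gamma> by sending x to c. It is only a relation; whether it is
  single-valued is a separate question, answered by \<open>partial_hom_adjoin\<close>.\<close>

definition adjoin :: "('r \<times> 'k) set \<Rightarrow> 'r \<Rightarrow> 'k \<Rightarrow> ('r \<times> 'k) set"
  where "adjoin \<Gamma> x c = {(poly P x, poly p c) |P p. paired \<Gamma> P p}"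

lemma adjoin_superset: "graph_closed \<Gamma> \<Longrightarrow> \<Gamma> \<subseteq> adjoin \<Gamma> x c"
proof
  fix z assume "graph_closed \<Gamma>" "z \<in> \<Gamma>"
  then show "z \<in> adjoin \<Gamma> x c"
    unfolding adjoin_def
    by (cases z) (auto intro!: exI[of _ "[:fst z:]"] exI[of _ "[:snd z:]"] paired_const)
qed

lemma adjoin_gen: "graph_closed \<Gamma> \<Longrightarrow> (x, c) \<in> adjoin \<Gamma> x c"
  unfolding adjoin_def
  by (auto intro!: exI[of _ "[:0, 1:]"]
      simp: paired_def coeff_pCons graph_closed_0 graph_closed_1 split: nat.split)

lemma graph_closed_adjoin:
  assumes "graph_closed \<Gamma>"
  shows "graph_closed (adjoin \<Gamma> x c)"
  unfolding graph_closed_def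
proof (intro conjI allI impI)
  fix d
  show "(\<iota> d, d) \<in> adjoin \<Gamma> x c"
    using adjoin_superset[OF assms] graph_closed_map[OF assms] by blast
next
  fix y d z e
  assume "(y, d) \<in> adjoin \<Gamma> x c" "(z, e) \<in> adjoin \<Gamma> x c"
  then obtain P p Q q where "paired \<Gamma> P p" "paired \<Gamma> Q q"
    and *: "y = poly P x" "d = poly p c" "z = poly Q x" "e = poly q c"
    unfolding adjoin_def by blast
  then have "paired \<Gamma> (P + Q) (p + q)" "paired \<Gamma> (P * Q) (p * q)"
    using assms by (auto intro: paired_add paired_mult)
  then show "(y + z, d + e) \<in> adjoin \<Gamma> x c" "(y * z, d * e) \<in> adjoin \<Gamma> x c"
    unfolding adjoin_def * poly_add[symmetric] poly_mult[symmetric] by blast+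
qed

text \<open>Over the algebraically closed k the polynomial splits, and in a domain one of its linear
  factors must vanish at x.\<close>

lemma integral_imp_const:
  assumes dom: "\<And>a b :: 'r. a * b = 0 \<Longrightarrow> a = 0 \<or> b = 0"
    and "p \<noteq> 0" "poly (map_poly \<iota> p) x = 0"
  shows "x \<in> range \<iota>"
  using assms(2,3)
proof (induction "degree p" arbitrary: p)
  case 0
  then obtain c where "p = [:c:]" "c \<noteq> 0"
    by (metis degree_eq_zeroE pCons_0_0)
  with 0 show ?case
    by (simp add: map_poly_pCons)
next
  case (Suc n)
  then obtain c where "poly p c = 0"
    using alg_closed_imp_poly_has_root[of p] by auto
  then obtain q where q: "p = [:- c, 1:] * q"
    by (auto simp: poly_eq_0_iff_dvd)
  have "map_poly \<iota> [:- c, 1:] = [:- \<iota> c, 1:]"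
    by (simp add: map_poly_pCons map_uminus)
  then have "(x - \<iota> c) * poly (map_poly \<iota> q) x = 0"
    using Suc.prems(2) by (simp only: q map_poly_mult poly_mult) (simp add: algebra_simps)
  moreover have "q \<noteq> 0"
    using q Suc.prems(1) by auto
  moreover have "n = degree q"
    using Suc.hyps(2) \<open>q \<noteq> 0\<close> unfolding q by (subst (asm) degree_mult_eq) auto
  ultimately show ?case
    using dom Suc.hyps(1)[of q] by (metis eq_iff_diff_eq_0 rangeI)
qed

end

section \<open>Partial homomorphisms modulo an ideal and their extension\<close>

locale algebra_map_ideal = algebra_map \<iota>
  for \<iota> :: "'k::alg_closed_field \<Rightarrow> 'r::comm_ring_1" +
  fixes J :: "'r set"
  assumes ideal_0 [simp]: "0 \<in> J"
    and ideal_add: "x \<in> J \<Longrightarrow> y \<in> J \<Longrightarrow> x + y \<in> J"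
    and ideal_mult: "x \<in> J \<Longrightarrow> r * x \<in> J"
begin

lemma ideal_uminus: "x \<in> J \<Longrightarrow> - x \<in> J"
  using ideal_mult[of x "- 1"] by simp

lemma ideal_diff: "x \<in> J \<Longrightarrow> y \<in> J \<Longrightarrow> x - y \<in> J"
  using ideal_add[of x "- y"] ideal_uminus by simp

text \<open>Vanishing on J makes \<Gamma> single-valued modulo J
  (\<open>partial_hom_unique\<close>). Places use J = {0}, the Nullstellensatz a prime J.\<close>

definition partial_hom :: "('r \<times> 'k) set \<Rightarrow> bool"
  where "partial_hom \<Gamma> \<longleftrightarrow> graph_closed \<Gamma> \<and> (\<forall>x c. (x, c) \<in> \<Gamma> \<longrightarrow> x \<in> J \<longrightarrow> c = 0)"

lemma partial_hom_graph: "partial_hom \<Gamma> \<Longrightarrow> graph_closed \<Gamma>"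
  by (simp add: partial_hom_def)

lemma partial_hom_ideal: "partial_hom \<Gamma> \<Longrightarrow> (x, c) \<in> \<Gamma> \<Longrightarrow> x \<in> J \<Longrightarrow> c = 0"
  by (simp add: partial_hom_def)

lemma partial_hom_unique:
  assumes "partial_hom \<Gamma>" "(x, c) \<in> \<Gamma>" "(y, d) \<in> \<Gamma>" "x - y \<in> J"
  shows "c = d"
  using partial_hom_ideal[OF assms(1) graph_closed_diff[OF partial_hom_graph[OF assms(1)] assms(2,3)]]
    assms(4) by simp

lemma partial_hom_unique':
  "partial_hom \<Gamma> \<Longrightarrow> (x, c) \<in> \<Gamma> \<Longrightarrow> (x, d) \<in> \<Gamma> \<Longrightarrow> c = d"
  using partial_hom_unique[of \<Gamma> x c x d] by simp

lemma partial_hom_adjoin: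
  assumes "graph_closed \<Gamma>" "\<And>P p. paired \<Gamma> P p \<Longrightarrow> poly P x \<in> J \<Longrightarrow> poly p c = 0"
  shows "partial_hom (adjoin \<Gamma> x c)"
  using assms graph_closed_adjoin unfolding partial_hom_def adjoin_def by blast

text \<open>The polynomials over k that arise by reducing relations of x modulo J form an ideal of
  k[X]. The hypothesis says that it is proper, so its generator has a root in k (or is 0), and every
  such root is an admissible image of x.\<close>

lemma partial_hom_extend:
  assumes \<Gamma>: "graph_closed \<Gamma>" and proper: "\<nexists>P. paired \<Gamma> P 1 \<and> poly P x \<in> J"
  shows "\<exists>c. partial_hom (adjoin \<Gamma> x c)"
proof -
  define I where "I = {p. \<exists>P. paired \<Gamma> P p \<and> poly P x \<in> J}"
  have I_diff: "p - q \<in> I" if "p \<in> I" "q \<in> I" for p q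
  proof -
    obtain P Q where "paired \<Gamma> P p" "poly P x \<in> J" "paired \<Gamma> Q q" "poly Q x \<in> J"
      using \<open>p \<in> I\<close> \<open>q \<in> I\<close> unfolding I_def by auto
    then show ?thesis
      unfolding I_def using paired_diff[OF \<Gamma>] ideal_diff by (auto intro!: exI[of _ "P - Q"])
  qed
  have I_mult: "q * p \<in> I" if "p \<in> I" for p q
  proof -
    obtain P where "paired \<Gamma> P p" "poly P x \<in> J"
      using \<open>p \<in> I\<close> unfolding I_def by auto
    then show ?thesis
      unfolding I_def using paired_mult[OF \<Gamma> paired_map_poly[OF \<Gamma>]] ideal_mult
      by (auto intro!: exI[of _ "map_poly \<iota> q * P"])
  qed
  have "\<exists>c. \<forall>p\<in>I. poly p c = 0"
  proof (cases "I \<subseteq> {0}")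
    case True
    then have "\<forall>p\<in>I. poly p 0 = 0"
      by fastforce
    then show ?thesis ..
  next
    case False
    then obtain d where d: "d \<in> I" "d \<noteq> 0" and min: "\<And>p. p \<in> I \<Longrightarrow> p \<noteq> 0 \<Longrightarrow> degree d \<le> degree p"
      using ex_has_least_nat[of "\<lambda>p. p \<in> I \<and> p \<noteq> 0" _ degree] by (metis insertI1 subsetI)
    have dvd: "d dvd p" if "p \<in> I" for p
    proof -
      have "p mod d \<in> I"
        using I_diff[OF that I_mult[OF d(1), of "p div d"]] by (simp add: minus_div_mult_eq_mod)
      then have "p mod d = 0"
        using min[of "p mod d"] degree_mod_less[of d p] d(2) by fastforce
      then show ?thesis by auto
    qed
    have "degree d > 0"
    proof (rule ccontr)
      assume "\<not> degree d > 0"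
      then obtain e where "d = [:e:]" "e \<noteq> 0"
        using d(2) by (metis degree_eq_zeroE gr0I pCons_0_0)
      then have "1 \<in> I"
        using I_mult[OF d(1), of "[:inverse e:]"] by (simp add: one_pCons)
      then show False
        using proper unfolding I_def by blast
    qed
    then obtain c where "poly d c = 0"
      using alg_closed_imp_poly_has_root by blast
    then show ?thesis
      using dvd by (metis poly_eq_0_iff_dvd dvd_trans)
  qed
  then show ?thesis
    using partial_hom_adjoin[OF \<Gamma>] unfolding I_def by blast
qed

lemma partial_hom_maximal:
  assumes "partial_hom \<Gamma>\<^sub>0"
  obtains \<Gamma> where "partial_hom \<Gamma>" "\<Gamma>\<^sub>0 \<subseteq> \<Gamma>" "\<And>\<Gamma>'. partial_hom \<Gamma>' \<Longrightarrow> \<Gamma> \<subseteq> \<Gamma>' \<Longrightarrow> \<Gamma>' = \<Gamma>"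
proof -
  let ?A = "{\<Gamma>. partial_hom \<Gamma> \<and> \<Gamma>\<^sub>0 \<subseteq> \<Gamma>}"
  have "\<exists>M\<in>?A. \<forall>X\<in>?A. M \<subseteq> X \<longrightarrow> X = M"
  proof (rule subset_Zorn_nonempty)
    show "?A \<noteq> {}" using assms by blast
    fix C assume C: "C \<noteq> {}" "subset.chain ?A C"
    have two: "\<exists>X\<in>C. u \<in> X \<and> v \<in> X" if uv: "u \<in> \<Union>C" "v \<in> \<Union>C" for u v
    proof -
      obtain X Y where "X \<in> C" "Y \<in> C" "u \<in> X" "v \<in> Y"
        using uv by blast
      moreover from this have "X \<subseteq> Y \<or> Y \<subseteq> X"
        using C(2) unfolding subset_chain_def by blast
      ultimately show ?thesis by blast
    qed
    have P: "partial_hom X" "\<Gamma>\<^sub>0 \<subseteq> X" if "X \<in> C" for X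
      using C(2) that unfolding subset_chain_def by auto
    have "partial_hom (\<Union>C)"
      unfolding partial_hom_def graph_closed_def
    proof (intro conjI allI impI)
      fix c show "(\<iota> c, c) \<in> \<Union>C"
        using C(1) P(1) partial_hom_graph graph_closed_map by blast
    next
      fix x c y d assume "(x, c) \<in> \<Union>C" "(y, d) \<in> \<Union>C"
      then obtain X where "X \<in> C" "(x, c) \<in> X" "(y, d) \<in> X"
        using two by blast
      then show "(x + y, c + d) \<in> \<Union>C" "(x * y, c * d) \<in> \<Union>C"
        using P(1) partial_hom_graph graph_closed_add graph_closed_mult by blast+
    next
      fix x c assume "(x, c) \<in> \<Union>C" "x \<in> J"
      then show "c = 0"
        using P(1) partial_hom_ideal by blast
    qed
    moreover have "\<Gamma>\<^sub>0 \<subseteq> \<Union>C"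
      using C(1) P(2) by blast
    ultimately show "\<Union>C \<in> ?A" by blast
  qed
  then show ?thesis
    using that by (metis (mono_tags, lifting) mem_Collect_eq order_trans)
qed

end

section \<open>Places\<close>

context algebra_map
begin

text \<open>For a field this is a valuation ring over k with residue field k, together with its
  residue map. The last two conditions say that x or 1/x is finite and that a finite element with
  nonzero residue is a unit of the ring; so the inverse of a pole is finite with residue 0.\<close>

definition place :: "('r \<times> 'k) set \<Rightarrow> bool"
  where "place \<Gamma> \<longleftrightarrow> graph_closed \<Gamma> \<and> (\<forall>c. (0, c) \<in> \<Gamma> \<longrightarrow> c = 0) \<and>
    (\<forall>x y. x * y = 1 \<longrightarrow> x \<in> Domain \<Gamma> \<or> y \<in> Domain \<Gamma>) \<and>
    (\<forall>x y d. x * y = 1 \<longrightarrow> (y, d) \<in> \<Gamma> \<longrightarrow> d \<noteq> 0 \<longrightarrow> x \<in> Domain \<Gamma>)"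

text \<open>With m the kernel of \<Gamma>, such a relation says that m generates the unit ideal
  after adjoining x, which is the obstruction to extending \<Gamma> to x. The bound n need not be
  the exact degree, so that it can be lowered step by step.\<close>

definition unit_relation :: "('r \<times> 'k) set \<Rightarrow> 'r \<Rightarrow> nat \<Rightarrow> (nat \<Rightarrow> 'r) \<Rightarrow> bool"
  where "unit_relation \<Gamma> x n f \<longleftrightarrow>
    (\<forall>i. (f i, if i = 0 then 1 else 0) \<in> \<Gamma>) \<and> (\<Sum>i\<le>n. f i * x ^ i) = 0"

lemma unit_relation_paired:
  assumes "paired \<Gamma> P 1" "poly P x = 0"
  shows "unit_relation \<Gamma> x (degree P) (coeff P)"
proof -
  have "coeff (1 :: 'k poly) i = (if i = 0 then 1 else 0)" for i
    by auto
  then show ?thesis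
    using assms unfolding unit_relation_def paired_def by (simp only: poly_altdef) simp
qed

lemma inverse_power:
  assumes "x * y = (1 :: 'r)" "i \<le> n"
  shows "x ^ n * y ^ i = x ^ (n - i)"
proof -
  have "x ^ n * y ^ i = x ^ (n - i) * (x * y) ^ i"
    using assms(2) by (simp add: power_mult_distrib flip: power_add mult.assoc)
  then show ?thesis
    by (simp add: assms(1))
qed

lemma unit_relation_pos:
  assumes "unit_relation \<Gamma> x n f" "\<And>c. (0, c) \<in> \<Gamma> \<Longrightarrow> c = 0"
  shows "n > 0"
proof (rule ccontr)
  assume "\<not> n > 0"
  then have "f 0 = 0"
    using assms(1) by (simp add: unit_relation_def)
  moreover have "(f 0, if (0::nat) = 0 then 1 else 0) \<in> \<Gamma>"
    using assms(1) unfolding unit_relation_def by blast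
  ultimately show False
    using assms(2)[of 1] by simp
qed

lemma unit_relation_reduce:
  assumes \<Gamma>: "graph_closed \<Gamma>" and f: "unit_relation \<Gamma> x n f" and g: "unit_relation \<Gamma> y m g"
    and xy: "x * y = 1" and mn: "m \<le> n" and n: "n > 0"
  shows "\<exists>f'. unit_relation \<Gamma> x (n - 1) f'"
proof -
  \<comment> \<open>The relation for y multiplied by \<open>x ^ n\<close> and sorted by powers of x.
    Its top coefficient is \<open>g 0\<close>, of residue 1; all others have residue 0.\<close>
  define h where "h i = (if n - m \<le> i \<and> i \<le> n then g (n - i) else 0)" for i
  \<comment> \<open>This combination cancels the coefficient of \<open>x ^ n\<close> without
    dividing by \<open>g 0\<close>. As n > 0, \<open>f n\<close> has residue 0, so the residues
    remain those of f.\<close>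
  define f' where "f' i = g 0 * f i - f n * h i" for i
  have h: "(h i, if i = n then 1 else 0) \<in> \<Gamma>" for i
    using g graph_closed_0[OF \<Gamma>] n unfolding h_def unit_relation_def by (auto split: if_splits)
  have "(f' i, 1 * (if i = 0 then 1 else 0) - 0 * (if i = n then 1 else 0)) \<in> \<Gamma>" for i
    unfolding f'_def using f g n h
    by (intro graph_closed_diff[OF \<Gamma>] graph_closed_mult[OF \<Gamma>])
      (auto simp: unit_relation_def dest: spec[of _ 0] spec[of _ n])
  then have 1: "(f' i, if i = 0 then 1 else 0) \<in> \<Gamma>" for i
    by (simp only: mult_1 mult_zero_left diff_zero)
  have "(\<Sum>i\<le>n. h i * x ^ i) = (\<Sum>i\<in>{n - m..n}. g (n - i) * x ^ i)"
    by (rule sum.mono_neutral_cong_right) (auto simp: h_def)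
  also have "\<dots> = (\<Sum>j\<le>m. g j * x ^ (n - j))"
    using mn by (intro sum.reindex_bij_witness[of _ "\<lambda>j. n - j" "\<lambda>i. n - i"]) auto
  also have "\<dots> = x ^ n * (\<Sum>j\<le>m. g j * y ^ j)"
    using mn by (auto simp: sum_distrib_left inverse_power[OF xy, symmetric] algebra_simps intro!: sum.cong)
  also have "\<dots> = 0"
    using g by (simp add: unit_relation_def)
  finally have hx: "(\<Sum>i\<le>n. h i * x ^ i) = 0" .
  have "(\<Sum>i\<le>n. f' i * x ^ i) = g 0 * (\<Sum>i\<le>n. f i * x ^ i) - f n * (\<Sum>i\<le>n. h i * x ^ i)"
    unfolding f'_def by (simp add: left_diff_distrib sum_subtractf sum_distrib_left mult.assoc)
  with hx have "(\<Sum>i\<le>n. f' i * x ^ i) = 0"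
    using f by (simp add: unit_relation_def)
  moreover have "f' n = 0"
    using n by (simp add: f'_def h_def)
  ultimately have "(\<Sum>i\<le>n - 1. f' i * x ^ i) = 0"
    using n by (cases n) auto
  with 1 show ?thesis
    unfolding unit_relation_def by blast
qed

text \<open>Descent on n + m: whichever relation has the larger degree can be shortened with the
  help of the other, until a relation of degree 0 gives 1 = 0 in k.\<close>

lemma no_unit_relations:
  assumes \<Gamma>: "graph_closed \<Gamma>" "\<And>c. (0, c) \<in> \<Gamma> \<Longrightarrow> c = 0"
  shows "unit_relation \<Gamma> x n f \<Longrightarrow> unit_relation \<Gamma> y m g \<Longrightarrow> x * y = 1 \<Longrightarrow> False"
proof (induction "n + m" arbitrary: n m f g rule: less_induct)
  case less
  have pos: "n > 0" "m > 0"
    using unit_relation_pos \<Gamma>(2) less.prems by blast+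
  show False
  proof (cases "m \<le> n")
    case True
    then obtain f' where "unit_relation \<Gamma> x (n - 1) f'"
      using unit_relation_reduce[OF \<Gamma>(1) less.prems(1,2,3)] pos by blast
    then show False
      using less.hyps[of "n - 1" m] less.prems pos by simp
  next
    case False
    then obtain g' where "unit_relation \<Gamma> y (m - 1) g'"
      using unit_relation_reduce[OF \<Gamma>(1) less.prems(2,1)] less.prems(3) pos by (auto simp: mult.commute)
    then show False
      using less.hyps[of n "m - 1"] less.prems pos by simp
  qed
qed

text \<open>Sending y = 1/q to 0 forces q to be a pole, and a maximal extension of this partial
  homomorphism is a place because every element outside its domain satisfies a unit
  relation.\<close>

lemma exists_place:
  assumes dom: "\<And>a b :: 'r. a * b = 0 \<Longrightarrow> a = 0 \<or> b = 0"
    and q: "q \<notin> range \<iota>" and yq: "q * y = 1"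
  shows "\<exists>\<Gamma>. place \<Gamma> \<and> q \<notin> Domain \<Gamma>"
proof -
  interpret Z: algebra_map_ideal \<iota> "{0}"
    by unfold_locales auto
  define \<Gamma>\<^sub>0 where "\<Gamma>\<^sub>0 = range (\<lambda>c. (\<iota> c, c))"
  have \<Gamma>\<^sub>0: "graph_closed \<Gamma>\<^sub>0"
    unfolding graph_closed_def \<Gamma>\<^sub>0_def
    by (auto simp: image_iff map_add map_mult intro: rangeI)
  \<comment> \<open>A relation p(y) = 0 with p(0) nonzero would, after reversal of the coefficients,
    make q algebraic over k and hence constant.\<close>
  have "Z.partial_hom (adjoin \<Gamma>\<^sub>0 y 0)"
  proof (rule Z.partial_hom_adjoin[OF \<Gamma>\<^sub>0])
    fix P p assume Pp: "paired \<Gamma>\<^sub>0 P p" "poly P y \<in> {0}"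
    have P: "P = map_poly \<iota> p"
      using Pp(1) unfolding paired_def \<Gamma>\<^sub>0_def by (intro poly_eqI) (auto simp: coeff_map_poly)
    show "poly p 0 = 0"
    proof (rule ccontr)
      assume p0: "poly p 0 \<noteq> 0"
      define n where "n = degree p"
      have "(\<Sum>i\<le>n. \<iota> (coeff p i) * y ^ i) = 0"
        using Pp(2) degree_map_poly[of \<iota> p] unfolding P by (simp add: poly_altdef n_def coeff_map_poly)
      then have "0 = q ^ n * (\<Sum>i\<le>n. \<iota> (coeff p i) * y ^ i)"
        by simp
      also have "\<dots> = (\<Sum>i\<le>n. \<iota> (coeff p i) * q ^ (n - i))"
        by (auto simp: sum_distrib_left inverse_power[OF yq, symmetric] algebra_simps intro!: sum.cong)
      also have "\<dots> = (\<Sum>j\<le>n. \<iota> (coeff p (n - j)) * q ^ j)"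
        by (intro sum.reindex_bij_witness[of _ "\<lambda>j. n - j" "\<lambda>i. n - i"]) auto
      also have "\<dots> = poly (map_poly \<iota> (reflect_poly p)) q"
        using p0 degree_map_poly[of \<iota> "reflect_poly p"]
        by (auto simp: poly_altdef coeff_map_poly coeff_reflect_poly n_def poly_0_coeff_0 intro!: sum.cong)
      finally have "poly (map_poly \<iota> (reflect_poly p)) q = 0" ..
      moreover have "reflect_poly p \<noteq> 0"
        using p0 by auto
      ultimately have "q \<in> range \<iota>"
        using integral_imp_const[OF dom] by blast
      with q show False ..
    qed
  qed
  then obtain \<Gamma> where \<Gamma>: "Z.partial_hom \<Gamma>" "adjoin \<Gamma>\<^sub>0 y 0 \<subseteq> \<Gamma>"
    and max: "\<And>\<Gamma>'. Z.partial_hom \<Gamma>' \<Longrightarrow> \<Gamma> \<subseteq> \<Gamma>' \<Longrightarrow> \<Gamma>' = \<Gamma>"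
    using Z.partial_hom_maximal by blast
  have gc: "graph_closed \<Gamma>"
    using \<Gamma>(1) by (rule Z.partial_hom_graph)
  have zero: "(0, c) \<in> \<Gamma> \<Longrightarrow> c = 0" for c
    using Z.partial_hom_ideal[OF \<Gamma>(1)] by blast
  \<comment> \<open>By maximality no value can be adjoined at x, so the obstruction in
    \<open>partial_hom_extend\<close> must occur.\<close>
  have rel: "\<exists>n f. unit_relation \<Gamma> x n f" if x: "x \<notin> Domain \<Gamma>" for x
  proof -
    have "\<exists>P. paired \<Gamma> P 1 \<and> poly P x \<in> {0}"
    proof (rule ccontr)
      assume "\<not> ?thesis"
      then obtain c where "Z.partial_hom (adjoin \<Gamma> x c)"
        using Z.partial_hom_extend[OF gc, of x] by blast
      then have "adjoin \<Gamma> x c = \<Gamma>"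
        using max adjoin_superset[OF gc] by blast
      then show False
        using adjoin_gen[OF gc, of x c] x by blast
    qed
    then show ?thesis
      using unit_relation_paired by blast
  qed
  have "x \<in> Domain \<Gamma> \<or> x' \<in> Domain \<Gamma>" if "x * x' = 1" for x x'
    using rel[of x] rel[of x'] no_unit_relations[OF gc zero] that by blast
  moreover have "x \<in> Domain \<Gamma>" if "x * x' = 1" "(x', d) \<in> \<Gamma>" "d \<noteq> 0" for x x' d
  proof (rule ccontr)
    assume "x \<notin> Domain \<Gamma>"
    then obtain n f where f: "unit_relation \<Gamma> x n f"
      using rel by blast
    \<comment> \<open>The relation for x times \<open>x' ^ n\<close> lives in the domain of
      \<Gamma>. Only its term i = 0 has a possibly nonzero residue, namely
      \<open>d ^ n\<close>.\<close>
    have "(\<Sum>i\<le>n. f i * x' ^ (n - i)) = x' ^ n * (\<Sum>i\<le>n. f i * x ^ i)"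
      using inverse_power[of x' x] that(1)
      by (auto simp: sum_distrib_left algebra_simps intro!: sum.cong)
    also have "\<dots> = 0"
      using f by (simp add: unit_relation_def)
    finally have "(\<Sum>i\<le>n. f i * x' ^ (n - i)) = 0" .
    moreover have "((\<Sum>i\<le>n. f i * x' ^ (n - i)), (\<Sum>i\<le>n. (if i = 0 then 1 else 0) * d ^ (n - i))) \<in> \<Gamma>"
      using f that(2) unfolding unit_relation_def
      by (intro graph_closed_sum[OF gc] graph_closed_mult[OF gc] graph_closed_power[OF gc]) auto
    moreover have "(\<Sum>i\<le>n. (if i = 0 then 1 else 0) * d ^ (n - i)) = (\<Sum>i\<le>n. if i = 0 then d ^ n else 0)"
      by (intro sum.cong) auto
    moreover have "\<dots> = d ^ n"
      by simp
    ultimately have "(0, d ^ n) \<in> \<Gamma>"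
      by (simp only:)
    then have "d ^ n = 0"
      by (rule zero)
    then show False
      using that(3) by simp
  qed
  moreover have "q \<notin> Domain \<Gamma>"
  proof
    assume "q \<in> Domain \<Gamma>"
    then obtain e where "(q, e) \<in> \<Gamma>" by blast
    moreover have "(y, 0) \<in> \<Gamma>"
      using adjoin_gen[OF \<Gamma>\<^sub>0] \<Gamma>(2) by blast
    ultimately have "(q * y, e * 0) \<in> \<Gamma>"
      by (rule graph_closed_mult[OF gc])
    then have "(1, 0) \<in> \<Gamma>"
      using yq by simp
    then show False
      using Z.partial_hom_unique'[OF \<Gamma>(1) _ graph_closed_1[OF gc]] by fastforce
  qed
  ultimately show ?thesis
    unfolding place_def using gc zero by blast
qed

end

section \<open>Tensor products and contractions\<close>

lemma linearI:
  assumes "vector_space s" "vector_space t" "\<And>x y. f (x + y) = f x + f y" "\<And>c x. f (s c x) = t c (f x)"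
  shows "Vector_Spaces.linear s t f"
  using assms by (auto simp: linear_iff_module_hom module_hom_iff vector_space_def module_def)

lemma linear_add: "Vector_Spaces.linear s t f \<Longrightarrow> f (x + y) = f x + f y"
  by (simp add: linear_iff_module_hom module_hom_iff)

lemma linear_scale: "Vector_Spaces.linear s t f \<Longrightarrow> f (s c x) = t c (f x)"
  by (simp add: linear_iff_module_hom module_hom_iff)

lemma linear_zero: "Vector_Spaces.linear s t f \<Longrightarrow> f 0 = 0"
  using linear_add[of s t f 0 0] by simp

lemma linear_uminus: "Vector_Spaces.linear s t f \<Longrightarrow> f (- x) = - f x"
  using linear_add[of s t f x "- x"] linear_zero[of s t f] by (simp add: eq_neg_iff_add_eq_0 add.commute)

lemma linear_diff: "Vector_Spaces.linear s t f \<Longrightarrow> f (x - y) = f x - f y"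
  using linear_add[of s t f x "- y"] linear_uminus[of s t f y] by simp

lemma linear_sum: "Vector_Spaces.linear s t f \<Longrightarrow> f (\<Sum>i\<in>A. g i) = (\<Sum>i\<in>A. f (g i))"
  by (induction A rule: infinite_finite_induct) (simp_all add: linear_zero linear_add)

lemma linear_vector_spaces:
  assumes "Vector_Spaces.linear s t f"
  shows "vector_space s" "vector_space t"
  using assms by (auto simp: Vector_Spaces.linear_def vector_space_pair_def)

lemma bilinear_mapI:
  assumes "vector_space sV" "vector_space sW" "vector_space sU"
    and "\<And>v v' w. f (v + v') w = f v w + f v' w" "\<And>c v w. f (sV c v) w = sU c (f v w)"
    and "\<And>v w w'. f v (w + w') = f v w + f v w'" "\<And>c v w. f v (sW c w) = sU c (f v w)"
  shows "bilinear_map sV sW sU f"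
  unfolding bilinear_map_def using assms by (blast intro: linearI)

lemma tensor_subspace_obtain:
  assumes "vector_space sV" "vector_space sW" "module.subspace sV S" "t \<in> tensor_subspace sV sW S"
  obtains I :: "nat set" and f g where "finite I" "t = (\<Sum>i\<in>I. pure_tensor sV sW (f i) (g i))" "\<And>i. f i \<in> S"
proof -
  interpret F: vector_space fun_scale by (rule vector_space_fun_scale)
  interpret V: vector_space sV by fact
  have "\<exists>n f g. t = (\<Sum>i<(n::nat). pure_tensor sV sW (f i) (g i)) \<and> (\<forall>i. f i \<in> S)"
    using assms(4) unfolding tensor_subspace_def
  proof (induction rule: F.span_induct_alt)
    case base
    have "0 \<in> S"
      using assms(3) V.subspace_0 by blast
    then show ?case
      by (intro exI[of _ 0] exI[of _ "\<lambda>_. 0"]) simp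
  next
    case (step c x y)
    obtain v w where x: "x = pure_tensor sV sW v w" "v \<in> S"
      using step(1) by blast
    obtain n :: nat and f g where y: "y = (\<Sum>i<n. pure_tensor sV sW (f i) (g i))" "\<forall>i. f i \<in> S"
      using step(2) by blast
    have cx: "fun_scale c x = pure_tensor sV sW (sV c v) w"
      using bilinear_pure_tensor[OF assms(1,2)] unfolding x bilinear_map_def
      by (metis linear_scale)
    have "sV c v \<in> S"
      using x(2) assms(3) V.subspace_scale by blast
    then have "\<forall>i. (f(n := sV c v)) i \<in> S"
      using y(2) by simp
    moreover have "fun_scale c x + y = (\<Sum>i<Suc n. pure_tensor sV sW ((f(n := sV c v)) i) ((g(n := w)) i))"
      unfolding cx y(1) by (simp add: add.commute)
    ultimately show ?case by blast
  qed
  then show ?thesis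
    using that by blast
qed

lemma pure_in_tensor_subspace:
  "v \<in> S \<Longrightarrow> pure_tensor sV sW v w \<in> tensor_subspace sV sW S"
proof -
  interpret F: vector_space fun_scale by (rule vector_space_fun_scale)
  show "v \<in> S \<Longrightarrow> pure_tensor sV sW v w \<in> tensor_subspace sV sW S"
    unfolding tensor_subspace_def by (blast intro: F.span_base)
qed

lemma sum_pure_in_tensor_subspace:
  assumes "\<And>i. i \<in> I \<Longrightarrow> f i \<in> S"
  shows "(\<Sum>i\<in>I. pure_tensor sV sW (f i) (g i)) \<in> tensor_subspace sV sW S"
proof -
  interpret F: vector_space fun_scale by (rule vector_space_fun_scale)
  show ?thesis
    using assms pure_in_tensor_subspace[of _ S sV sW] unfolding tensor_subspace_def
    by (intro F.span_sum) auto
qed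

lemma sum_pure_in_tensor_space: "(\<Sum>i\<in>I. pure_tensor sV sW (f i) (g i)) \<in> tensor_space sV sW"
  unfolding tensor_space_def by (rule sum_pure_in_tensor_subspace) simp

lemma tensor_subspace_subset: "tensor_subspace sV sW S \<subseteq> tensor_space sV sW"
proof -
  interpret F: vector_space fun_scale by (rule vector_space_fun_scale)
  show ?thesis
    unfolding tensor_space_def tensor_subspace_def by (intro F.span_mono) blast
qed

lemma tensor_subspace_scale: "t \<in> tensor_subspace sV sW S \<Longrightarrow> fun_scale c t \<in> tensor_subspace sV sW S"
proof -
  interpret F: vector_space fun_scale by (rule vector_space_fun_scale)
  show "t \<in> tensor_subspace sV sW S \<Longrightarrow> fun_scale c t \<in> tensor_subspace sV sW S"
    unfolding tensor_subspace_def by (rule F.span_scale)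
qed

lemma tensor_space_obtain:
  assumes "vector_space sV" "vector_space sW" "t \<in> tensor_space sV sW"
  obtains I :: "nat set" and f g where "finite I" "t = (\<Sum>i\<in>I. pure_tensor sV sW (f i) (g i))"
proof -
  interpret V: vector_space sV by fact
  show ?thesis
    using tensor_subspace_obtain[OF assms(1,2) V.subspace_UNIV] assms(3) that
    unfolding tensor_space_def by blast
qed

lemma sum_eq_sum_list_pairs:
  assumes "set xs = I" "distinct xs"
  shows "(\<Sum>i\<in>I. h (a i) (b i)) = (\<Sum>(v, w)\<leftarrow>map (\<lambda>i. (a i, b i)) xs. h v w)"
  using assms by (simp add: sum_list_distinct_conv_sum_set comp_def)

lemma tensor_lift_sum:
  fixes sU :: "'k::field \<Rightarrow> 'u::ab_group_add \<Rightarrow> 'u"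
  assumes "vector_space sU" "bilinear_map sV sW sU f" "finite I"
  shows "tensor_lift sV sW f (\<Sum>i\<in>I. pure_tensor sV sW (a i) (b i)) = (\<Sum>i\<in>I. f (a i) (b i))"
proof -
  obtain xs where xs: "set xs = I" "distinct xs"
    using finite_distinct_list[OF assms(3)] by blast
  show ?thesis
    unfolding sum_eq_sum_list_pairs[OF xs] by (rule tensor_lift_sum_list[OF assms(1,2)])
qed

text \<open>Indexed families rather than sets, because the two factors in a sum of pure tensors
  share one index.\<close>

definition independent_family :: "('k::field \<Rightarrow> 'v::ab_group_add \<Rightarrow> 'v) \<Rightarrow> 'i set \<Rightarrow> ('i \<Rightarrow> 'v) \<Rightarrow> bool"
  where "independent_family s I f \<longleftrightarrow> (\<forall>c. (\<Sum>i\<in>I. s (c i) (f i)) = 0 \<longrightarrow> (\<forall>i\<in>I. c i = 0))"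

lemma independent_family_inj:
  fixes s :: "'k::field \<Rightarrow> 'v::ab_group_add \<Rightarrow> 'v" and I :: "'i set"
  assumes "vector_space s" "finite I" "independent_family s I f"
  shows "inj_on f I"
proof (rule inj_onI, rule ccontr)
  fix i j assume ij: "i \<in> I" "j \<in> I" "f i = f j" "i \<noteq> j"
  interpret vector_space s by fact
  define c :: "'i \<Rightarrow> 'k" where "c k = (if k = i then 1 else 0) - (if k = j then 1 else 0)" for k
  have "(\<Sum>k\<in>I. s (c k) (f k)) = (\<Sum>k\<in>I. (if k = i then f k else 0) - (if k = j then f k else 0))"
    unfolding c_def by (intro sum.cong) auto
  also have "\<dots> = 0"
    using ij assms(2) by (simp add: sum_subtractf)
  finally have "c i = 0"
    using assms(3) ij(1) unfolding independent_family_def by blast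
  then show False
    using ij(4) by (simp add: c_def)
qed

lemma independent_family_image:
  assumes "vector_space s" "finite I" "independent_family s I f"
  shows "\<not> module.dependent s (f ` I)"
proof -
  interpret vector_space s by fact
  have inj: "inj_on f I"
    using assms by (rule independent_family_inj)
  show ?thesis
  proof
    assume "dependent (f ` I)"
    then obtain u v where uv: "v \<in> f ` I" "u v \<noteq> 0" "(\<Sum>v\<in>f ` I. s (u v) v) = 0"
      using assms(2) by (auto simp: dependent_finite)
    have "(\<Sum>i\<in>I. s (u (f i)) (f i)) = 0"
      using uv(3) by (simp add: sum.reindex[OF inj])
    then have "\<forall>i\<in>I. u (f i) = 0"
      using assms(3)[unfolded independent_family_def, rule_format, of "\<lambda>i. u (f i)"] by blast
    then show False
      using uv(1,2) by blast
  qed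
qed

lemma dual_form:
  fixes s :: "'k::field \<Rightarrow> 'v::ab_group_add \<Rightarrow> 'v"
  assumes "vector_space s" "finite I" "independent_family s I f" "i \<in> I"
  obtains \<phi> where "Vector_Spaces.linear s (*) \<phi>" "\<And>j. j \<in> I \<Longrightarrow> \<phi> (f j) = (if j = i then 1 else 0)"
proof -
  interpret V: vector_space s by fact
  interpret K: vector_space "(*) :: 'k \<Rightarrow> 'k \<Rightarrow> 'k" by (rule vector_space_field)
  interpret VK: vector_space_pair s "(*) :: 'k \<Rightarrow> 'k \<Rightarrow> 'k" ..
  obtain \<phi> where "Vector_Spaces.linear s (*) \<phi>" "\<forall>v\<in>f ` I. \<phi> v = (if v = f i then 1 else 0)"
    using VK.linear_independent_extend[OF independent_family_image[OF assms(1-3)],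
      of "\<lambda>v. if v = f i then 1 else 0"] by blast
  then show ?thesis
    using that independent_family_inj[OF assms(1-3)] assms(4) by (auto simp: inj_on_eq_iff)
qed

lemma pure_tensor_linear:
  assumes "vector_space sV" "vector_space sW"
  shows "pure_tensor sV sW (v + v') w = pure_tensor sV sW v w + pure_tensor sV sW v' w"
    and "pure_tensor sV sW v (w + w') = pure_tensor sV sW v w + pure_tensor sV sW v w'"
    and "pure_tensor sV sW (sV c v) w = fun_scale c (pure_tensor sV sW v w)"
    and "pure_tensor sV sW v (sW c w) = fun_scale c (pure_tensor sV sW v w)"
    and "Vector_Spaces.linear sV fun_scale (\<lambda>v. pure_tensor sV sW v w)"
    and "Vector_Spaces.linear sW fun_scale (pure_tensor sV sW v)"
proof -
  have 1: "Vector_Spaces.linear sV fun_scale (\<lambda>v. pure_tensor sV sW v w)" for w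
    using bilinear_pure_tensor[OF assms] unfolding bilinear_map_def by blast
  have 2: "Vector_Spaces.linear sW fun_scale (pure_tensor sV sW v)" for v
    using bilinear_pure_tensor[OF assms] unfolding bilinear_map_def by blast
  show "pure_tensor sV sW (v + v') w = pure_tensor sV sW v w + pure_tensor sV sW v' w"
    by (rule linear_add[OF 1])
  show "pure_tensor sV sW v (w + w') = pure_tensor sV sW v w + pure_tensor sV sW v w'"
    by (rule linear_add[OF 2])
  show "pure_tensor sV sW (sV c v) w = fun_scale c (pure_tensor sV sW v w)"
    by (rule linear_scale[OF 1])
  show "pure_tensor sV sW v (sW c w) = fun_scale c (pure_tensor sV sW v w)"
    by (rule linear_scale[OF 2])
qed (use bilinear_pure_tensor[OF assms] in \<open>simp_all add: bilinear_map_def\<close>)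

text \<open>The linear relation is solved for \<open>f j\<close>, and the term of index j is
  absorbed into the right factors of the others.\<close>

lemma sum_pure_reduce:
  fixes sV :: "'k::field \<Rightarrow> 'v::ab_group_add \<Rightarrow> 'v" and sW :: "'k \<Rightarrow> 'w::ab_group_add \<Rightarrow> 'w"
  assumes V: "vector_space sV" and W: "vector_space sW"
    and I: "finite I" "j \<in> I" and c: "(\<Sum>i\<in>I. sV (c i) (f i)) = 0" "c j \<noteq> 0"
  shows "(\<Sum>i\<in>I. pure_tensor sV sW (f i) (g i)) =
    (\<Sum>i\<in>I - {j}. pure_tensor sV sW (f i) (g i - sW (c i / c j) (g j)))"
proof -
  interpret V: vector_space sV by fact
  interpret W: vector_space sW by fact
  note pl = pure_tensor_linear[OF V W]
  have "sV (c j) (f j) = - (\<Sum>i\<in>I - {j}. sV (c i) (f i))"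
    using c(1) sum.remove[OF I, of "\<lambda>i. sV (c i) (f i)"] by (simp add: eq_neg_iff_add_eq_0)
  then have "sV (inverse (c j)) (sV (c j) (f j)) = - (\<Sum>i\<in>I - {j}. sV (c i / c j) (f i))"
    by (simp add: V.scale_sum_right field_simps)
  then have fj: "f j = - (\<Sum>i\<in>I - {j}. sV (c i / c j) (f i))"
    using c(2) by simp
  have pj: "pure_tensor sV sW (f j) (g j) = - (\<Sum>i\<in>I - {j}. pure_tensor sV sW (sV (c i / c j) (f i)) (g j))"
    by (subst fj) (simp only: linear_uminus[OF pl(5)] linear_sum[OF pl(5)])
  have *: "pure_tensor sV sW (f i) (g i - sW (c i / c j) (g j)) =
      pure_tensor sV sW (f i) (g i) - pure_tensor sV sW (sV (c i / c j) (f i)) (g j)" for i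
    by (simp only: linear_diff[OF pl(6)] pl(3,4))
  have "(\<Sum>i\<in>I - {j}. pure_tensor sV sW (f i) (g i - sW (c i / c j) (g j))) =
      (\<Sum>i\<in>I - {j}. pure_tensor sV sW (f i) (g i)) + pure_tensor sV sW (f j) (g j)"
    unfolding * sum_subtractf pj by (simp only: diff_conv_add_uminus)
  then show ?thesis
    using sum.remove[OF I, of "\<lambda>i. pure_tensor sV sW (f i) (g i)"] by (simp only: add.commute)
qed

lemma sum_pure_reduce':
  fixes sV :: "'k::field \<Rightarrow> 'v::ab_group_add \<Rightarrow> 'v" and sW :: "'k \<Rightarrow> 'w::ab_group_add \<Rightarrow> 'w"
  assumes V: "vector_space sV" and W: "vector_space sW"
    and I: "finite I" "j \<in> I" and c: "(\<Sum>i\<in>I. sW (c i) (g i)) = 0" "c j \<noteq> 0"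
  shows "(\<Sum>i\<in>I. pure_tensor sV sW (f i) (g i)) =
    (\<Sum>i\<in>I - {j}. pure_tensor sV sW (f i - sV (c i / c j) (f j)) (g i))"
proof -
  interpret V: vector_space sV by fact
  interpret W: vector_space sW by fact
  note pl = pure_tensor_linear[OF V W]
  have "sW (c j) (g j) = - (\<Sum>i\<in>I - {j}. sW (c i) (g i))"
    using c(1) sum.remove[OF I, of "\<lambda>i. sW (c i) (g i)"] by (simp add: eq_neg_iff_add_eq_0)
  then have "sW (inverse (c j)) (sW (c j) (g j)) = - (\<Sum>i\<in>I - {j}. sW (c i / c j) (g i))"
    by (simp add: W.scale_sum_right field_simps)
  then have gj: "g j = - (\<Sum>i\<in>I - {j}. sW (c i / c j) (g i))"
    using c(2) by simp
  have pj: "pure_tensor sV sW (f j) (g j) = - (\<Sum>i\<in>I - {j}. pure_tensor sV sW (f j) (sW (c i / c j) (g i)))"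
    by (subst gj) (simp only: linear_uminus[OF pl(6)] linear_sum[OF pl(6)])
  have *: "pure_tensor sV sW (f i - sV (c i / c j) (f j)) (g i) =
      pure_tensor sV sW (f i) (g i) - pure_tensor sV sW (f j) (sW (c i / c j) (g i))" for i
    by (simp only: linear_diff[OF pl(5)] pl(3,4))
  have "(\<Sum>i\<in>I - {j}. pure_tensor sV sW (f i - sV (c i / c j) (f j)) (g i)) =
      (\<Sum>i\<in>I - {j}. pure_tensor sV sW (f i) (g i)) + pure_tensor sV sW (f j) (g j)"
    unfolding * sum_subtractf pj by (simp only: diff_conv_add_uminus)
  then show ?thesis
    using sum.remove[OF I, of "\<lambda>i. pure_tensor sV sW (f i) (g i)"] by (simp only: add.commute)
qed

text \<open>In a sum with the fewest terms both families are independent, since a relation on either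
  side would eliminate a term. One such sum thus displays the coefficients in either factor.\<close>

lemma tensor_space_independent:
  fixes sV :: "'k::field \<Rightarrow> 'v::ab_group_add \<Rightarrow> 'v" and sW :: "'k \<Rightarrow> 'w::ab_group_add \<Rightarrow> 'w"
  assumes V: "vector_space sV" and W: "vector_space sW" and t: "t \<in> tensor_space sV sW"
  obtains I :: "nat set" and f g where "finite I" "t = (\<Sum>i\<in>I. pure_tensor sV sW (f i) (g i))"
    "independent_family sV I f" "independent_family sW I g"
proof -
  define P where "P I \<longleftrightarrow> finite I \<and> (\<exists>f g. t = (\<Sum>i\<in>I. pure_tensor sV sW (f i) (g i)))" for I :: "nat set"
  obtain I\<^sub>0 where "P I\<^sub>0"
    using tensor_space_obtain[OF V W t] unfolding P_def by metis
  from ex_has_least_nat[of P, OF this, of card] obtain I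
    where "P I" and least: "\<forall>J. P J \<longrightarrow> card I \<le> card J" by blast
  from \<open>P I\<close> obtain f g where I: "finite I" "t = (\<Sum>i\<in>I. pure_tensor sV sW (f i) (g i))"
    unfolding P_def by blast
  have min: "t \<noteq> (\<Sum>i\<in>I - {j}. pure_tensor sV sW (f' i) (g' i))" if "j \<in> I" for f' g' j
  proof
    assume "t = (\<Sum>i\<in>I - {j}. pure_tensor sV sW (f' i) (g' i))"
    then have "P (I - {j})"
      using I(1) unfolding P_def by blast
    then have "card I \<le> card (I - {j})"
      using least by blast
    then show False
      using card_Diff1_less[OF I(1) that] by simp
  qed
  have "independent_family sV I f"
    unfolding independent_family_def
  proof (intro allI impI ballI, rule ccontr)
    fix c j assume c: "(\<Sum>i\<in>I. sV (c i) (f i)) = 0" "j \<in> I" "c j \<noteq> 0"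
    have "t = (\<Sum>i\<in>I - {j}. pure_tensor sV sW (f i) (g i - sW (c i / c j) (g j)))"
      unfolding I(2) by (rule sum_pure_reduce[OF V W I(1) c(2,1,3)])
    then show False
      by (rule notE[OF min[OF c(2), of f "\<lambda>i. g i - sW (c i / c j) (g j)"]])
  qed
  moreover have "independent_family sW I g"
    unfolding independent_family_def
  proof (intro allI impI ballI, rule ccontr)
    fix c j assume c: "(\<Sum>i\<in>I. sW (c i) (g i)) = 0" "j \<in> I" "c j \<noteq> 0"
    have "t = (\<Sum>i\<in>I - {j}. pure_tensor sV sW (f i - sV (c i / c j) (f j)) (g i))"
      unfolding I(2) by (rule sum_pure_reduce'[OF V W I(1) c(2,1,3)])
    then show False
      by (rule notE[OF min[OF c(2), of "\<lambda>i. f i - sV (c i / c j) (f j)" g]])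
  qed
  ultimately show ?thesis
    using that I by blast
qed

text \<open>This is the map id \<otimes> \<phi> from V \<otimes> W to V.\<close>

definition contract ::
  "('k::field \<Rightarrow> 'v::ab_group_add \<Rightarrow> 'v) \<Rightarrow> ('k \<Rightarrow> 'w::ab_group_add \<Rightarrow> 'w) \<Rightarrow> ('w \<Rightarrow> 'k) \<Rightarrow>
   ('k, 'v, 'w) tensor \<Rightarrow> 'v"
  where "contract sV sW \<phi> t = tensor_lift sV sW (\<lambda>v w. sV (\<phi> w) v) t"

lemma bilinear_contract:
  assumes V: "vector_space sV" and \<phi>: "Vector_Spaces.linear sW (*) \<phi>"
  shows "bilinear_map sV sW sV (\<lambda>v w. sV (\<phi> w) v)"
proof -
  interpret V: vector_space sV by fact
  show ?thesis
    using linear_vector_spaces(1)[OF \<phi>] V.vector_space_axioms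
    by (intro bilinear_mapI)
      (simp_all add: V.scale_right_distrib V.scale_left_distrib linear_add[OF \<phi>] linear_scale[OF \<phi>] mult.commute)
qed

lemma contract_sum:
  assumes "vector_space sV" "Vector_Spaces.linear sW (*) \<phi>" "finite I"
  shows "contract sV sW \<phi> (\<Sum>i\<in>I. pure_tensor sV sW (f i) (g i)) = (\<Sum>i\<in>I. sV (\<phi> (g i)) (f i))"
  unfolding contract_def by (rule tensor_lift_sum[OF assms(1) bilinear_contract[OF assms(1,2)] assms(3)])

lemma contract_in_subspace:
  assumes V: "vector_space sV" and \<phi>: "Vector_Spaces.linear sW (*) \<phi>"
    and S: "module.subspace sV S" and t: "t \<in> tensor_subspace sV sW S"
  shows "contract sV sW \<phi> t \<in> S"
proof -
  interpret V: vector_space sV by fact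
  obtain I :: "nat set" and f g where I: "finite I" "t = (\<Sum>i\<in>I. pure_tensor sV sW (f i) (g i))" "\<And>i. f i \<in> S"
    using tensor_subspace_obtain[OF V linear_vector_spaces(1)[OF \<phi>] S t] by blast
  show ?thesis
    unfolding I(2) contract_sum[OF V \<phi> I(1)]
    using I(3) S by (intro V.subspace_sum V.subspace_scale) auto
qed

text \<open>Once the right factors are independent, the left factors are themselves contractions of
  t, by forms dual to the right factors.\<close>

lemma tensor_subspaceI:
  fixes sV :: "'k::field \<Rightarrow> 'v::ab_group_add \<Rightarrow> 'v" and sW :: "'k \<Rightarrow> 'w::ab_group_add \<Rightarrow> 'w"
  assumes V: "vector_space sV" and W: "vector_space sW" and t: "t \<in> tensor_space sV sW"
    and S: "\<And>\<phi>. Vector_Spaces.linear sW (*) \<phi> \<Longrightarrow> contract sV sW \<phi> t \<in> S"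
  shows "t \<in> tensor_subspace sV sW S"
proof -
  interpret V: vector_space sV by fact
  obtain I :: "nat set" and f g where I: "finite I" "t = (\<Sum>i\<in>I. pure_tensor sV sW (f i) (g i))"
      "independent_family sV I f" "independent_family sW I g"
    using tensor_space_independent[OF V W t] .
  have "f i \<in> S" if i: "i \<in> I" for i
  proof -
    obtain \<phi> where \<phi>: "Vector_Spaces.linear sW (*) \<phi>" "\<And>j. j \<in> I \<Longrightarrow> \<phi> (g j) = (if j = i then 1 else 0)"
      using dual_form[OF W I(1,4) i] by blast
    have "contract sV sW \<phi> t = (\<Sum>j\<in>I. sV (\<phi> (g j)) (f j))"
      unfolding I(2) by (rule contract_sum[OF V \<phi>(1) I(1)])
    also have "\<dots> = (\<Sum>j\<in>I. if j = i then f j else 0)"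
      using \<phi>(2) by (intro sum.cong) auto
    also have "\<dots> = f i"
      using i I(1) by simp
    finally show ?thesis
      using S[OF \<phi>(1)] by simp
  qed
  then show ?thesis
    unfolding I(2) by (rule sum_pure_in_tensor_subspace)
qed

section \<open>The Nullstellensatz\<close>

text \<open>Over a finite field, 1 plus the product of all X - a would have no root.\<close>

lemma infinite_alg_closed_field: "infinite (UNIV :: 'k::alg_closed_field set)"
proof
  assume fin: "finite (UNIV :: 'k set)"
  define p :: "'k poly" where "p = (\<Prod>a\<in>UNIV. [:- a, 1:])"
  have "degree p = card (UNIV :: 'k set)"
    unfolding p_def by (subst degree_prod_eq_sum_degree) auto
  then have "degree p > 0"
    using fin by (simp add: card_gt_0_iff)
  then have "degree (p + 1) > 0"
    by (subst degree_add_eq_left) auto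
  then obtain c where "poly (p + 1) c = 0"
    using alg_closed_imp_poly_has_root by blast
  moreover have "poly p c = 0"
    using fin unfolding p_def poly_prod by (auto simp: prod_zero_iff intro!: bexI[of _ c])
  ultimately show False by simp
qed

section \<open>Polynomials over subalgebras and pseudo-division\<close>

context algebra_map_ideal
begin

definition subring_over :: "'r set \<Rightarrow> bool"
  where "subring_over B \<longleftrightarrow> range \<iota> \<subseteq> B \<and> (\<forall>x\<in>B. \<forall>y\<in>B. x + y \<in> B \<and> x * y \<in> B)"

definition coeffs_in :: "'r set \<Rightarrow> 'r poly \<Rightarrow> bool"
  where "coeffs_in B P \<longleftrightarrow> (\<forall>i. coeff P i \<in> B)"

lemma subring_0: "subring_over B \<Longrightarrow> 0 \<in> B"
  unfolding subring_over_def using map_zero by (metis range_subsetD)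

lemma subring_1: "subring_over B \<Longrightarrow> 1 \<in> B"
  unfolding subring_over_def using map_one by (metis range_subsetD)

lemma subring_add: "subring_over B \<Longrightarrow> x \<in> B \<Longrightarrow> y \<in> B \<Longrightarrow> x + y \<in> B"
  by (simp add: subring_over_def)

lemma subring_mult: "subring_over B \<Longrightarrow> x \<in> B \<Longrightarrow> y \<in> B \<Longrightarrow> x * y \<in> B"
  by (simp add: subring_over_def)

lemma subring_uminus:
  assumes "subring_over B" "x \<in> B"
  shows "- x \<in> B"
proof -
  have "\<iota> (- 1) * x \<in> B"
    using assms by (auto simp: subring_over_def)
  then show ?thesis by (simp add: map_uminus)
qed

lemma subring_diff: "subring_over B \<Longrightarrow> x \<in> B \<Longrightarrow> y \<in> B \<Longrightarrow> x - y \<in> B"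
  using subring_add[of B x "- y"] subring_uminus[of B y] by simp

lemma subring_power: "subring_over B \<Longrightarrow> x \<in> B \<Longrightarrow> x ^ n \<in> B"
  by (induction n) (auto intro: subring_1 subring_mult)

lemma subring_sum: "subring_over B \<Longrightarrow> (\<And>i. i \<in> A \<Longrightarrow> f i \<in> B) \<Longrightarrow> (\<Sum>i\<in>A. f i) \<in> B"
  by (induction A rule: infinite_finite_induct) (auto intro: subring_0 subring_add)

lemma coeffs_in_add: "subring_over B \<Longrightarrow> coeffs_in B P \<Longrightarrow> coeffs_in B Q \<Longrightarrow> coeffs_in B (P + Q)"
  by (simp add: coeffs_in_def subring_add)

lemma coeffs_in_diff: "subring_over B \<Longrightarrow> coeffs_in B P \<Longrightarrow> coeffs_in B Q \<Longrightarrow> coeffs_in B (P - Q)"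
  by (simp add: coeffs_in_def subring_diff)

lemma coeffs_in_mult: "subring_over B \<Longrightarrow> coeffs_in B P \<Longrightarrow> coeffs_in B Q \<Longrightarrow> coeffs_in B (P * Q)"
  by (simp add: coeffs_in_def coeff_mult subring_sum subring_mult)

lemma coeffs_in_smult: "subring_over B \<Longrightarrow> x \<in> B \<Longrightarrow> coeffs_in B P \<Longrightarrow> coeffs_in B (smult x P)"
  by (simp add: coeffs_in_def subring_mult)

lemma coeffs_in_monom: "subring_over B \<Longrightarrow> x \<in> B \<Longrightarrow> coeffs_in B (monom x n)"
  by (simp add: coeffs_in_def subring_0)

lemma coeffs_in_const: "subring_over B \<Longrightarrow> x \<in> B \<Longrightarrow> coeffs_in B [:x:]"
  using coeffs_in_monom[of B x 0] by (simp add: monom_0)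

lemma poly_in_ideal: "(\<And>i. coeff P i \<in> J) \<Longrightarrow> poly P x \<in> J"
proof -
  assume "\<And>i. coeff P i \<in> J"
  then have "(\<Sum>i\<in>A. coeff P i * x ^ i) \<in> J" for A
    by (induction A rule: infinite_finite_induct)
      (auto intro: ideal_add ideal_mult simp: mult.commute[of _ "x ^ _"])
  then show ?thesis
    by (simp add: poly_altdef)
qed

lemma ideal_sum: "(\<And>i. i \<in> A \<Longrightarrow> f i \<in> J) \<Longrightarrow> (\<Sum>i\<in>A. f i) \<in> J"
  by (induction A rule: infinite_finite_induct) (auto intro: ideal_add)

lemma pseudo_division:
  assumes B: "subring_over B" and D: "coeffs_in B D"
    and Q: "coeffs_in B Q" "\<And>i. i \<ge> N \<Longrightarrow> coeff Q i = 0"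
  shows "\<exists>n A R. coeffs_in B A \<and> coeffs_in B R \<and> smult (lead_coeff D ^ n) Q = A * D + R \<and>
    (\<forall>i\<ge>degree D. coeff R i = 0) \<and> (\<forall>i. i + degree D \<ge> N \<longrightarrow> coeff A i = 0)"
  using Q
proof (induction N arbitrary: Q)
  case 0
  then show ?case
    using subring_0[OF B]
    by (intro exI[of _ 0] exI[of _ "0 :: 'r poly"] exI[of _ Q]) (auto simp: coeffs_in_def)
next
  case (Suc N)
  let ?m = "degree D" and ?\<delta> = "lead_coeff D"
  show ?case
  proof (cases "N < ?m")
    case True
    then show ?thesis
      using Suc.prems subring_0[OF B]
      by (intro exI[of _ 0] exI[of _ "0 :: 'r poly"] exI[of _ Q]) (auto simp: coeffs_in_def)
  next
    case False
    define M where "M = monom (coeff Q N) (N - ?m)"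
    define Q' where "Q' = smult ?\<delta> Q - M * D"
    have \<delta>: "?\<delta> \<in> B"
      using D by (simp add: coeffs_in_def)
    have M: "coeffs_in B M"
      using Suc.prems(1) unfolding M_def by (intro coeffs_in_monom[OF B]) (simp add: coeffs_in_def)
    have MD: "coeff (M * D) i = (if i < N - ?m then 0 else coeff Q N * coeff D (i - (N - ?m)))" for i
      unfolding M_def by (simp add: coeff_monom_mult)
    have "coeffs_in B Q'"
      unfolding Q'_def using B D M \<delta> Suc.prems(1)
      by (intro coeffs_in_diff coeffs_in_smult coeffs_in_mult)
    moreover have "coeff Q' i = 0" if "i \<ge> N" for i
    proof (cases "i = N")
      case True
      with False show ?thesis
        by (simp add: Q'_def MD mult.commute[of "coeff Q N"])
    next
      case i: False
      then have "coeff Q i = 0" "coeff D (i - (N - ?m)) = 0"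
        using that Suc.prems(2) False by (auto intro: coeff_eq_0)
      then show ?thesis
        by (simp add: Q'_def MD)
    qed
    ultimately obtain n A R where IH: "coeffs_in B A" "coeffs_in B R"
        "smult (?\<delta> ^ n) Q' = A * D + R" "\<forall>i\<ge>?m. coeff R i = 0" "\<forall>i. i + ?m \<ge> N \<longrightarrow> coeff A i = 0"
      using Suc.IH by blast
    define A' where "A' = A + smult (?\<delta> ^ n) M"
    have "smult (?\<delta> ^ Suc n) Q = smult (?\<delta> ^ n) Q' + smult (?\<delta> ^ n) (M * D)"
      by (simp add: Q'_def smult_diff_right mult.commute)
    also have "\<dots> = A' * D + R"
      unfolding IH(3) A'_def by (simp add: algebra_simps)
    finally have "smult (?\<delta> ^ Suc n) Q = A' * D + R" .
    moreover have "coeffs_in B A'"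
      unfolding A'_def using B IH(1) M \<delta>
      by (intro coeffs_in_add coeffs_in_smult subring_power)
    moreover have "coeff A' i = 0" if "i + ?m \<ge> Suc N" for i
      using that IH(5) False by (auto simp: A'_def M_def)
    ultimately show ?thesis
      using IH(2,4) by blast
  qed
qed

lemma Domain_subring:
  assumes "graph_closed \<Gamma>"
  shows "subring_over (Domain \<Gamma>)"
  using graph_closed_map[OF assms] graph_closed_add[OF assms] graph_closed_mult[OF assms]
  unfolding subring_over_def by (blast intro: DomainI)

lemma obtain_paired:
  assumes "graph_closed \<Gamma>" "coeffs_in (Domain \<Gamma>) P"
  obtains p where "paired \<Gamma> P p"
proof -
  obtain f where f: "\<And>i. (coeff P i, f i) \<in> \<Gamma>"
    using assms(2) unfolding coeffs_in_def Domain_iff by metis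
  define p where "p = (\<Sum>i\<le>degree P. monom (f i) i)"
  have "coeff p i = (if i \<le> degree P then f i else 0)" for i
    unfolding p_def coeff_sum by (simp add: sum.delta)
  then have "paired \<Gamma> P p"
    using f graph_closed_0[OF assms(1)] unfolding paired_def by (auto simp: coeff_eq_0)
  then show ?thesis by (rule that)
qed

lemma Domain_adjoin:
  assumes "graph_closed \<Gamma>"
  shows "Domain (adjoin \<Gamma> x c) = {poly P x |P. coeffs_in (Domain \<Gamma>) P}"
proof (intro equalityI subsetI)
  fix z assume "z \<in> Domain (adjoin \<Gamma> x c)"
  then show "z \<in> {poly P x |P. coeffs_in (Domain \<Gamma>) P}"
    unfolding adjoin_def paired_def coeffs_in_def by blast
next
  fix z assume "z \<in> {poly P x |P. coeffs_in (Domain \<Gamma>) P}"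
  then obtain P where "z = poly P x" "coeffs_in (Domain \<Gamma>) P" by blast
  moreover from this obtain p where "paired \<Gamma> P p"
    using obtain_paired[OF assms] by blast
  ultimately have "(z, poly p c) \<in> adjoin \<Gamma> x c"
    unfolding adjoin_def by blast
  then show "z \<in> Domain (adjoin \<Gamma> x c)" ..
qed

text \<open>The Nullstellensatz for B modulo J, strengthened to all s outside J: when B is enlarged
  to B[x], an element of B[x] is traced back to a different element of B.\<close>

definition enough_homs :: "'r set \<Rightarrow> bool"
  where "enough_homs B \<longleftrightarrow> (\<forall>s\<in>B - J. \<exists>\<Gamma>. partial_hom \<Gamma> \<and> Domain \<Gamma> = B \<and> (\<forall>c. (s, c) \<in> \<Gamma> \<longrightarrow> c \<noteq> 0))"

end

locale algebra_map_prime = algebra_map_ideal +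
  assumes one_notin: "1 \<notin> J"
    and prime: "x * y \<in> J \<Longrightarrow> x \<in> J \<or> y \<in> J"
begin

lemma power_notin: "x \<notin> J \<Longrightarrow> x ^ n \<notin> J"
  by (induction n) (auto simp: one_notin dest: prime)

text \<open>
  The step \<open>B \<leadsto> B[x]\<close> is the extension theorem for homomorphisms into an algebraically closed field
  (Atiyah--Macdonald, Proposition 5.23), relative to the prime \<open>J\<close>.
\<close>

lemma enough_homs_transcendental:
  assumes B: "subring_over B" "enough_homs B"
    and trans: "\<And>P i. coeffs_in B P \<Longrightarrow> poly P x \<in> J \<Longrightarrow> coeff P i \<in> J"
  shows "enough_homs {poly P x |P. coeffs_in B P}"
  unfolding enough_homs_def
proof
  fix s assume "s \<in> {poly P x |P. coeffs_in B P} - J"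
  then obtain S where S: "coeffs_in B S" "s = poly S x" "s \<notin> J" by blast
  then obtain i where "coeff S i \<notin> J"
    using poly_in_ideal by blast
  then obtain \<Gamma> where \<Gamma>: "partial_hom \<Gamma>" "Domain \<Gamma> = B" "\<And>c. (coeff S i, c) \<in> \<Gamma> \<Longrightarrow> c \<noteq> 0"
    using B(2) S(1) unfolding enough_homs_def coeffs_in_def by blast
  have gc: "graph_closed \<Gamma>"
    using \<Gamma>(1) by (rule partial_hom_graph)
  obtain \<sigma> where \<sigma>: "paired \<Gamma> S \<sigma>"
    using obtain_paired[OF gc] S(1) \<Gamma>(2) by blast
  then have "\<sigma> \<noteq> 0"
    using \<Gamma>(3) unfolding paired_def by (metis coeff_0)
  then have "finite {c. poly \<sigma> c = 0}"
    by (rule poly_roots_finite)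
  \<comment> \<open>As x is transcendental modulo J, any value c may be assigned to it. The infinite
    field k contains one that is not a root of \<sigma>, so that s gets a nonzero image.\<close>
  then obtain c where c: "poly \<sigma> c \<noteq> 0"
    using infinite_alg_closed_field by (metis (mono_tags, lifting) UNIV_eq_I mem_Collect_eq)
  have ph: "partial_hom (adjoin \<Gamma> x c)"
  proof (rule partial_hom_adjoin[OF gc])
    fix P p assume P: "paired \<Gamma> P p" "poly P x \<in> J"
    then have "coeffs_in B P"
      using \<Gamma>(2) unfolding paired_def coeffs_in_def by blast
    then have "coeff p i = 0" for i
      using partial_hom_ideal[OF \<Gamma>(1)] trans P unfolding paired_def by blast
    then show "poly p c = 0"
      by (simp add: poly_altdef)
  qed
  moreover have "(s, poly \<sigma> c) \<in> adjoin \<Gamma> x c"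
    using \<sigma> unfolding adjoin_def S(2) by blast
  then have "d \<noteq> 0" if "(s, d) \<in> adjoin \<Gamma> x c" for d
    using partial_hom_unique'[OF ph that] c by auto
  ultimately show "\<exists>\<Gamma>. partial_hom \<Gamma> \<and> Domain \<Gamma> = {poly P x |P. coeffs_in B P} \<and> (\<forall>c. (s, c) \<in> \<Gamma> \<longrightarrow> c \<noteq> 0)"
    using Domain_adjoin[OF gc, of x c] \<Gamma>(2) by blast
qed

text \<open>Modulo J, the element s divides in B[x] some \<delta> in B outside J. A homomorphism on
  B that is nonzero at \<delta> and at the leading coefficient of a minimal relation for x extends
  to B[x], and it cannot vanish at s because it does not vanish at \<delta>.\<close>

lemma enough_homs_algebraic:
  assumes B: "subring_over B" "enough_homs B"
    and alg: "coeffs_in B P\<^sub>0" "poly P\<^sub>0 x \<in> J" "coeff P\<^sub>0 i\<^sub>0 \<notin> J"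
  shows "enough_homs {poly P x |P. coeffs_in B P}"
proof -
  \<comment> \<open>P plays the role of a minimal polynomial of x over B modulo J: any relation of
    lower degree has all its coefficients in J.\<close>
  let ?rel = "\<lambda>P. coeffs_in B P \<and> poly P x \<in> J \<and> (\<exists>i. coeff P i \<notin> J)"
  obtain P where P: "?rel P" and minP: "\<And>Q. ?rel Q \<Longrightarrow> degree P \<le> degree Q"
    using ex_has_least_nat[of ?rel P\<^sub>0 degree] alg by blast
  define m where "m = degree P"
  define lc where "lc = lead_coeff P"
  have small: "coeff Q i \<in> J" if Q: "coeffs_in B Q" "poly Q x \<in> J" "\<And>j. j \<ge> m \<Longrightarrow> coeff Q j = 0" for Q i
  proof (rule ccontr)
    assume "coeff Q i \<notin> J"
    then have "m \<le> degree Q"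
      using minP Q unfolding m_def by blast
    then have "coeff Q (degree Q) = 0"
      using Q(3) by blast
    then have "Q = 0" by simp
    with \<open>coeff Q i \<notin> J\<close> show False by simp
  qed
  have lcB: "lc \<in> B"
    using P by (simp add: lc_def coeffs_in_def)
  \<comment> \<open>Otherwise dropping the leading term leaves a relation of smaller degree, so all
    coefficients of P would lie in J.\<close>
  have lc: "lc \<notin> J"
  proof
    assume lc: "lc \<in> J"
    define Q where "Q = P - monom lc m"
    have "coeffs_in B Q"
      unfolding Q_def using P lcB by (intro coeffs_in_diff[OF B(1)] coeffs_in_monom[OF B(1)]) auto
    moreover have "poly Q x \<in> J"
      unfolding Q_def using P lc ideal_mult[of lc "x ^ m"]
      by (auto simp: poly_monom mult.commute intro!: ideal_diff)
    moreover have "coeff Q j = 0" if "j \<ge> m" for j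
      using that unfolding Q_def by (cases "j = m") (auto simp: lc_def m_def intro!: coeff_eq_0)
    ultimately have Q: "coeff Q j \<in> J" for j
      by (rule small)
    have "coeff P j \<in> J" for j
      using Q[of j] lc unfolding Q_def by (cases "j = m") (auto simp: lc_def m_def)
    with P show False by blast
  qed
  have m: "m > 0"
  proof (rule ccontr)
    assume "\<not> m > 0"
    then have "poly P x = lc"
      by (simp add: m_def lc_def poly_altdef)
    with P lc show False by simp
  qed
  show ?thesis
    unfolding enough_homs_def
  proof
    fix s assume "s \<in> {poly P x |P. coeffs_in B P} - J"
    then obtain S where S: "coeffs_in B S" "s = poly S x" "s \<notin> J" by blast
    \<comment> \<open>Values at x that are multiples of s modulo J and do not lie in J. One of least
      degree turns out to be constant, which gives \<delta>.\<close>
    let ?mult = "\<lambda>D. coeffs_in B D \<and> poly D x \<notin> J \<and> (\<exists>U. coeffs_in B U \<and> poly D x - poly U x * s \<in> J)"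
    have "?mult S"
      using S coeffs_in_const[OF B(1) subring_1[OF B(1)]] by (auto intro!: exI[of _ "[:1:]"])
    then obtain D where D: "?mult D" and minD: "\<And>E. ?mult E \<Longrightarrow> degree D \<le> degree E"
      using ex_has_least_nat[of ?mult S degree] by blast
    then obtain U where U: "coeffs_in B U" "poly D x - poly U x * s \<in> J" by blast
    define d where "d = degree D"
    define \<delta> where "\<delta> = lead_coeff D"
    have minD': "poly E x \<in> J"
      if E: "coeffs_in B E" "coeffs_in B V" "poly E x - poly V x * s \<in> J" "\<And>j. j \<ge> d \<Longrightarrow> coeff E j = 0" for E V
    proof (rule ccontr)
      assume "poly E x \<notin> J"
      then have "d \<le> degree E"
        using minD E unfolding d_def by blast
      then have "coeff E (degree E) = 0"
        using E(4) by blast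
      then have "E = 0" by simp
      with \<open>poly E x \<notin> J\<close> show False by simp
    qed
    have \<delta>B: "\<delta> \<in> B"
      using D by (simp add: \<delta>_def coeffs_in_def)
    have \<delta>: "\<delta> \<notin> J"
    proof
      assume \<delta>: "\<delta> \<in> J"
      define E where "E = D - monom \<delta> d"
      have *: "\<delta> * x ^ d \<in> J"
        using \<delta> ideal_mult[of \<delta> "x ^ d"] by (simp add: mult.commute)
      have E: "poly E x = poly D x - \<delta> * x ^ d"
        by (simp add: E_def poly_monom)
      have "coeffs_in B E"
        unfolding E_def using D \<delta>B by (intro coeffs_in_diff[OF B(1)] coeffs_in_monom[OF B(1)]) auto
      moreover have "poly E x - poly U x * s \<in> J"
        unfolding E using ideal_diff[OF U(2) *] by (simp add: algebra_simps)
      moreover have "coeff E j = 0" if "j \<ge> d" for j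
        using that unfolding E_def by (cases "j = d") (auto simp: \<delta>_def d_def intro!: coeff_eq_0)
      ultimately have "poly E x \<in> J"
        using U(1) by (intro minD')
      then have "poly D x \<in> J"
        using ideal_add[OF _ *] unfolding E by fastforce
      with D show False by blast
    qed
    \<comment> \<open>Otherwise the remainder of D on division by P would be a multiple of s of
      smaller degree, hence in J at x, and then so would \<open>lc ^ n * poly D x\<close>.\<close>
    have "d \<le> m"
    proof (rule ccontr)
      assume dm: "\<not> d \<le> m"
      obtain n A R where AR: "coeffs_in B A" "coeffs_in B R" "smult (lc ^ n) D = A * P + R"
          "\<forall>i\<ge>m. coeff R i = 0"
        using pseudo_division[OF B(1), of P D "Suc d"] P D unfolding lc_def m_def d_def
        by (auto simp: coeff_eq_0)
      have R: "poly R x = lc ^ n * poly D x - poly A x * poly P x"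
        using arg_cong[OF AR(3), of "\<lambda>Q. poly Q x"] by simp
      have "lc ^ n * (poly D x - poly U x * s) - poly A x * poly P x \<in> J"
        using P U(2) by (intro ideal_diff[OF ideal_mult ideal_mult]) auto
      then have "poly R x - poly (smult (lc ^ n) U) x * s \<in> J"
        unfolding R by (simp add: algebra_simps)
      moreover have "coeffs_in B (smult (lc ^ n) U)"
        using B(1) U(1) lcB by (intro coeffs_in_smult subring_power)
      ultimately have "poly R x \<in> J"
        using minD'[OF AR(2)] AR(4) dm by auto
      then have "lc ^ n * poly D x \<in> J"
        using ideal_add[OF \<open>poly R x \<in> J\<close> ideal_mult[of "poly P x" "poly A x"]] P unfolding R by simp
      then show False
        using prime D power_notin[OF lc] by blast
    qed
    \<comment> \<open>Divide P by D. The remainder R is a multiple of s modulo J, so R(x) is in J by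
      minimality of D; then A(x) D(x), and by primality A(x), is in J. For d > 0 both A and R have
      degree below m, so all their coefficients lie in J, contradicting the top coefficient
      \<open>\<delta> ^ n * lc\<close>.\<close>
    have "d = 0"
    proof (rule ccontr)
      assume d: "d \<noteq> 0"
      obtain n A R where AR: "coeffs_in B A" "coeffs_in B R" "smult (\<delta> ^ n) P = A * D + R"
          "\<forall>i\<ge>d. coeff R i = 0" "\<forall>i. i + d \<ge> Suc m \<longrightarrow> coeff A i = 0"
        using pseudo_division[OF B(1), of D P "Suc m"] P D unfolding \<delta>_def m_def d_def
        by (auto simp: coeff_eq_0)
      have AD: "poly A x * poly D x = \<delta> ^ n * poly P x - poly R x"
        using arg_cong[OF AR(3), of "\<lambda>Q. poly Q x"] by simp
      have "\<delta> ^ n * poly P x - poly A x * (poly D x - poly U x * s) \<in> J"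
        using P U(2) by (intro ideal_diff[OF ideal_mult ideal_mult]) auto
      then have "poly R x - poly (- (A * U)) x * s \<in> J"
        using AD by (simp add: algebra_simps)
      moreover have "coeffs_in B (- (A * U))"
        using B(1) U(1) AR(1) coeffs_in_mult[of B A U] by (simp add: coeffs_in_def subring_uminus)
      ultimately have RJ: "poly R x \<in> J"
        using minD'[OF AR(2)] AR(4) by blast
      then have "poly A x * poly D x \<in> J"
        unfolding AD using P by (intro ideal_diff ideal_mult) auto
      then have AJ: "poly A x \<in> J"
        using prime D by blast
      have "coeff A i \<in> J" for i
        using small[OF AR(1) AJ] AR(5) d by simp
      moreover have "coeff R i \<in> J" for i
        using small[OF AR(2) RJ] AR(4) \<open>d \<le> m\<close> by simp
      ultimately have "coeff (A * D + R) m \<in> J"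
        unfolding coeff_add coeff_mult
        by (intro ideal_add ideal_sum) (auto simp: mult.commute[of "coeff A _"] intro: ideal_mult)
      then have "\<delta> ^ n * lc \<in> J"
        unfolding AR(3)[symmetric] by (simp add: lc_def m_def)
      then show False
        using prime lc power_notin[OF \<delta>] by blast
    qed
    then have Dx: "poly D x = \<delta>"
      by (simp add: poly_altdef d_def \<delta>_def)
    have "\<delta> * lc \<in> B - J"
      using prime lc \<delta> \<delta>B lcB subring_mult[OF B(1)] by blast
    then obtain \<Gamma> where \<Gamma>: "partial_hom \<Gamma>" "Domain \<Gamma> = B" "\<And>c. (\<delta> * lc, c) \<in> \<Gamma> \<Longrightarrow> c \<noteq> 0"
      using B(2) unfolding enough_homs_def by blast
    have gc: "graph_closed \<Gamma>"
      using \<Gamma>(1) by (rule partial_hom_graph)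
    obtain e l where el: "(\<delta>, e) \<in> \<Gamma>" "(lc, l) \<in> \<Gamma>"
      using \<delta>B lcB \<Gamma>(2) by blast
    have nz: "e \<noteq> 0" "l \<noteq> 0"
      using \<Gamma>(3)[OF graph_closed_mult[OF gc el]] by auto
    obtain p where p: "paired \<Gamma> P p"
      using obtain_paired[OF gc] P \<Gamma>(2) by blast
    have "coeff p m = l"
      using partial_hom_unique'[OF \<Gamma>(1) _ el(2)] p unfolding paired_def lc_def m_def by blast
    then have deg_p: "degree p \<ge> m"
      using nz(2) by (auto intro: le_degree)
    \<comment> \<open>Dividing such a Q by P leaves a remainder with coefficients in J. After
      reduction to k, p divides a nonzero constant, although its degree is at least m > 0.\<close>
    have "\<nexists>Q. paired \<Gamma> Q 1 \<and> poly Q x \<in> J"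
    proof
      assume "\<exists>Q. paired \<Gamma> Q 1 \<and> poly Q x \<in> J"
      then obtain Q where Q: "paired \<Gamma> Q 1" "poly Q x \<in> J" by blast
      have QB: "coeffs_in B Q"
        using Q(1) \<Gamma>(2) unfolding paired_def coeffs_in_def by blast
      obtain n A R where AR: "coeffs_in B A" "coeffs_in B R" "smult (lc ^ n) Q = A * P + R"
          "\<forall>i\<ge>m. coeff R i = 0"
        using pseudo_division[OF B(1), of P Q "Suc (degree Q)"] P QB unfolding lc_def m_def
        by (auto simp: coeff_eq_0)
      have "poly R x = lc ^ n * poly Q x - poly A x * poly P x"
        using arg_cong[OF AR(3), of "\<lambda>Q. poly Q x"] by simp
      also have "\<dots> \<in> J"
        using P Q(2) by (intro ideal_diff ideal_mult) auto
      finally have R: "coeff R i \<in> J" for i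
        using small[OF AR(2)] AR(4) by blast
      obtain \<alpha> where \<alpha>: "paired \<Gamma> A \<alpha>"
        using obtain_paired[OF gc] AR(1) \<Gamma>(2) by blast
      have 1: "paired \<Gamma> ([:lc ^ n:] * Q) ([:l ^ n:] * 1)"
        using el(2) Q(1) by (intro paired_mult[OF gc] paired_const[OF gc] graph_closed_power[OF gc])
      have 2: "paired \<Gamma> (A * P) (\<alpha> * p)"
        using \<alpha> p by (rule paired_mult[OF gc])
      have "[:l ^ n:] * 1 = \<alpha> * p"
      proof (rule poly_eqI)
        fix i
        have "coeff ([:lc ^ n:] * Q) i - coeff (A * P) i \<in> J"
          using R[of i] arg_cong[OF AR(3), of "\<lambda>Q. coeff Q i"] by simp
        then show "coeff ([:l ^ n:] * 1) i = coeff (\<alpha> * p) i"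
          using partial_hom_unique[OF \<Gamma>(1)] 1 2 unfolding paired_def by blast
      qed
      then have "p dvd [:l ^ n:]" by simp
      then have "degree p = 0"
        using dvd_imp_degree_le[of p "[:l ^ n:]"] nz(2) by simp
      with deg_p m show False by simp
    qed
    then obtain c where ph: "partial_hom (adjoin \<Gamma> x c)"
      using partial_hom_extend[OF gc] by blast
    have gc': "graph_closed (adjoin \<Gamma> x c)"
      using ph by (rule partial_hom_graph)
    obtain u where "paired \<Gamma> U u"
      using obtain_paired[OF gc] U(1) \<Gamma>(2) by blast
    then have Uu: "(poly U x, poly u c) \<in> adjoin \<Gamma> x c"
      unfolding adjoin_def by blast
    have "b \<noteq> 0" if "(s, b) \<in> adjoin \<Gamma> x c" for b
    proof -
      have "(\<delta>, e) \<in> adjoin \<Gamma> x c"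
        using el(1) adjoin_superset[OF gc] by blast
      from partial_hom_unique[OF ph this graph_closed_mult[OF gc' Uu that]] U(2) Dx
      show ?thesis
        using nz(1) by auto
    qed
    then show "\<exists>\<Gamma>. partial_hom \<Gamma> \<and> Domain \<Gamma> = {poly P x |P. coeffs_in B P} \<and> (\<forall>c. (s, c) \<in> \<Gamma> \<longrightarrow> c \<noteq> 0)"
      using Domain_adjoin[OF gc, of x c] \<Gamma>(2) ph by blast
  qed
qed

lemma enough_homs_step:
  assumes "subring_over B" "enough_homs B"
  shows "enough_homs {poly P x |P. coeffs_in B P}"
  using enough_homs_transcendental[OF assms, of x] enough_homs_algebraic[OF assms, of _ x] by blast

lemma subring_step:
  assumes "subring_over B"
  shows "subring_over {poly P x |P. coeffs_in B P}"
  unfolding subring_over_def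
proof (intro conjI ballI)
  show "range \<iota> \<subseteq> {poly P x |P. coeffs_in B P}"
    using assms by (auto simp: subring_over_def intro!: exI[of _ "[:\<iota> _:]"] coeffs_in_const)
next
  fix y z assume "y \<in> {poly P x |P. coeffs_in B P}" "z \<in> {poly P x |P. coeffs_in B P}"
  then obtain P Q where *: "coeffs_in B P" "coeffs_in B Q" "y = poly P x" "z = poly Q x" by blast
  show "y + z \<in> {poly P x |P. coeffs_in B P}" "y * z \<in> {poly P x |P. coeffs_in B P}"
    unfolding *(3,4) poly_add[symmetric] poly_mult[symmetric]
    using coeffs_in_add[OF assms *(1,2)] coeffs_in_mult[OF assms *(1,2)] by blast+
qed

lemma exists_enough_homs:
  assumes "finite F"
  shows "\<exists>B. F \<subseteq> B \<and> subring_over B \<and> enough_homs B"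
  using assms
proof induction
  case empty
  define \<Gamma> where "\<Gamma> = range (\<lambda>c. (\<iota> c, c))"
  have gc: "graph_closed \<Gamma>"
    unfolding graph_closed_def \<Gamma>_def by (auto simp: image_iff map_add map_mult)
  have "c = 0" if "\<iota> c \<in> J" for c
    using ideal_mult[OF that, of "\<iota> (inverse c)"] one_notin
    by (cases "c = 0") (auto simp flip: map_mult)
  then have ph: "partial_hom \<Gamma>"
    unfolding partial_hom_def using gc by (auto simp: \<Gamma>_def)
  have D: "Domain \<Gamma> = range \<iota>"
    by (auto simp: \<Gamma>_def)
  have "enough_homs (range \<iota>)"
    unfolding enough_homs_def
  proof
    fix s assume s: "s \<in> range \<iota> - J"
    have "c \<noteq> 0" if "(s, c) \<in> \<Gamma>" for c
      using that s by (auto simp: \<Gamma>_def)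
    with ph D show "\<exists>\<Gamma>. partial_hom \<Gamma> \<and> Domain \<Gamma> = range \<iota> \<and> (\<forall>c. (s, c) \<in> \<Gamma> \<longrightarrow> c \<noteq> 0)"
      by blast
  qed
  then show ?case
    using Domain_subring[OF gc] D by (intro exI[of _ "range \<iota>"]) auto
next
  case (insert x F)
  then obtain B where B: "F \<subseteq> B" "subring_over B" "enough_homs B" by blast
  have "y \<in> {poly P x |P. coeffs_in B P}" if "y \<in> B" for y
    using coeffs_in_const[OF B(2) that] by (auto intro!: exI[of _ "[:y:]"])
  moreover have "x \<in> {poly P x |P. coeffs_in B P}"
    using coeffs_in_monom[OF B(2) subring_1[OF B(2)], of 1] by (auto intro!: exI[of _ "monom 1 1"] simp: poly_monom)
  ultimately show ?case
    using subring_step[OF B(2)] enough_homs_step[OF B(2,3)] B(1)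
    by (intro exI[of _ "{poly P x |P. coeffs_in B P}"]) blast
qed

end

text \<open>An ideal maximal among those containing no power of f is prime: enlarging it by x and by
  y gives powers of f whose product would lie in it if x y did.\<close>

lemma (in algebra_map) exists_prime_ideal:
  assumes f: "\<And>n. f ^ n \<noteq> 0"
  shows "\<exists>J. algebra_map_prime \<iota> J \<and> f \<notin> J"
proof -
  let ?A = "{J. algebra_map_ideal \<iota> J \<and> (\<forall>n. f ^ n \<notin> J)}"
  have "\<exists>M\<in>?A. \<forall>X\<in>?A. M \<subseteq> X \<longrightarrow> X = M"
  proof (rule subset_Zorn_nonempty)
    have "algebra_map_ideal \<iota> {0}"
      by unfold_locales auto
    then show "?A \<noteq> {}"
      using f by blast
    fix C assume C: "C \<noteq> {}" "subset.chain ?A C"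
    have P: "algebra_map_ideal \<iota> X" "f ^ n \<notin> X" if "X \<in> C" for X n
      using C(2) that unfolding subset_chain_def by auto
    have "algebra_map_ideal \<iota> (\<Union>C)"
    proof unfold_locales
      show "0 \<in> \<Union>C"
        using C(1) P(1) algebra_map_ideal.ideal_0 by blast
    next
      fix x y assume "x \<in> \<Union>C" "y \<in> \<Union>C"
      then obtain X Y where XY: "X \<in> C" "Y \<in> C" "x \<in> X" "y \<in> Y" by blast
      then have "X \<subseteq> Y \<or> Y \<subseteq> X"
        using C(2) unfolding subset_chain_def by blast
      then show "x + y \<in> \<Union>C"
        using XY algebra_map_ideal.ideal_add[OF P(1)] by blast
    next
      fix x r assume "x \<in> \<Union>C"
      then show "r * x \<in> \<Union>C"
        using algebra_map_ideal.ideal_mult[OF P(1)] by blast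
    qed
    then show "\<Union>C \<in> ?A"
      using P(2) by blast
  qed
  then obtain J where "J \<in> ?A" and max: "\<forall>X\<in>?A. J \<subseteq> X \<longrightarrow> X = J"
    by (rule bexE)
  then have J: "algebra_map_ideal \<iota> J" and fJ: "\<And>n. f ^ n \<notin> J"
    by auto
  interpret J: algebra_map_ideal \<iota> J by fact
  have meets: "\<exists>n j r. j \<in> J \<and> f ^ n = j + r * x" if x: "x \<notin> J" for x
  proof -
    define X where "X = {j + r * x |j r. j \<in> J}"
    have JX: "J \<subseteq> X"
      unfolding X_def by (metis (mono_tags, lifting) add.right_neutral mem_Collect_eq mult_zero_left subsetI)
    have "x \<in> X"
      unfolding X_def using J.ideal_0 by (metis (mono_tags, lifting) add_0 mem_Collect_eq mult_1)
    have "algebra_map_ideal \<iota> X"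
    proof unfold_locales
      show "0 \<in> X"
        using JX J.ideal_0 by blast
    next
      fix y z assume "y \<in> X" "z \<in> X"
      then obtain j r j' r' where "j \<in> J" "j' \<in> J" "y = j + r * x" "z = j' + r' * x"
        unfolding X_def by blast
      then have "y + z = (j + j') + (r + r') * x" "j + j' \<in> J"
        by (auto simp: algebra_simps J.ideal_add)
      then show "y + z \<in> X"
        unfolding X_def by blast
    next
      fix y s assume "y \<in> X"
      then obtain j r where "j \<in> J" "y = j + r * x"
        unfolding X_def by blast
      then have "s * y = s * j + (s * r) * x" "s * j \<in> J"
        by (auto simp: distrib_left mult.assoc J.ideal_mult)
      then show "s * y \<in> X"
        unfolding X_def by blast
    qed
    moreover have "X \<noteq> J"
      using \<open>x \<in> X\<close> x by blast
    ultimately have "\<exists>n. f ^ n \<in> X"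
      using bspec[OF max, of X] JX by blast
    then show ?thesis
      unfolding X_def by blast
  qed
  have "algebra_map_prime \<iota> J"
  proof unfold_locales
    show "1 \<notin> J"
      using fJ[of 0] by simp
    fix x y assume xy: "x * y \<in> J"
    show "x \<in> J \<or> y \<in> J"
    proof (rule ccontr)
      assume "\<not> (x \<in> J \<or> y \<in> J)"
      then obtain n j r m j' r' where *: "j \<in> J" "f ^ n = j + r * x" "j' \<in> J" "f ^ m = j' + r' * y"
        using meets by metis
      have "f ^ (n + m) = (j' + r' * y) * j + (r * x) * j' + (r * r') * (x * y)"
        unfolding power_add * by (simp add: algebra_simps)
      also have "\<dots> \<in> J"
        using * xy by (intro J.ideal_add[OF J.ideal_add[OF J.ideal_mult J.ideal_mult] J.ideal_mult])
      finally show False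
        using fJ by blast
    qed
  qed
  then show ?thesis
    using fJ[of 1] by auto
qed

lemma (in algebra_map_prime) exists_hom:
  assumes "enough_homs UNIV" "s \<notin> J"
  obtains h where "\<And>x y. h (x + y) = h x + h y" "\<And>x y. h (x * y) = h x * h y" "\<And>c. h (\<iota> c) = c" "h s \<noteq> 0"
proof -
  obtain \<Gamma> where \<Gamma>: "partial_hom \<Gamma>" "Domain \<Gamma> = UNIV" "\<And>c. (s, c) \<in> \<Gamma> \<Longrightarrow> c \<noteq> 0"
    using assms unfolding enough_homs_def by blast
  have gc: "graph_closed \<Gamma>"
    using \<Gamma>(1) by (rule partial_hom_graph)
  have "\<forall>x. \<exists>c. (x, c) \<in> \<Gamma>"
    using \<Gamma>(2) by blast
  then obtain h where h: "\<And>x. (x, h x) \<in> \<Gamma>"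
    by metis
  have uniq: "c = h x" if "(x, c) \<in> \<Gamma>" for x c
    using partial_hom_unique'[OF \<Gamma>(1) that h] .
  show thesis
  proof (rule that)
    show "h (x + y) = h x + h y" for x y
      using uniq[OF graph_closed_add[OF gc h h]] by simp
    show "h (x * y) = h x * h y" for x y
      using uniq[OF graph_closed_mult[OF gc h h]] by simp
    show "h (\<iota> c) = c" for c
      using uniq[OF graph_closed_map[OF gc]] by simp
    show "h s \<noteq> 0"
      using \<Gamma>(3) h by blast
  qed
qed


lemma algebra_map_comm_algebra:
  fixes s :: "'k::alg_closed_field \<Rightarrow> 'a::comm_ring_1 \<Rightarrow> 'a"
  assumes "comm_algebra s"
  shows "algebra_map (\<lambda>c. s c 1)"
proof -
  interpret comm_algebra s by fact
  show ?thesis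
    by unfold_locales (simp_all add: scale_left_distrib scale_mult_left)
qed

text \<open>A prime J avoids f, and a subring with enough homomorphisms that contains the finitely
  many generators is the whole algebra.\<close>

theorem nullstellensatz:
  fixes s :: "'k::alg_closed_field \<Rightarrow> 'a::comm_ring_1 \<Rightarrow> 'a"
  assumes alg: "comm_algebra s" and fg: "finitely_generated_algebra s" and f: "\<And>n. f ^ n \<noteq> 0"
  obtains p where "algebra_hom s (*) p" "p f \<noteq> 0"
proof -
  interpret comm_algebra s by fact
  interpret algebra_map "\<lambda>c. s c 1"
    using alg by (rule algebra_map_comm_algebra)
  have scale: "s c x = s c 1 * x" for c x
    by (simp add: scale_mult_left)
  obtain J where J: "algebra_map_prime (\<lambda>c. s c 1) J" and fJ: "f \<notin> J"
    using exists_prime_ideal f by blast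
  interpret J: algebra_map_prime "\<lambda>c. s c 1" J by fact
  obtain F where F: "finite F" "subalgebra s hull F = UNIV"
    using fg unfolding finitely_generated_algebra_def by blast
  obtain B where B: "F \<subseteq> B" "J.subring_over B" "J.enough_homs B"
    using J.exists_enough_homs[OF F(1)] by blast
  have "subalgebra s B"
    using J.subring_0[OF B(2)] J.subring_1[OF B(2)] J.subring_add[OF B(2)] J.subring_mult[OF B(2)] B(2)
    unfolding subalgebra_def subspace_def J.subring_over_def by (subst scale) blast
  with B(1) have "subalgebra s hull F \<subseteq> B"
    by (rule hull_minimal)
  with F(2) have "B = UNIV" by blast
  then obtain p where p: "\<And>x y. p (x + y) = p x + p y" "\<And>x y. p (x * y) = p x * p y"
      "\<And>c. p (s c 1) = c" "p f \<noteq> 0"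
    using J.exists_hom[OF _ fJ] B(3) by blast
  have "p (s c x) = c * p x" for c x
    by (subst scale) (simp add: p)
  then have "Vector_Spaces.linear s (*) p"
    by (intro linearI vector_space_axioms vector_space_field p(1))
  moreover have "p 1 = 1"
    using p(3)[of 1] by simp
  ultimately have "algebra_hom s (*) p"
    using p(2) by (simp add: algebra_hom_def)
  then show thesis
    using p(4) by (rule that)
qed

section \<open>Comodules\<close>

text \<open>The device that turns identities in tensor products into identities of operators: a form
  that factors on pure tensors is evaluated by contracting one factor first.\<close>

lemma tensor_lift_eval:
  fixes sU :: "'k::field \<Rightarrow> 'u::ab_group_add \<Rightarrow> 'u"
  assumes F: "bilinear_map sV sW sU F" and \<Phi>: "Vector_Spaces.linear sU (*) \<Phi>"
    and \<chi>: "Vector_Spaces.linear sV (*) \<chi>" and c: "Vector_Spaces.linear sW (*) c"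
    and eval: "\<And>v w. \<Phi> (F v w) = \<chi> v * c w" and t: "t \<in> tensor_space sV sW"
  shows "\<Phi> (tensor_lift sV sW F t) = \<chi> (contract sV sW c t)"
proof -
  note V = linear_vector_spaces(1)[OF \<chi>] and W = linear_vector_spaces(1)[OF c]
  obtain I :: "nat set" and f g where I: "finite I" "t = (\<Sum>i\<in>I. pure_tensor sV sW (f i) (g i))"
    using tensor_space_obtain[OF V W t] .
  show ?thesis
    unfolding I(2) tensor_lift_sum[OF linear_vector_spaces(1)[OF \<Phi>] F I(1)] contract_sum[OF V c I(1)]
    by (simp add: linear_sum[OF \<Phi>] linear_sum[OF \<chi>] linear_scale[OF \<chi>] eval mult.commute)
qed

lemma linear_tensor_lift_compose:
  fixes sU :: "'k::field \<Rightarrow> 'u::ab_group_add \<Rightarrow> 'u"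
  assumes W: "vector_space sW" and V: "vector_space sV" and U: "vector_space sU"
    and P: "bilinear_map sV sW sU P"
    and \<rho>: "Vector_Spaces.linear sX fun_scale \<rho>" "range \<rho> \<subseteq> tensor_space sV sW"
  shows "Vector_Spaces.linear sX sU (\<lambda>m. tensor_lift sV sW P (\<rho> m))"
proof (rule linearI[OF linear_vector_spaces(1)[OF \<rho>(1)] U])
  have mem: "\<rho> x \<in> tensor_space sV sW" for x
    using \<rho>(2) by blast
  show "tensor_lift sV sW P (\<rho> (x + y)) = tensor_lift sV sW P (\<rho> x) + tensor_lift sV sW P (\<rho> y)" for x y
    unfolding linear_add[OF \<rho>(1)] by (rule linear_tensor_lift(1)[OF V W U P mem mem])
  show "tensor_lift sV sW P (\<rho> (sX c x)) = sU c (tensor_lift sV sW P (\<rho> x))" for c x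
    unfolding linear_scale[OF \<rho>(1)] by (rule linear_tensor_lift(2)[OF V W U P mem mem])
qed

lemma linear_tensor_lift_parameter:
  fixes sU :: "'k::field \<Rightarrow> 'u::ab_group_add \<Rightarrow> 'u"
  assumes V: "vector_space sV" and W: "vector_space sW" and U: "vector_space sU" and X: "vector_space sX"
    and P: "\<And>h. bilinear_map sV sW sU (\<lambda>v w. P v w h)"
    and lin: "\<And>v w. Vector_Spaces.linear sX sU (P v w)" and t: "t \<in> tensor_space sV sW"
  shows "Vector_Spaces.linear sX sU (\<lambda>h. tensor_lift sV sW (\<lambda>v w. P v w h) t)"
proof -
  interpret U: vector_space sU by fact
  obtain I :: "nat set" and f g where I: "finite I" "t = (\<Sum>i\<in>I. pure_tensor sV sW (f i) (g i))"
    using tensor_space_obtain[OF V W t] .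
  show ?thesis
    unfolding I(2) tensor_lift_sum[OF U P I(1)]
    by (rule linearI[OF X U])
      (simp_all add: linear_add[OF lin] linear_scale[OF lin] sum.distrib U.scale_sum_right)
qed

lemma pure_tensor3_linear:
  assumes U: "vector_space sU" and V: "vector_space sV" and W: "vector_space sW"
  shows "Vector_Spaces.linear sU fun_scale (\<lambda>u. pure_tensor3 sU sV sW u v w)"
    and "Vector_Spaces.linear sV fun_scale (\<lambda>v. pure_tensor3 sU sV sW u v w)"
    and "Vector_Spaces.linear sW fun_scale (\<lambda>w. pure_tensor3 sU sV sW u v w)"
proof -
  have 1: "\<tau> (x + x') v w = \<tau> x v w + \<tau> x' v w" "\<tau> (sU c x) v w = c * \<tau> x v w"
    if "trilinear_form sU sV sW \<tau>" for \<tau> x x' v w c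
    using that linear_add[of sU "(*)" "\<lambda>u. \<tau> u v w"] linear_scale[of sU "(*)" "\<lambda>u. \<tau> u v w"]
    unfolding trilinear_form_def by auto
  have 2: "\<tau> u (x + x') w = \<tau> u x w + \<tau> u x' w" "\<tau> u (sV c x) w = c * \<tau> u x w"
    if "trilinear_form sU sV sW \<tau>" for \<tau> u x x' w c
    using that linear_add[of sV "(*)" "\<lambda>v. \<tau> u v w"] linear_scale[of sV "(*)" "\<lambda>v. \<tau> u v w"]
    unfolding trilinear_form_def by auto
  have 3: "\<tau> u v (x + x') = \<tau> u v x + \<tau> u v x'" "\<tau> u v (sW c x) = c * \<tau> u v x"
    if "trilinear_form sU sV sW \<tau>" for \<tau> u v x x' c
    using that linear_add[of sW "(*)" "\<tau> u v"] linear_scale[of sW "(*)" "\<tau> u v"]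
    unfolding trilinear_form_def by auto
  show "Vector_Spaces.linear sU fun_scale (\<lambda>u. pure_tensor3 sU sV sW u v w)"
    by (rule linearI[OF U vector_space_fun_scale]) (auto simp: pure_tensor3_def fun_scale_def 1)
  show "Vector_Spaces.linear sV fun_scale (\<lambda>v. pure_tensor3 sU sV sW u v w)"
    by (rule linearI[OF V vector_space_fun_scale]) (auto simp: pure_tensor3_def fun_scale_def 2)
  show "Vector_Spaces.linear sW fun_scale (\<lambda>w. pure_tensor3 sU sV sW u v w)"
    by (rule linearI[OF W vector_space_fun_scale]) (auto simp: pure_tensor3_def fun_scale_def 3)
qed

lemma trilinear_form_product:
  assumes \<psi>: "Vector_Spaces.linear sU (*) \<psi>" and \<mu>: "Vector_Spaces.linear sV (*) \<mu>"
    and \<nu>: "Vector_Spaces.linear sW (*) \<nu>"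
  shows "trilinear_form sU sV sW (\<lambda>u v w. \<psi> u * \<mu> v * \<nu> w)"
  unfolding trilinear_form_def
  using linear_vector_spaces(1)[OF \<psi>] linear_vector_spaces(1)[OF \<mu>] linear_vector_spaces(1)[OF \<nu>]
  by (auto intro!: linearI vector_space_field
    simp: linear_add[OF \<psi>] linear_scale[OF \<psi>] linear_add[OF \<mu>] linear_scale[OF \<mu>]
      linear_add[OF \<nu>] linear_scale[OF \<nu>] algebra_simps)

lemma linear_apply: "Vector_Spaces.linear fun_scale (*) (\<lambda>F. F \<tau>)"
  by (rule linearI[OF vector_space_fun_scale vector_space_field]) (auto simp: fun_scale_def)

lemma linear_mult_left:
  assumes "Vector_Spaces.linear s (*) \<psi>"
  shows "Vector_Spaces.linear s (*) (\<lambda>x. c * \<psi> x)"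
  by (rule linearI[OF linear_vector_spaces[OF assms]])
    (simp_all add: linear_add[OF assms] linear_scale[OF assms] algebra_simps)

lemma linear_compose_form:
  "Vector_Spaces.linear s t f \<Longrightarrow> Vector_Spaces.linear t u g \<Longrightarrow> Vector_Spaces.linear s u (\<lambda>x. g (f x))"
  by (rule linearI[OF linear_vector_spaces(1) linear_vector_spaces(2)])
    (auto simp: linear_add linear_scale)

lemma eq_if_forms_eq:
  assumes "vector_space s" "\<And>\<psi>. Vector_Spaces.linear s (*) \<psi> \<Longrightarrow> \<psi> x = (\<psi> y :: 'k::field)"
  shows "x = y"
proof (rule ccontr)
  assume "x \<noteq> y"
  then obtain \<psi> where \<psi>: "Vector_Spaces.linear s (*) \<psi>" "\<psi> (x - y) \<noteq> 0"
    using linear_functional_separates[OF assms(1), of "x - y"] by auto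
  then show False
    using assms(2)[OF \<psi>(1)] linear_diff[OF \<psi>(1)] by simp
qed

section \<open>Linear forms on the coordinate ring as operators on a comodule\<close>

locale group_comodule =
  fixes G :: "('k::field, 'g::comm_ring_1) group_scheme"
    and sM :: "'k \<Rightarrow> 'm::ab_group_add \<Rightarrow> 'm" and \<rho> :: "'m \<Rightarrow> ('k, 'm, 'g) tensor"
  assumes scheme: "affine_group_scheme G" and comodule: "is_comodule G sM \<rho>"
begin

abbreviation "sG \<equiv> gscale G"

lemma vector_space_G: "vector_space sG"
  using scheme unfolding affine_group_scheme_def comm_algebra_def by blast

lemma vector_space_M: "vector_space sM"
  using comodule unfolding is_comodule_def by blast

sublocale M: vector_space sM by (rule vector_space_M)
sublocale K: vector_space sG by (rule vector_space_G)

lemma coaction_linear: "Vector_Spaces.linear sM fun_scale \<rho>"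
  using comodule unfolding is_comodule_def by blast

lemma coaction_range: "range \<rho> \<subseteq> tensor_space sM sG"
  using comodule unfolding is_comodule_def by blast

lemma coaction_in: "\<rho> x \<in> tensor_space sM sG"
  using coaction_range by blast

definition act :: "('g \<Rightarrow> 'k) \<Rightarrow> 'm \<Rightarrow> 'm"
  where "act \<mu> x = contract sM sG \<mu> (\<rho> x)"

lemma act_linear:
  assumes "Vector_Spaces.linear sG (*) \<mu>"
  shows "Vector_Spaces.linear sM sM (act \<mu>)"
  unfolding act_def contract_def
  by (rule linear_tensor_lift_compose[OF vector_space_G vector_space_M vector_space_M
    bilinear_contract[OF vector_space_M assms] coaction_linear coaction_range])

lemma counit_linear: "Vector_Spaces.linear sG (*) (counit G)"
  using scheme unfolding affine_group_scheme_def algebra_hom_def by blast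

lemma act_counit: "act (counit G) x = x"
  using comodule unfolding is_comodule_def act_def contract_def by blast

lemma comult_linear: "Vector_Spaces.linear sG fun_scale (comult G)"
  and comult_range: "range (comult G) \<subseteq> tensor_space sG sG"
  using scheme unfolding affine_group_scheme_def algebra_hom_tensor_def by blast+

text \<open>The product of the dual algebra of k[G], which on points is the group law of
  \<open>points G\<close>.\<close>

definition conv :: "('g \<Rightarrow> 'k) \<Rightarrow> ('g \<Rightarrow> 'k) \<Rightarrow> 'g \<Rightarrow> 'k"
  where "conv \<mu> \<nu> f = tensor_lift sG sG (\<lambda>x y. \<mu> x * \<nu> y) (comult G f)"

lemma bilinear_product:
  assumes \<mu>: "Vector_Spaces.linear sG (*) \<mu>" and \<nu>: "Vector_Spaces.linear sG (*) \<nu>"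
  shows "bilinear_map sG sG (*) (\<lambda>x y. \<mu> x * \<nu> y)"
  by (rule bilinear_mapI[OF vector_space_G vector_space_G vector_space_field])
    (simp_all add: linear_add[OF \<mu>] linear_scale[OF \<mu>] linear_add[OF \<nu>] linear_scale[OF \<nu>] algebra_simps)

lemma linear_id_form: "Vector_Spaces.linear (*) (*) (\<lambda>x :: 'k. x)"
  by (rule linearI[OF vector_space_field vector_space_field]) auto

lemma conv_eq:
  assumes \<mu>: "Vector_Spaces.linear sG (*) \<mu>" and \<nu>: "Vector_Spaces.linear sG (*) \<nu>"
  shows "conv \<mu> \<nu> f = \<mu> (contract sG sG \<nu> (comult G f))"
  unfolding conv_def using comult_range
  by (intro tensor_lift_eval[OF bilinear_product[OF \<mu> \<nu>] linear_id_form \<mu> \<nu>]) auto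

lemma conv_linear:
  assumes \<mu>: "Vector_Spaces.linear sG (*) \<mu>" and \<nu>: "Vector_Spaces.linear sG (*) \<nu>"
  shows "Vector_Spaces.linear sG (*) (conv \<mu> \<nu>)"
  unfolding conv_def
  by (rule linear_tensor_lift_compose[OF vector_space_G vector_space_G vector_space_field
    bilinear_product[OF \<mu> \<nu>] comult_linear comult_range])

text \<open>P is left abstract so that the same computation serves for the comodule law and, with
  its last two arguments exchanged, for commuting coactions.\<close>

lemma iterated_coaction_eval:
  fixes sH :: "'k \<Rightarrow> 'h::ab_group_add \<Rightarrow> 'h" and sU :: "'k \<Rightarrow> 'u::ab_group_add \<Rightarrow> 'u"
  assumes H: "vector_space sH" and t: "t \<in> tensor_space sM sH"
    and P1: "\<And>g h. Vector_Spaces.linear sM sU (\<lambda>m. P m g h)"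
    and P2: "\<And>m h. Vector_Spaces.linear sG sU (\<lambda>g. P m g h)"
    and P3: "\<And>m g. Vector_Spaces.linear sH sU (P m g)"
    and \<Phi>: "Vector_Spaces.linear sU (*) \<Phi>" and \<psi>: "Vector_Spaces.linear sM (*) \<psi>"
    and \<mu>: "Vector_Spaces.linear sG (*) \<mu>" and \<nu>: "Vector_Spaces.linear sH (*) \<nu>"
    and eval: "\<And>m g h. \<Phi> (P m g h) = \<psi> m * \<mu> g * \<nu> h"
  shows "\<Phi> (tensor_lift sM sH (\<lambda>m h. tensor_lift sM sG (\<lambda>m' g. P m' g h) (\<rho> m)) t) =
    \<psi> (act \<mu> (contract sM sH \<nu> t))"
proof -
  note U = linear_vector_spaces(1)[OF \<Phi>]
  have Ph: "bilinear_map sM sG sU (\<lambda>m g. P m g h)" for h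
    unfolding bilinear_map_def using P1 P2 by blast
  have "bilinear_map sM sH sU (\<lambda>m h. tensor_lift sM sG (\<lambda>m' g. P m' g h) (\<rho> m))"
    unfolding bilinear_map_def
    using linear_tensor_lift_compose[OF vector_space_G vector_space_M U Ph coaction_linear coaction_range]
      linear_tensor_lift_parameter[OF vector_space_M vector_space_G U H Ph P3 coaction_in] by blast
  moreover have "\<Phi> (tensor_lift sM sG (\<lambda>m' g. P m' g h) (\<rho> m)) = \<psi> (act \<mu> m) * \<nu> h" for m h
    using tensor_lift_eval[OF Ph \<Phi> linear_mult_left[OF \<psi>, of "\<nu> h"] \<mu> _ coaction_in] eval
    unfolding act_def by (simp add: mult_ac)
  ultimately show ?thesis
    by (rule tensor_lift_eval[OF _ \<Phi> linear_compose_form[OF act_linear[OF \<mu>] \<psi>] \<nu> _ t])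
qed

text \<open>Both sides of the comodule law are evaluated at the trilinear form \<psi> \<mu> \<nu>;
  thus a comodule is a module over the dual algebra.\<close>

lemma act_act:
  assumes \<mu>: "Vector_Spaces.linear sG (*) \<mu>" and \<nu>: "Vector_Spaces.linear sG (*) \<nu>"
  shows "act \<mu> (act \<nu> x) = act (conv \<mu> \<nu>) x"
proof (rule eq_if_forms_eq[OF vector_space_M])
  fix \<psi> assume \<psi>: "Vector_Spaces.linear sM (*) \<psi>"
  define \<tau> where "\<tau> = (\<lambda>m g h. \<psi> m * \<mu> g * \<nu> h)"
  have \<tau>: "trilinear_form sM sG sG \<tau>"
    unfolding \<tau>_def by (rule trilinear_form_product[OF \<psi> \<mu> \<nu>])
  define P where "P = pure_tensor3 sM sG sG"
  note pl = pure_tensor3_linear[OF vector_space_M vector_space_G vector_space_G, folded P_def]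
  have eval: "P m g h \<tau> = \<psi> m * \<mu> g * \<nu> h" for m g h
    using \<tau> by (simp add: P_def pure_tensor3_def \<tau>_def)
  have "\<psi> (act \<mu> (act \<nu> x)) =
      tensor_lift sM sG (\<lambda>m h. tensor_lift sM sG (\<lambda>m' g. P m' g h) (\<rho> m)) (\<rho> x) \<tau>"
    using iterated_coaction_eval[where P = P and \<Phi> = "\<lambda>F. F \<tau>", OF vector_space_G coaction_in pl linear_apply \<psi> \<mu> \<nu> eval]
    unfolding act_def by simp
  also have "\<dots> = tensor_lift sM sG (\<lambda>m g. tensor_lift sG sG (\<lambda>g' g''. P m g' g'') (comult G g)) (\<rho> x) \<tau>"
    using comodule unfolding is_comodule_def P_def by metis
  also have "\<dots> = \<psi> (act (conv \<mu> \<nu>) x)"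
    unfolding act_def
  proof (rule tensor_lift_eval[OF _ linear_apply \<psi> conv_linear[OF \<mu> \<nu>] _ coaction_in])
    have Pm: "bilinear_map sG sG fun_scale (P m)" for m
      unfolding bilinear_map_def using pl by blast
    have "Vector_Spaces.linear sM fun_scale (\<lambda>m. tensor_lift sG sG (P m) (comult G g))" for g
      using linear_tensor_lift_parameter[OF vector_space_G vector_space_G vector_space_fun_scale
        vector_space_M, of "\<lambda>g g' m. P m g g'"] Pm pl(1) comult_range by blast
    then show "bilinear_map sM sG fun_scale (\<lambda>m g. tensor_lift sG sG (P m) (comult G g))"
      unfolding bilinear_map_def
      using linear_tensor_lift_compose[OF vector_space_G vector_space_G vector_space_fun_scale Pm
        comult_linear comult_range] by blast
    fix m g
    have "comult G g \<in> tensor_space sG sG"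
      using comult_range by blast
    from tensor_lift_eval[OF Pm linear_apply linear_mult_left[OF \<mu>, of "\<psi> m"] \<nu> _ this, of m \<tau>]
    show "tensor_lift sG sG (P m) (comult G g) \<tau> = \<psi> m * conv \<mu> \<nu> g"
      unfolding conv_eq[OF \<mu> \<nu>] eval by simp
  qed
  finally show "\<psi> (act \<mu> (act \<nu> x)) = \<psi> (act (conv \<mu> \<nu>) x)" .
qed

end

text \<open>The two orders of applying the coactions are compared at the trilinear form \<psi> \<mu>
  \<nu>.\<close>

lemma commuting_act:
  assumes \<rho>: "group_comodule G sM \<rho>" and \<sigma>: "group_comodule H sM \<sigma>"
    and comm: "commuting_comodules G H sM \<rho> \<sigma>"
    and \<mu>: "Vector_Spaces.linear (gscale G) (*) \<mu>" and \<nu>: "Vector_Spaces.linear (gscale H) (*) \<nu>"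
  shows "group_comodule.act G sM \<rho> \<mu> (group_comodule.act H sM \<sigma> \<nu> x) =
    group_comodule.act H sM \<sigma> \<nu> (group_comodule.act G sM \<rho> \<mu> x)"
proof -
  interpret A: group_comodule G sM \<rho> by fact
  interpret B: group_comodule H sM \<sigma> by fact
  show ?thesis
  proof (rule eq_if_forms_eq[OF A.vector_space_M])
    fix \<psi> assume \<psi>: "Vector_Spaces.linear sM (*) \<psi>"
    define \<tau> where "\<tau> = (\<lambda>m g h. \<psi> m * \<mu> g * \<nu> h)"
    have \<tau>: "trilinear_form sM A.sG B.sG \<tau>"
      unfolding \<tau>_def by (rule trilinear_form_product[OF \<psi> \<mu> \<nu>])
    define P where "P = pure_tensor3 sM A.sG B.sG"
    note pl = pure_tensor3_linear[OF A.vector_space_M A.vector_space_G B.vector_space_G, folded P_def]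
    have eval: "P m g h \<tau> = \<psi> m * \<mu> g * \<nu> h" for m g h
      using \<tau> by (simp add: P_def pure_tensor3_def \<tau>_def)
    have eval': "P m g h \<tau> = \<psi> m * \<nu> h * \<mu> g" for m g h
      unfolding eval by simp
    have "\<psi> (A.act \<mu> (B.act \<nu> x)) =
        tensor_lift sM B.sG (\<lambda>m h. tensor_lift sM A.sG (\<lambda>m' g. P m' g h) (\<rho> m)) (\<sigma> x) \<tau>"
      using A.iterated_coaction_eval[where P = P and \<Phi> = "\<lambda>F. F \<tau>", OF B.vector_space_G B.coaction_in pl linear_apply \<psi> \<mu> \<nu> eval]
      unfolding B.act_def by simp
    also have "\<dots> = tensor_lift sM A.sG (\<lambda>m g. tensor_lift sM B.sG (\<lambda>m' h. P m' g h) (\<sigma> m)) (\<rho> x) \<tau>"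
      using comm unfolding commuting_comodules_def P_def by metis
    also have "\<dots> = \<psi> (B.act \<nu> (A.act \<mu> x))"
      using B.iterated_coaction_eval[where P = "\<lambda>m h g. P m g h" and \<Phi> = "\<lambda>F. F \<tau>",
        OF A.vector_space_G A.coaction_in pl(1,3,2) linear_apply \<psi> \<nu> \<mu> eval']
      unfolding A.act_def by simp
    finally show "\<psi> (A.act \<mu> (B.act \<nu> x)) = \<psi> (B.act \<nu> (A.act \<mu> x))" .
  qed
qed

lemma tensor_mult_sum:
  fixes sA :: "'k::field \<Rightarrow> 'a::comm_ring_1 \<Rightarrow> 'a" and sB :: "'k \<Rightarrow> 'b::comm_ring_1 \<Rightarrow> 'b"
  assumes A: "comm_algebra sA" and B: "comm_algebra sB" and I: "finite I" and J: "finite J"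
  shows "tensor_mult sA sB (\<Sum>i\<in>I. pure_tensor sA sB (a i) (g i)) (\<Sum>j\<in>J. pure_tensor sA sB (y j) (q j)) =
    (\<Sum>i\<in>I. \<Sum>j\<in>J. pure_tensor sA sB (a i * y j) (g i * q j))"
proof -
  interpret A: comm_algebra sA by fact
  interpret B: comm_algebra sB by fact
  note VA = A.vector_space_axioms and VB = B.vector_space_axioms and F = vector_space_fun_scale
  have smult: "x * sA c y = sA c (x * y)" "x' * sB c y' = sB c (x' * y')" for c x y x' y'
    using A.scale_mult_left[of c y x] B.scale_mult_left[of c y' x'] by (simp_all add: mult.commute)
  note pl = pure_tensor_linear[OF VA VB]
  let ?t = "\<Sum>j\<in>J. pure_tensor sA sB (y j) (q j)"
  have inner: "bilinear_map sA sB fun_scale (\<lambda>a' b'. pure_tensor sA sB (a * a') (b * b'))" for a b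
    by (rule bilinear_mapI[OF VA VB F]) (simp_all add: distrib_left smult pl del: plus_fun_apply)
  have lin: "Vector_Spaces.linear sA fun_scale (\<lambda>a. pure_tensor sA sB (a * a') (b * b'))"
    "Vector_Spaces.linear sB fun_scale (\<lambda>b. pure_tensor sA sB (a * a') (b * b'))" for a b a' b'
    by (rule linearI[OF VA F] linearI[OF VB F];
      simp add: distrib_right A.scale_mult_left B.scale_mult_left pl del: plus_fun_apply)+
  have "bilinear_map sA sB fun_scale
      (\<lambda>a b. tensor_lift sA sB (\<lambda>a' b'. pure_tensor sA sB (a * a') (b * b')) ?t)"
    unfolding bilinear_map_def
    using linear_tensor_lift_parameter[OF VA VB F VA, of "\<lambda>a' b' a. pure_tensor sA sB (a * a') (_ * b')"]
      linear_tensor_lift_parameter[OF VA VB F VB, of "\<lambda>a' b' b. pure_tensor sA sB (_ * a') (b * b')"]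
      inner lin sum_pure_in_tensor_space by blast
  then show ?thesis
    unfolding tensor_mult_def by (simp only: tensor_lift_sum[OF F _ I] tensor_lift_sum[OF F inner J])
qed

section \<open>The coordinate ring of a connected group\<close>

text \<open>A basis of S extends to one of T, and finiteness turns equal cardinality into equality.
  The ambient space may be infinite-dimensional, so a finite B must bound T.\<close>

lemma (in vector_space) subspace_eq_if_dim_le:
  assumes S: "subspace S" and T: "S \<subseteq> T" "T \<subseteq> span B" "finite B" and dim: "dim T \<le> dim S"
  shows "S = T"
proof -
  obtain C where C: "C \<subseteq> S" "independent C" "S \<subseteq> span C" "card C = dim S"
    using basis_exists by blast
  obtain D where D: "C \<subseteq> D" "D \<subseteq> T" "independent D" "T \<subseteq> span D"
    using maximal_independent_subset_extend[of C T] C T(1) by blast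
  have "finite D"
    using independent_span_bound[OF T(3) D(3)] D(2) T(2) by blast
  moreover have "card D = dim T"
    using basis_card_eq_dim[OF D(2,4,3)] by simp
  ultimately have "C = D"
    using card_seteq[of D C] D(1) C(4) dim by simp
  then have "T \<subseteq> span C"
    using D(4) by simp
  then show ?thesis
    using span_minimal[OF C(1) S] T(1) by blast
qed

locale group_action =
  fixes G :: "('k::field, 'g::comm_ring_1) group_scheme"
    and sA :: "'k \<Rightarrow> 'a::comm_ring_1 \<Rightarrow> 'a" and \<rho> :: "'a \<Rightarrow> ('k, 'a, 'g) tensor"
  assumes scheme: "affine_group_scheme G" and acts: "acts_on_algebra G sA \<rho>"
begin

sublocale group_comodule G sA \<rho>
  using scheme acts by unfold_locales (simp_all add: acts_on_algebra_def)

lemma comm_algebra_A: "comm_algebra sA"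
  using acts by (simp add: acts_on_algebra_def)

lemma comm_algebra_G: "comm_algebra sG"
  using scheme by (simp add: affine_group_scheme_def)

lemma coaction_hom: "algebra_hom_tensor sA sA sG \<rho>"
  using acts by (simp add: acts_on_algebra_def)

lemma coaction_mult: "\<rho> (x * y) = tensor_mult sA sG (\<rho> x) (\<rho> y)"
  using coaction_hom by (simp add: algebra_hom_tensor_def)

lemma act_mult_sum:
  assumes I: "finite I" "\<rho> x = (\<Sum>i\<in>I. pure_tensor sA sG (a i) (g i))"
    and J: "finite J" "\<rho> y = (\<Sum>j\<in>J. pure_tensor sA sG (b j) (q j))"
    and \<mu>: "Vector_Spaces.linear sG (*) \<mu>"
  shows "act \<mu> (x * y) = (\<Sum>i\<in>I. \<Sum>j\<in>J. sA (\<mu> (g i * q j)) (a i * b j))"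
proof -
  have "\<rho> (x * y) = (\<Sum>i\<in>I. \<Sum>j\<in>J. pure_tensor sA sG (a i * b j) (g i * q j))"
    unfolding coaction_mult I(2) J(2) by (rule tensor_mult_sum[OF comm_algebra_A comm_algebra_G I(1) J(1)])
  also have "\<dots> = (\<Sum>z\<in>I \<times> J. pure_tensor sA sG (a (fst z) * b (snd z)) (g (fst z) * q (snd z)))"
    by (simp only: sum.cartesian_product case_prod_unfold)
  finally have "act \<mu> (x * y) = (\<Sum>z\<in>I \<times> J. sA (\<mu> (g (fst z) * q (snd z))) (a (fst z) * b (snd z)))"
    unfolding act_def by (simp only: contract_sum[OF vector_space_M \<mu> finite_cartesian_product[OF I(1) J(1)]])
  then show ?thesis
    by (simp add: sum.cartesian_product case_prod_unfold)
qed

text \<open>Unlike general forms, points act multiplicatively: the double sum factors because p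
  does.\<close>

lemma act_point_mult:
  assumes p: "algebra_hom sG (*) p"
  shows "act p (x * y) = act p x * act p y"
proof -
  interpret A: comm_algebra sA by (rule comm_algebra_A)
  have lin: "Vector_Spaces.linear sG (*) p" and mult: "\<And>x y. p (x * y) = p x * p y"
    using p by (auto simp: algebra_hom_def)
  obtain I :: "nat set" and a g where I: "finite I" "\<rho> x = (\<Sum>i\<in>I. pure_tensor sA sG (a i) (g i))"
    using tensor_space_obtain[OF vector_space_M vector_space_G coaction_in] .
  obtain J :: "nat set" and b q where J: "finite J" "\<rho> y = (\<Sum>i\<in>J. pure_tensor sA sG (b i) (q i))"
    using tensor_space_obtain[OF vector_space_M vector_space_G coaction_in] .
  have *: "sA c u * sA d v = sA (c * d) (u * v)" for c d u v
    by (metis A.scale_mult_left M.scale_scale mult.commute)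
  show ?thesis
    unfolding act_mult_sum[OF I J lin] mult
    by (simp add: act_def I J contract_sum[OF vector_space_M lin] sum_product *)
qed

end

lemma group_action_regular:
  assumes "affine_group_scheme G"
  shows "group_action G (gscale G) (comult G)"
  using assms by unfold_locales (simp_all add: affine_group_scheme_def acts_on_algebra_def)

section \<open>Points of the group and translation of functions\<close>

locale affine_group =
  fixes G :: "('k::field, 'g::comm_ring_1) group_scheme"
  assumes affine: "affine_group_scheme G"
begin

sublocale group_action G "gscale G" "comult G"
  using affine by (rule group_action_regular)

definition point :: "('g \<Rightarrow> 'k) \<Rightarrow> bool"
  where "point p \<longleftrightarrow> algebra_hom sG (*) p"

lemma point_linear: "point p \<Longrightarrow> Vector_Spaces.linear sG (*) p"
  and point_mult: "point p \<Longrightarrow> p (x * y) = p x * p y"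
  and point_1: "point p \<Longrightarrow> p 1 = 1"
  by (simp_all add: point_def algebra_hom_def)

lemma point_0: "point p \<Longrightarrow> p 0 = 0"
  using linear_zero[OF point_linear] .

lemma point_counit: "point (counit G)"
  using affine by (simp add: point_def affine_group_scheme_def)

lemma antipode_hom: "algebra_hom sG sG (antipode G)"
  using affine by (simp add: affine_group_scheme_def)

lemma antipode_linear: "Vector_Spaces.linear sG sG (antipode G)"
  using antipode_hom by (simp add: algebra_hom_def)

lemma comult_in: "comult G f \<in> tensor_space sG sG"
  using comult_range by blast

lemma conv_act: "point p \<Longrightarrow> point q \<Longrightarrow> conv p q f = p (act q f)"
  unfolding act_def by (rule conv_eq[OF point_linear point_linear])

lemma point_conv:
  assumes p: "point p" and q: "point q"
  shows "point (conv p q)"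
proof -
  have "comult G 1 = (\<Sum>i\<in>{0::nat}. pure_tensor sG sG 1 1)"
    using affine by (simp add: affine_group_scheme_def algebra_hom_tensor_def)
  then have "act q 1 = 1"
    unfolding act_def by (simp only: contract_sum[OF vector_space_G point_linear[OF q] finite.insertI[OF finite.emptyI]])
      (simp add: point_1[OF q])
  then show ?thesis
    unfolding point_def algebra_hom_def
    using conv_linear[OF point_linear[OF p] point_linear[OF q]] q
    by (simp add: conv_act[OF p q] point_1[OF p] point_mult[OF p] act_point_mult point_def)
qed

definition inverse_point :: "('g \<Rightarrow> 'k) \<Rightarrow> 'g \<Rightarrow> 'k"
  where "inverse_point p f = p (antipode G f)"

lemma point_inverse:
  assumes "point p"
  shows "point (inverse_point p)"
  using antipode_hom linear_compose_form[OF antipode_linear point_linear[OF assms]]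
  by (simp add: point_def algebra_hom_def inverse_point_def[abs_def] point_1[OF assms] point_mult[OF assms])

lemma conv_inverse:
  assumes p: "point p"
  shows "conv p (inverse_point p) = counit G" and "conv (inverse_point p) p = counit G"
proof -
  note lp = point_linear[OF p] and li = point_linear[OF point_inverse[OF p]]
  interpret G: comm_algebra sG by (rule comm_algebra_G)
  have smult: "x * sG c y = sG c (x * y)" for c x y
    using G.scale_mult_left[of c y x] by (simp add: mult.commute)
  have b1: "bilinear_map sG sG sG (\<lambda>x y. x * antipode G y)"
    by (rule bilinear_mapI[OF vector_space_G vector_space_G vector_space_G])
      (simp_all add: algebra_simps G.scale_mult_left smult linear_add[OF antipode_linear] linear_scale[OF antipode_linear])
  have b2: "bilinear_map sG sG sG (\<lambda>x y. antipode G x * y)"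
    by (rule bilinear_mapI[OF vector_space_G vector_space_G vector_space_G])
      (simp_all add: algebra_simps G.scale_mult_left smult linear_add[OF antipode_linear] linear_scale[OF antipode_linear])
  have e: "p (sG (counit G f) 1) = counit G f" for f
    by (simp add: linear_scale[OF lp] point_1[OF p])
  show "conv p (inverse_point p) = counit G"
  proof
    fix f
    have "p (tensor_lift sG sG (\<lambda>x y. x * antipode G y) (comult G f)) = conv p (inverse_point p) f"
      unfolding conv_eq[OF lp li]
      by (rule tensor_lift_eval[OF b1 lp lp li _ comult_in]) (simp add: point_mult[OF p] inverse_point_def)
    moreover have "tensor_lift sG sG (\<lambda>x y. x * antipode G y) (comult G f) = sG (counit G f) 1"
      using affine by (simp add: affine_group_scheme_def)
    ultimately show "conv p (inverse_point p) f = counit G f"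
      using e by simp
  qed
  show "conv (inverse_point p) p = counit G"
  proof
    fix f
    have "p (tensor_lift sG sG (\<lambda>x y. antipode G x * y) (comult G f)) = conv (inverse_point p) p f"
      unfolding conv_eq[OF li lp]
      by (rule tensor_lift_eval[OF b2 lp li lp _ comult_in]) (simp add: point_mult[OF p] inverse_point_def)
    moreover have "tensor_lift sG sG (\<lambda>x y. antipode G x * y) (comult G f) = sG (counit G f) 1"
      using affine by (simp add: affine_group_scheme_def)
    ultimately show "conv (inverse_point p) p f = counit G f"
      using e by simp
  qed
qed

lemma act_inverse:
  assumes p: "point p"
  shows "act p (act (inverse_point p) f) = f" and "act (inverse_point p) (act p f) = f"
  using act_act[OF point_linear[OF p] point_linear[OF point_inverse[OF p]]]
    act_act[OF point_linear[OF point_inverse[OF p]] point_linear[OF p]] conv_inverse[OF p] act_counit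
  by simp_all

text \<open>The left counit law: a function translated by p and evaluated at the identity is its
  value at p.\<close>

lemma counit_act:
  assumes p: "point p"
  shows "counit G (act p f) = p f"
proof -
  interpret G: comm_algebra sG by (rule comm_algebra_G)
  have b: "bilinear_map sG sG sG (\<lambda>x y. sG (counit G x) y)"
    by (rule bilinear_mapI[OF vector_space_G vector_space_G vector_space_G])
      (simp_all add: M.scale_left_distrib M.scale_right_distrib linear_add[OF counit_linear]
        linear_scale[OF counit_linear] mult.commute)
  have "p (tensor_lift sG sG (\<lambda>x y. sG (counit G x) y) (comult G f)) = counit G (contract sG sG p (comult G f))"
    by (rule tensor_lift_eval[OF b point_linear[OF p] counit_linear point_linear[OF p] _ comult_in])
      (simp add: linear_scale[OF point_linear[OF p]])
  moreover have "tensor_lift sG sG (\<lambda>x y. sG (counit G x) y) (comult G f) = f"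
    using affine by (simp add: affine_group_scheme_def)
  ultimately show ?thesis
    by (simp add: act_def)
qed

lemma exists_translation:
  assumes p: "point p" and r: "point r" "r h \<noteq> 0"
  obtains q where "point q" "p (act q h) \<noteq> 0"
proof
  \<comment> \<open>The point q with p q = r, so that the translate of h by q takes at p the value
    of h at r.\<close>
  let ?q = "conv (inverse_point p) r"
  show "point ?q"
    by (rule point_conv[OF point_inverse[OF p] r(1)])
  have "p (act ?q h) = p (act (inverse_point p) (act r h))"
    by (simp add: act_act[OF point_linear[OF point_inverse[OF p]] point_linear[OF r(1)]])
  also have "\<dots> = r h"
    by (simp add: conv_act[OF p point_inverse[OF p], symmetric] conv_inverse(1)[OF p] counit_act[OF r(1)])
  finally show "p (act ?q h) \<noteq> 0"
    using r(2) by simp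
qed

text \<open>Acting with all forms instead of points gives a subspace at once, inside the span of the
  finitely many left coefficients of \<open>comult G f\<close>.\<close>

definition translates :: "'g \<Rightarrow> 'g set"
  where "translates f = {act \<mu> f |\<mu>. Vector_Spaces.linear sG (*) \<mu>}"

lemma translates_self: "f \<in> translates f"
  unfolding translates_def using act_counit counit_linear by (metis (mono_tags, lifting) mem_Collect_eq)

lemma translates_act:
  assumes "point q" "v \<in> translates f"
  shows "act q v \<in> translates f"
  using assms(2) act_act[OF point_linear[OF assms(1)]] conv_linear[OF point_linear[OF assms(1)]]
  unfolding translates_def by blast

lemma translates_finite_dim:
  obtains B where "finite B" "translates f \<subseteq> M.span B"
proof -
  obtain I :: "nat set" and a g where I: "finite I" "comult G f = (\<Sum>i\<in>I. pure_tensor sG sG (a i) (g i))"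
    using tensor_space_obtain[OF vector_space_G vector_space_G comult_in] .
  have "translates f \<subseteq> M.span (a ` I)"
  proof
    fix v assume "v \<in> translates f"
    then obtain \<mu> where \<mu>: "Vector_Spaces.linear sG (*) \<mu>" "v = act \<mu> f"
      unfolding translates_def by blast
    show "v \<in> M.span (a ` I)"
      unfolding \<mu>(2) act_def I(2) contract_sum[OF vector_space_G \<mu>(1) I(1)]
      by (intro M.span_sum M.span_scale) (simp add: M.span_base)
  qed
  then show thesis
    using that I(1) by blast
qed

lemma translates_subspace: "M.subspace (translates f)"
proof -
  obtain I :: "nat set" and a g where I: "finite I" "comult G f = (\<Sum>i\<in>I. pure_tensor sG sG (a i) (g i))"
    using tensor_space_obtain[OF vector_space_G vector_space_G comult_in] .
  have act: "act \<mu> f = (\<Sum>i\<in>I. sG (\<mu> (g i)) (a i))" if "Vector_Spaces.linear sG (*) \<mu>" for \<mu>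
    unfolding act_def I(2) by (rule contract_sum[OF vector_space_G that I(1)])
  show ?thesis
    unfolding M.subspace_def
  proof (intro conjI ballI allI)
    have l: "Vector_Spaces.linear sG (*) (\<lambda>_. 0 :: 'k)"
      by (rule linearI[OF vector_space_G vector_space_field]) auto
    from act[OF l] have "act (\<lambda>_. 0) f = 0" by simp
    with l show "0 \<in> translates f"
      unfolding translates_def by (metis (mono_tags, lifting) mem_Collect_eq)
  next
    fix x y assume "x \<in> translates f" "y \<in> translates f"
    then obtain \<mu> \<nu> where *: "Vector_Spaces.linear sG (*) \<mu>" "Vector_Spaces.linear sG (*) \<nu>"
        "x = act \<mu> f" "y = act \<nu> f"
      unfolding translates_def by blast
    have l: "Vector_Spaces.linear sG (*) (\<lambda>x. \<mu> x + \<nu> x)"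
      by (rule linearI[OF vector_space_G vector_space_field])
        (simp_all add: linear_add[OF *(1)] linear_add[OF *(2)] linear_scale[OF *(1)] linear_scale[OF *(2)] algebra_simps)
    have "x + y = act (\<lambda>x. \<mu> x + \<nu> x) f"
      by (simp add: * act[OF *(1)] act[OF *(2)] act[OF l] M.scale_left_distrib sum.distrib)
    with l show "x + y \<in> translates f"
      unfolding translates_def by blast
  next
    fix c x assume "x \<in> translates f"
    then obtain \<mu> where *: "Vector_Spaces.linear sG (*) \<mu>" "x = act \<mu> f"
      unfolding translates_def by blast
    have "sG c x = act (\<lambda>x. c * \<mu> x) f"
      by (simp add: * act[OF *(1)] act[OF linear_mult_left[OF *(1)]] M.scale_sum_right)
    with linear_mult_left[OF *(1)] show "sG c x \<in> translates f"
      unfolding translates_def by blast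
  qed
qed

definition killed :: "'g \<Rightarrow> 'g \<Rightarrow> 'g set"
  where "killed f h = {v \<in> translates f. v * h = 0}"

lemma killed_mono: "killed f h \<subseteq> killed f (h * h')"
  unfolding killed_def by (auto simp flip: mult.assoc)

lemma killed_subspace: "M.subspace (killed f h)"
proof -
  interpret G: comm_algebra sG by (rule comm_algebra_G)
  show ?thesis
    using translates_subspace[of f] unfolding killed_def M.subspace_def
    by (auto simp: distrib_right G.scale_mult_left)
qed

text \<open>Dimensions of killed subspaces are bounded, so some nonzero h attains the largest one; a
  nonzero multiple of h kills at least as much and hence the same.\<close>

lemma exists_maximal_killed:
  obtains h where "h \<noteq> 0" "\<And>h'. h * h' \<noteq> 0 \<Longrightarrow> killed f (h * h') = killed f h"
proof -
  obtain B where B: "finite B" "translates f \<subseteq> M.span B"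
    using translates_finite_dim .
  have sub: "killed f h \<subseteq> M.span B" for h
    using B(2) unfolding killed_def by blast
  have "\<forall>h. h \<noteq> 0 \<longrightarrow> M.dim (killed f h) \<le> card B"
    using M.dim_le_card[OF sub B(1)] by blast
  then obtain h where h: "h \<noteq> 0" "\<forall>h'. h' \<noteq> 0 \<longrightarrow> M.dim (killed f h') \<le> M.dim (killed f h)"
    using ex_has_greatest_nat[of "\<lambda>h. h \<noteq> 0" 1 "\<lambda>h. M.dim (killed f h)" "Suc (card B)"]
    by (auto simp: less_Suc_eq_le)
  have "killed f h = killed f (h * h')" if "h * h' \<noteq> 0" for h'
    using M.subspace_eq_if_dim_le[OF killed_subspace killed_mono sub B(1)] h(2) that by blast
  then show thesis
    using that h(1) by metis
qed

text \<open>Translation by q is an algebra automorphism preserving \<open>translates f\<close>, so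
  the statement is pulled back to h by the inverse of q.\<close>

lemma maximal_killed_act:
  assumes q: "point q" and max: "\<And>h'. h * h' \<noteq> 0 \<Longrightarrow> killed f (h * h') = killed f h"
    and nz: "act q h * h' \<noteq> 0"
  shows "killed f (act q h * h') = killed f (act q h)"
proof
  show "killed f (act q h) \<subseteq> killed f (act q h * h')"
    by (rule killed_mono)
  show "killed f (act q h * h') \<subseteq> killed f (act q h)"
  proof
    fix v assume v: "v \<in> killed f (act q h * h')"
    let ?i = "inverse_point q"
    note i = point_inverse[OF q]
    have act_0: "act p 0 = 0" if "point p" for p
      using linear_zero[OF act_linear[OF point_linear[OF that]]] .
    note am = act_point_mult[folded point_def]
    have h': "act q h * h' = act q (h * act ?i h')"
      by (simp add: am[OF q] act_inverse[OF q])
    have "h * act ?i h' \<noteq> 0"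
      using nz act_0[OF q] unfolding h' by auto
    then have eq: "killed f (h * act ?i h') = killed f h"
      by (rule max)
    have "act ?i (v * act q (h * act ?i h')) = 0"
      using v act_0[OF i] unfolding killed_def h' by simp
    then have "act ?i v * (h * act ?i h') = 0"
      by (simp add: am[OF i] act_inverse[OF q])
    then have "act ?i v \<in> killed f h"
      using v translates_act[OF i] unfolding eq[symmetric] by (simp add: killed_def)
    then have "act q (act ?i v * h) = 0"
      using act_0[OF q] by (simp add: killed_def)
    then have "v * act q h = 0"
      by (simp add: am[OF q] act_inverse[OF q])
    then show "v \<in> killed f (act q h)"
      using v by (simp add: killed_def)
  qed
qed

end

text \<open>
  If \<open>h\<close> kills as much as possible of the finite-dimensional translation-stable space spanned by the
  translates of \<open>f\<close>, then what a translate of \<open>h\<close> kills is locally constant on the group, hence constant by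
  connectedness, hence zero because the translates of \<open>h\<close> have no common zero. This avoids
  irreducible components.
\<close>

theorem connected_reduced_domain:
  fixes G :: "('k::alg_closed_field, 'g::comm_ring_1) group_scheme"
  assumes G: "algebraic_group G" and conn: "connected_group G" and fk: "f * k = 0"
  shows "f = 0 \<or> k = (0 :: 'g)"
proof (rule ccontr)
  assume "\<not> (f = 0 \<or> k = 0)"
  then have f: "f \<noteq> 0" and k: "k \<noteq> 0" by auto
  interpret affine_group G
    using G by unfold_locales (simp add: algebraic_group_def affine_algebraic_group_scheme_def)
  have nst: "\<exists>p. point p \<and> p x \<noteq> 0" if "x \<noteq> 0" for x
  proof -
    have "finitely_generated_algebra sG" "\<And>n. x ^ n \<noteq> 0"
      using G that by (auto simp: algebraic_group_def affine_algebraic_group_scheme_def)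
    then show ?thesis
      using nullstellensatz[OF comm_algebra_G] unfolding point_def by metis
  qed
  define U where "U h = {p \<in> carrier (points G). p h \<noteq> 0}" for h
  have U_iff: "p \<in> U h \<longleftrightarrow> point p \<and> p h \<noteq> 0" for p h
    by (simp add: U_def points_def point_def)
  have open_U: "openin (zariski_topology G) (U h)" for h
    unfolding zariski_topology_def U_def by (rule topology_generated_by_Basis) blast
  have top: "topspace (zariski_topology G) \<subseteq> {p. point p}"
    unfolding zariski_topology_def topology_generated_by_topspace by (auto simp: points_def point_def)
  obtain h where h: "h \<noteq> 0" and max: "\<And>h'. h * h' \<noteq> 0 \<Longrightarrow> killed f (h * h') = killed f h"
    using exists_maximal_killed[of f] by metis
  obtain r where r: "point r" "r h \<noteq> 0"
    using nst[OF h] by blast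
  \<comment> \<open>The open sets where a translate of h does not vanish cover the group. They are
    sorted by whether the translate kills the same functions as h.\<close>
  define E1 where "E1 = \<Union>{U (act q h) |q. point q \<and> killed f (act q h) = killed f h}"
  define E2 where "E2 = \<Union>{U (act q h) |q. point q \<and> killed f (act q h) \<noteq> killed f h}"
  have "openin (zariski_topology G) E1" "openin (zariski_topology G) E2"
    unfolding E1_def E2_def using open_U by (auto intro!: openin_Union)
  moreover have "topspace (zariski_topology G) \<subseteq> E1 \<union> E2"
  proof
    fix p assume "p \<in> topspace (zariski_topology G)"
    then have p: "point p"
      using top by blast
    obtain q where q: "point q" "p (act q h) \<noteq> 0"
      using exists_translation[OF p r] .
    then have "p \<in> U (act q h)"
      using p by (simp add: U_iff)
    then show "p \<in> E1 \<union> E2"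
      unfolding E1_def E2_def using q(1) by blast
  qed
  \<comment> \<open>At a common point the product of the two translates is nonzero, and by
    maximality each of them kills exactly what the product kills.\<close>
  moreover have "E1 \<inter> E2 = {}"
  proof (rule ccontr)
    assume "E1 \<inter> E2 \<noteq> {}"
    then obtain p q q' where *: "point q" "point q'" "killed f (act q h) = killed f h"
        "killed f (act q' h) \<noteq> killed f h" "p \<in> U (act q h)" "p \<in> U (act q' h)"
      unfolding E1_def E2_def by blast
    then have "p (act q h * act q' h) \<noteq> 0" "point p"
      by (auto simp: U_iff point_mult)
    then have nz: "act q h * act q' h \<noteq> 0"
      using point_0 by auto
    have "killed f (act q h) = killed f (act q h * act q' h)"
      using maximal_killed_act[OF *(1) max nz] by simp
    also have "\<dots> = killed f (act q' h)"
      using maximal_killed_act[OF *(2) max, of "act q h"] nz by (simp add: mult.commute)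
    finally show False
      using * by simp
  qed
  moreover have "E1 \<noteq> {}"
  proof -
    have "r \<in> U (act (counit G) h)"
      using r by (simp add: U_iff act_counit)
    then show ?thesis
      unfolding E1_def using point_counit act_counit[of h] by force
  qed
  ultimately have "E2 = {}"
    using conn unfolding connected_group_def connected_space_def by blast
  \<comment> \<open>A translate of h is nonzero, hence nonzero at some point; a bad one would put
    that point into E2.\<close>
  have all: "killed f (act q h) = killed f h" if q: "point q" for q
  proof (rule ccontr)
    assume ne: "killed f (act q h) \<noteq> killed f h"
    have "act q h \<noteq> 0"
      using act_inverse(2)[OF q, of h] h linear_zero[OF act_linear[OF point_linear[OF point_inverse[OF q]]]] by auto
    then obtain p where "point p" "p (act q h) \<noteq> 0"
      using nst by blast
    then have "p \<in> U (act q h)"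
      by (simp add: U_iff)
    then show False
      using \<open>E2 = {}\<close> q ne unfolding E2_def by blast
  qed
  \<comment> \<open>Such a v is killed by every translate of h, and at each point some translate
    does not vanish.\<close>
  have killed_h: "v = 0" if v: "v \<in> killed f h" for v
  proof (rule ccontr)
    assume "v \<noteq> 0"
    then obtain p where p: "point p" "p v \<noteq> 0"
      using nst by blast
    obtain q where q: "point q" "p (act q h) \<noteq> 0"
      using exists_translation[OF p(1) r] .
    have "v * act q h = 0"
      using v all[OF q(1)] unfolding killed_def by blast
    then have "p v * p (act q h) = 0"
      using point_mult[OF p(1), of v "act q h"] point_0[OF p(1)] by simp
    then show False
      using p(2) q(2) by simp
  qed
  obtain p where p: "point p" "p k \<noteq> 0"
    using nst[OF k] by blast
  obtain q where q: "point q" "p (act q h) \<noteq> 0"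
    using exists_translation[OF p(1) r] .
  have "p (act q h * k) \<noteq> 0"
    using p q by (simp add: point_mult)
  then have "act q h * k \<noteq> 0"
    using point_0[OF p(1)] by auto
  then have "killed f (act q h * k) = killed f h"
    using maximal_killed_act[OF q(1) max] all[OF q(1)] by simp
  \<comment> \<open>The product of k with a suitable translate of h is nonzero and kills f, but by
    maximality it kills only what h kills, which is 0.\<close>
  moreover have "f \<in> killed f (act q h * k)"
    unfolding killed_def using translates_self fk by (simp add: mult.left_commute[of f])
  ultimately show False
    using killed_h f by blast
qed

section \<open>Multipliers\<close>

text \<open>Linearity is assumed on S only, since the residue map to be extended has no meaning at
  poles.\<close>

lemma (in vector_space) linear_form_extend:
  assumes S: "subspace S"
    and add: "\<And>x y. x \<in> S \<Longrightarrow> y \<in> S \<Longrightarrow> \<phi> (x + y) = \<phi> x + \<phi> y"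
    and scale: "\<And>c x. x \<in> S \<Longrightarrow> \<phi> (scale c x) = c * \<phi> x"
  obtains \<psi> where "Vector_Spaces.linear scale (*) \<psi>" "\<And>x. x \<in> S \<Longrightarrow> \<psi> x = \<phi> x"
proof -
  obtain C where C: "C \<subseteq> S" "independent C" "S \<subseteq> span C"
    using basis_exists[of S] by metis
  interpret K: vector_space "(*) :: 'a \<Rightarrow> 'a \<Rightarrow> 'a" by (rule vector_space_field)
  interpret VK: vector_space_pair scale "(*) :: 'a \<Rightarrow> 'a \<Rightarrow> 'a" ..
  obtain \<psi> where \<psi>: "Vector_Spaces.linear scale (*) \<psi>" "\<forall>x\<in>C. \<psi> x = \<phi> x"
    using VK.linear_independent_extend[OF C(2)] by blast
  have 0: "0 \<in> S"
    using S by (rule subspace_0)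
  have "x \<in> S \<and> \<psi> x = \<phi> x" if "x \<in> span C" for x
    using that
  proof (induction rule: span_induct_alt)
    case base
    show ?case
      using 0 scale[OF 0, of 0] linear_zero[OF \<psi>(1)] by simp
  next
    case (step c x y)
    then have x: "x \<in> S" "scale c x \<in> S"
      using C(1) S subspace_scale by blast+
    then show ?case
      using step \<psi>(2) add[of "scale c x" y] scale[OF x(1)] subspace_add[OF S]
      by (simp add: linear_add[OF \<psi>(1)] linear_scale[OF \<psi>(1)])
  qed
  then show thesis
    using that \<psi>(1) C(3) by blast
qed

lemma independent_family_nonzero:
  assumes "vector_space s" "finite I" "independent_family s I f" "i \<in> I"
  shows "f i \<noteq> 0"
proof
  interpret vector_space s by fact
  assume "f i = 0"
  then have "(\<Sum>j\<in>I. s (if j = i then 1 else 0) (f j)) = 0"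
    by (intro sum.neutral) auto
  then show False
    using assms(3,4) unfolding independent_family_def by fastforce
qed

text \<open>Such a u has least value in S. Any two elements are comparable because one of their two
  quotients is finite, and finiteness of quotients is transitive.\<close>

lemma (in algebra_map) place_minimal:
  assumes \<Gamma>: "place \<Gamma>" and recip: "\<And>x. x \<noteq> 0 \<Longrightarrow> x * recip x = 1"
  shows "finite S \<Longrightarrow> S \<noteq> {} \<Longrightarrow> 0 \<notin> S \<Longrightarrow> \<exists>u\<in>S. \<forall>v\<in>S. v * recip u \<in> Domain \<Gamma>"
proof (induction rule: finite_ne_induct)
  case (singleton x)
  then show ?case
    using recip[of x] \<Gamma> graph_closed_1[of \<Gamma>] unfolding place_def by auto
next
  case (insert x S)
  have gc: "graph_closed \<Gamma>"
    using \<Gamma> by (simp add: place_def)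
  obtain u where u: "u \<in> S" "\<forall>v\<in>S. v * recip u \<in> Domain \<Gamma>"
    using insert by auto
  have "u \<noteq> 0" "x \<noteq> 0"
    using u(1) insert.prems by auto
  then have ux: "u * recip u = 1" "x * recip x = 1"
    using recip by blast+
  have "(x * recip u) * (u * recip x) = (x * recip x) * (u * recip u)"
    by (simp add: mult_ac)
  then have "(x * recip u) * (u * recip x) = 1"
    unfolding ux by simp
  then consider "x * recip u \<in> Domain \<Gamma>" | "u * recip x \<in> Domain \<Gamma>"
    using \<Gamma> unfolding place_def by blast
  then show ?case
  proof cases
    case 1
    then show ?thesis
      using u by blast
  next
    case 2
    have "v * recip x \<in> Domain \<Gamma>" if "v \<in> S" for v
    proof -
      obtain c d where "(v * recip u, c) \<in> \<Gamma>" "(u * recip x, d) \<in> \<Gamma>"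
        using u(2) \<open>v \<in> S\<close> 2 by blast
      then have "((v * recip u) * (u * recip x), c * d) \<in> \<Gamma>"
        by (rule graph_closed_mult[OF gc])
      moreover have "(v * recip u) * (u * recip x) = v * recip x * (u * recip u)"
        by (simp add: mult_ac)
      ultimately show ?thesis
        using ux by auto
    qed
    moreover have "x * recip x \<in> Domain \<Gamma>"
      using ux graph_closed_1[OF gc] by auto
    ultimately show ?thesis by blast
  qed
qed

text \<open>
  The form \<open>\<psi>\<close> used below takes the leading coefficient: for \<open>g i0\<close> and \<open>q j0\<close> of least value
  at a place, it is the residue of \<open>r / (g i0 * q j0)\<close>, extended linearly.
\<close>

lemma tensor_factor_constant:
  fixes sA :: "'k::alg_closed_field \<Rightarrow> 'a::comm_ring_1 \<Rightarrow> 'a" and sB :: "'k \<Rightarrow> 'b::comm_ring_1 \<Rightarrow> 'b"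
    and I J :: "'i set"
  assumes A: "comm_algebra sA" and B: "comm_algebra sB"
    and domA: "\<And>x y :: 'a. x * y = 0 \<Longrightarrow> x = 0 \<or> y = 0"
    and domB: "\<And>x y :: 'b. x * y = 0 \<Longrightarrow> x = 0 \<or> y = 0"
    and I: "finite I" "independent_family sA I a" and i: "i \<in> I" "g i \<noteq> 0"
    and J: "finite J" "independent_family sA J y"
    and prod: "\<And>\<psi>. Vector_Spaces.linear sB (*) \<psi> \<Longrightarrow> (\<And>i. i \<in> I \<Longrightarrow> \<psi> (g i) = 0) \<Longrightarrow>
      (\<Sum>i\<in>I. \<Sum>j\<in>J. sA (\<psi> (g i * q j)) (a i * y j)) = 0"
    and j: "j \<in> J"
  shows "q j \<in> range (\<lambda>c. sB c 1)"
proof (rule ccontr)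
  \<comment> \<open>A place with a pole at \<open>q j\<close> will be refuted. The hypothesis
    \<open>prod\<close> is the dual form of the condition that the coefficients of the product lie
    in the span of the g i.\<close>
  assume qj: "q j \<notin> range (\<lambda>c. sB c 1)"
  interpret A: comm_algebra sA by fact
  interpret B: comm_algebra sB by fact
  interpret B1: algebra_map "\<lambda>c. sB c 1"
    using B by (rule algebra_map_comm_algebra)
  interpret Q: algebra_map "\<lambda>c. to_quot (sB c 1)"
    by unfold_locales (simp_all add: B1.map_add B1.map_mult to_quot_add to_quot_mult)
  have ex_inv: "\<exists>y. x * y = 1" if "x \<noteq> 0" for x :: "'b total_quotient"
    using total_quotient_inverse domB that by blast
  then obtain recip where recip: "\<And>x :: 'b total_quotient. x \<noteq> 0 \<Longrightarrow> x * recip x = 1"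
    by metis
  have domQ: "x = 0 \<or> z = 0" if "x * z = 0" for x z :: "'b total_quotient"
  proof (rule ccontr)
    assume "\<not> (x = 0 \<or> z = 0)"
    then have "(x * z) * (recip x * recip z) = 1"
      using recip[of x] recip[of z] by (metis mult.assoc mult.left_commute mult_1)
    with that show False by simp
  qed
  have q0: "q j \<noteq> 0"
    using qj B1.map_zero by (metis rangeI)
  have "to_quot (q j) \<notin> range (\<lambda>c. to_quot (sB c 1))"
  proof
    assume "to_quot (q j) \<in> range (\<lambda>c. to_quot (sB c 1))"
    then obtain c where "to_quot (q j) = to_quot (sB c 1)" by blast
    then have "to_quot (q j - sB c 1) = 0"
      using to_quot_add[of "q j - sB c 1" "sB c 1"] by simp
    then have "q j = sB c 1" by simp
    with qj show False by blast
  qed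
  moreover have "to_quot (q j) * recip (to_quot (q j)) = 1"
    using recip q0 by simp
  ultimately obtain \<Gamma> where \<Gamma>: "Q.place \<Gamma>" "to_quot (q j) \<notin> Domain \<Gamma>"
    using Q.exists_place[OF domQ] by blast
  have gc: "Q.graph_closed \<Gamma>"
    using \<Gamma>(1) by (simp add: Q.place_def)
  have uniq: "c = d" if "(x, c) \<in> \<Gamma>" "(x, d) \<in> \<Gamma>" for x c d
    using Q.graph_closed_diff[OF gc that] \<Gamma>(1) unfolding Q.place_def by auto
  have zero: "(0, 0) \<in> \<Gamma>" and one: "(1, 1) \<in> \<Gamma>"
    using Q.graph_closed_0[OF gc] Q.graph_closed_1[OF gc] .
  have minimal: "\<exists>l\<in>L. f l \<noteq> 0 \<and> (\<forall>i\<in>L. f i \<noteq> 0 \<longrightarrow> to_quot (f i) * recip (to_quot (f l)) \<in> Domain \<Gamma>)"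
    if "finite L" "l \<in> L" "f l \<noteq> 0" for L :: "'i set" and f l
  proof -
    let ?S = "(\<lambda>i. to_quot (f i)) ` {i \<in> L. f i \<noteq> 0}"
    have "0 \<notin> ?S"
      by (metis (mono_tags, lifting) imageE mem_Collect_eq to_quot_eq_0_iff)
    moreover have "finite ?S" "?S \<noteq> {}"
      using that by auto
    ultimately have "\<exists>u\<in>?S. \<forall>v\<in>?S. v * recip u \<in> Domain \<Gamma>"
      using Q.place_minimal[OF \<Gamma>(1) recip] by blast
    then show ?thesis by blast
  qed
  obtain i0 where i0: "i0 \<in> I" "g i0 \<noteq> 0"
      and min_i: "\<And>i. i \<in> I \<Longrightarrow> g i \<noteq> 0 \<Longrightarrow> to_quot (g i) * recip (to_quot (g i0)) \<in> Domain \<Gamma>"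
    using minimal[of I i g, OF I(1) i] by blast
  obtain j0 where j0: "j0 \<in> J" "q j0 \<noteq> 0"
      and min_j: "\<And>j. j \<in> J \<Longrightarrow> q j \<noteq> 0 \<Longrightarrow> to_quot (q j) * recip (to_quot (q j0)) \<in> Domain \<Gamma>"
    using minimal[of J j q, OF J(1) j q0] by blast
  define u where "u = to_quot (g i0)"
  define w where "w = to_quot (q j0)"
  have u: "u * recip u = 1" and w: "w * recip w = 1"
    using recip i0 j0 by (simp_all add: u_def w_def)
  have "\<exists>c. (to_quot (g i) * recip u, c) \<in> \<Gamma>" if "i \<in> I" for i
    using min_i[OF that] zero by (cases "g i = 0") (auto simp: u_def)
  then obtain c where c: "\<And>i. i \<in> I \<Longrightarrow> (to_quot (g i) * recip u, c i) \<in> \<Gamma>"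
    by metis
  have "\<exists>d. (to_quot (q j) * recip w, d) \<in> \<Gamma>" if "j \<in> J" for j
    using min_j[OF that] zero by (cases "q j = 0") (auto simp: w_def)
  then obtain d where d: "\<And>j. j \<in> J \<Longrightarrow> (to_quot (q j) * recip w, d j) \<in> \<Gamma>"
    by metis
  have c0: "c i0 = 1"
    using uniq[OF c[OF i0(1)], of 1] u one by (simp add: u_def)
  have d0: "d j0 = 1"
    using uniq[OF d[OF j0(1)], of 1] w one by (simp add: w_def)
  \<comment> \<open>\<open>q j\<close> divided by w is finite, so a finite w would make
    \<open>q j\<close> finite. Hence w is a pole and 1/w has residue 0.\<close>
  have wO: "w \<notin> Domain \<Gamma>"
  proof
    assume "w \<in> Domain \<Gamma>"
    then obtain e where "(w, e) \<in> \<Gamma>" by blast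
    from Q.graph_closed_mult[OF gc d[OF j] this] have "to_quot (q j) * recip w * w \<in> Domain \<Gamma>"
      by blast
    moreover have "to_quot (q j) * recip w * w = to_quot (q j)"
      using w by (metis mult.assoc mult.commute mult_1)
    ultimately show False
      using \<Gamma>(2) by simp
  qed
  then obtain e where e: "(recip w, e) \<in> \<Gamma>"
    using \<Gamma>(1) w unfolding Q.place_def by blast
  then have "e = 0"
    using \<Gamma>(1) w wO unfolding Q.place_def by blast
  with e have w0: "(recip w, 0) \<in> \<Gamma>" by simp
  \<comment> \<open>The elements of value at least that of u w; \<phi> is their leading coefficient
    relative to u w.\<close>
  define X where "X = {r. to_quot r * (recip u * recip w) \<in> Domain \<Gamma>}"
  define \<phi> where "\<phi> r = (THE c. (to_quot r * (recip u * recip w), c) \<in> \<Gamma>)" for r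
  have \<phi>I: "r \<in> X \<and> \<phi> r = c" if "(to_quot r * (recip u * recip w), c) \<in> \<Gamma>" for r c
    unfolding \<phi>_def X_def using that uniq by blast
  have \<phi>: "(to_quot r * (recip u * recip w), \<phi> r) \<in> \<Gamma>" if "r \<in> X" for r
    using that \<phi>I unfolding X_def by blast
  have add: "r + s \<in> X \<and> \<phi> (r + s) = \<phi> r + \<phi> s" if "r \<in> X" "s \<in> X" for r s
    by (rule \<phi>I) (use Q.graph_closed_add[OF gc \<phi>[OF that(1)] \<phi>[OF that(2)]] in \<open>simp add: to_quot_add distrib_right\<close>)
  have scale: "sB k r \<in> X \<and> \<phi> (sB k r) = k * \<phi> r" if "r \<in> X" for r k
  proof (rule \<phi>I)
    have "to_quot (sB k r) = to_quot (sB k 1) * to_quot r"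
      by (simp add: B.scale_mult_left flip: to_quot_mult)
    then show "(to_quot (sB k r) * (recip u * recip w), k * \<phi> r) \<in> \<Gamma>"
      using Q.graph_closed_mult[OF gc Q.graph_closed_map[OF gc] \<phi>[OF that]] by (simp add: mult.assoc)
  qed
  have "0 \<in> X"
    using \<phi>I[of 0 0] zero by simp
  then have "B.subspace X"
    unfolding B.subspace_def using add scale by blast
  then obtain \<psi> where \<psi>: "Vector_Spaces.linear sB (*) \<psi>" "\<And>r. r \<in> X \<Longrightarrow> \<psi> r = \<phi> r"
    using B.linear_form_extend[of X \<phi>] add scale by blast
  \<comment> \<open>\<open>g i\<close> divided by u is finite, and the extra factor 1/w has residue
    0. This is the only use of the pole.\<close>
  have "\<psi> (g i) = 0" if "i \<in> I" for i
  proof -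
    have "(to_quot (g i) * (recip u * recip w), c i * 0) \<in> \<Gamma>"
      using Q.graph_closed_mult[OF gc c[OF that] w0] by (simp add: mult.assoc)
    then show ?thesis
      using \<phi>I \<psi>(2) by fastforce
  qed
  then have "(\<Sum>i\<in>I. \<Sum>j\<in>J. sA (\<psi> (g i * q j)) (a i * y j)) = 0"
    using prod \<psi>(1) by blast
  moreover have "\<psi> (g i * q j) = c i * d j" if "i \<in> I" "j \<in> J" for i j
  proof -
    have "(to_quot (g i * q j) * (recip u * recip w), c i * d j) \<in> \<Gamma>"
      using Q.graph_closed_mult[OF gc c[OF that(1)] d[OF that(2)]] by (simp add: to_quot_mult mult_ac)
    then show ?thesis
      using \<phi>I \<psi>(2) by fastforce
  qed
  moreover have "sA (k * l) (x * z) = sA k x * sA l z" for k l x z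
    by (metis A.scale_mult_left A.scale_scale mult.commute)
  \<comment> \<open>The product of the two leading coefficients vanishes, yet each is a combination
    of independent elements with one coefficient equal to 1, namely at i0 and at j0.\<close>
  ultimately have "(\<Sum>i\<in>I. sA (c i) (a i)) * (\<Sum>j\<in>J. sA (d j) (y j)) = 0"
    by (simp add: sum_product)
  then consider "(\<Sum>i\<in>I. sA (c i) (a i)) = 0" | "(\<Sum>j\<in>J. sA (d j) (y j)) = 0"
    using domA by blast
  then show False
  proof cases
    case 1
    then have "c i0 = 0"
      using I(2) i0(1) unfolding independent_family_def by blast
    with c0 show False by simp
  next
    case 2
    then have "d j0 = 0"
      using J(2) j0(1) unfolding independent_family_def by blast
    with d0 show False by simp
  qed
qed

lemma semi_invariantI:
  assumes lin: "Vector_Spaces.linear sM fun_scale \<rho>"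
    and a: "\<rho> a \<in> tensor_subspace sM (gscale G) (module.span sM {a})"
  shows "semi_invariant G sM \<rho> a"
proof -
  interpret vector_space sM
    using lin by (rule linear_vector_spaces)
  have "\<rho> m \<in> tensor_subspace sM (gscale G) (span {a})" if "m \<in> span {a}" for m
  proof -
    obtain c where "m = sM c a"
      using \<open>m \<in> span {a}\<close> by (auto simp: span_singleton)
    then show ?thesis
      using tensor_subspace_scale[OF a] by (simp add: linear_scale[OF lin])
  qed
  then show ?thesis
    unfolding semi_invariant_def is_submodule_def using subspace_span by blast
qed

section \<open>Stable principal ideals and their multipliers\<close>

locale integral_group_action = group_action G sA \<rho>
  for G :: "('k::alg_closed_field, 'g::comm_ring_1) group_scheme"
    and sA :: "'k \<Rightarrow> 'a::idom \<Rightarrow> 'a" and \<rho> :: "'a \<Rightarrow> ('k, 'a, 'g) tensor" +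
  assumes group: "algebraic_group G" and conn: "connected_group G"
begin

lemma counit_scale_1: "counit G (sG c 1) = c"
  using scheme linear_scale[OF counit_linear, of c 1]
  by (simp add: affine_group_scheme_def algebra_hom_def)

text \<open>The reduction shared by H and H': stability of A a makes each contraction of \<sigma> a
  a multiple of a, and it remains to show that the multiplier is constant. For a = 0 the multiplier
  is arbitrary, so that case is excluded from \<open>const\<close>.\<close>

lemma semi_invariant_multiplier:
  assumes lin: "Vector_Spaces.linear sA fun_scale \<sigma>"
    and sub: "is_submodule H sA \<sigma> (range (\<lambda>b. b * a))"
    and H: "vector_space (gscale H)"
    and const: "\<And>\<phi> u. Vector_Spaces.linear (gscale H) (*) \<phi> \<Longrightarrow> a \<noteq> 0 \<Longrightarrow>
      contract sA (gscale H) \<phi> (\<sigma> a) = a * u \<Longrightarrow> u \<in> range (\<lambda>c. sA c 1)"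
  shows "semi_invariant H sA \<sigma> a"
proof (rule semi_invariantI[OF lin], rule tensor_subspaceI[OF vector_space_M H])
  interpret A: comm_algebra sA by (rule comm_algebra_A)
  have S: "M.subspace (range (\<lambda>b. b * a))"
    and "\<sigma> a \<in> tensor_subspace sA (gscale H) (range (\<lambda>b. b * a))"
    using sub range_eqI[of a "\<lambda>b. b * a" 1] unfolding is_submodule_def by auto
  then show "\<sigma> a \<in> tensor_space sA (gscale H)"
    using tensor_subspace_subset by blast
  fix \<phi> assume \<phi>: "Vector_Spaces.linear (gscale H) (*) \<phi>"
  have "contract sA (gscale H) \<phi> (\<sigma> a) \<in> range (\<lambda>b. b * a)"
    by (rule contract_in_subspace[OF vector_space_M \<phi> S]) fact
  then obtain u where u: "contract sA (gscale H) \<phi> (\<sigma> a) = a * u"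
    by (auto simp: mult.commute)
  show "contract sA (gscale H) \<phi> (\<sigma> a) \<in> M.span {a}"
  proof (cases "a = 0")
    case True
    then show ?thesis
      using u M.span_zero by simp
  next
    case False
    then obtain c where "u = sA c 1"
      using const[OF \<phi> _ u] by blast
    then have "contract sA (gscale H) \<phi> (\<sigma> a) = sA c a"
      using u A.scale_mult_left[of c 1 a] by (simp add: mult.commute)
    then show ?thesis
      unfolding M.span_singleton by blast
  qed
qed

text \<open>The counit recovers a from \<rho> a, so the sum cannot be empty; this supplies the
  nonzero coefficient that \<open>tensor_factor_constant\<close> asks for.\<close>

lemma coaction_family_nonempty:
  assumes "finite I" "\<rho> a = (\<Sum>i\<in>I. pure_tensor sA sG (x i) (g i))" "a \<noteq> 0"
  obtains i where "i \<in> I"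
proof -
  have "a = (\<Sum>i\<in>I. sA (counit G (g i)) (x i))"
    using act_counit[of a] unfolding act_def assms(2) contract_sum[OF vector_space_M counit_linear assms(1)] by simp
  then have "I \<noteq> {}"
    using assms(3) by auto
  then show thesis
    using that by blast
qed

text \<open>A form \<psi> killing the coefficients g i of \<rho> a annihilates a, and hence also E a
  = a u, because E commutes with \<open>act \<psi>\<close>. This is the hypothesis
  \<open>prod\<close>, with the place on k[G].\<close>

lemma multiplier_commuting:
  assumes E: "Vector_Spaces.linear sA sA E"
    and comm: "\<And>\<psi> x. Vector_Spaces.linear sG (*) \<psi> \<Longrightarrow> act \<psi> (E x) = E (act \<psi> x)"
    and a: "a \<noteq> 0" and u: "E a = a * u"
  shows "u \<in> invariants G sA \<rho>"
proof -
  interpret A: comm_algebra sA by (rule comm_algebra_A)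
  obtain I :: "nat set" and x g where I: "finite I" "\<rho> a = (\<Sum>i\<in>I. pure_tensor sA sG (x i) (g i))"
      "independent_family sA I x" "independent_family sG I g"
    using tensor_space_independent[OF vector_space_M vector_space_G coaction_in] .
  obtain J :: "nat set" and y q where J: "finite J" "\<rho> u = (\<Sum>j\<in>J. pure_tensor sA sG (y j) (q j))"
      "independent_family sA J y" "independent_family sG J q"
    using tensor_space_independent[OF vector_space_M vector_space_G coaction_in] .
  obtain i where i: "i \<in> I"
    using coaction_family_nonempty[OF I(1,2) a] .
  have "q j \<in> range (\<lambda>c. sG c 1)" if "j \<in> J" for j
  proof (rule tensor_factor_constant[OF comm_algebra_A comm_algebra_G _ _ I(1,3) i _ J(1,3) _ that])
    show "v * w = 0 \<Longrightarrow> v = 0 \<or> w = 0" for v w :: 'a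
      by simp
    show "v * w = 0 \<Longrightarrow> v = 0 \<or> w = 0" for v w :: 'g
      by (rule connected_reduced_domain[OF group conn])
    show "g i \<noteq> 0"
      using independent_family_nonzero[OF vector_space_G I(1,4) i] .
    fix \<psi> assume \<psi>: "Vector_Spaces.linear sG (*) \<psi>" "\<And>i. i \<in> I \<Longrightarrow> \<psi> (g i) = 0"
    have "act \<psi> a = 0"
      unfolding act_def I(2) contract_sum[OF vector_space_M \<psi>(1) I(1)] using \<psi>(2) by simp
    then have "act \<psi> (a * u) = 0"
      unfolding u[symmetric] comm[OF \<psi>(1)] by (simp add: linear_zero[OF E])
    then show "(\<Sum>i\<in>I. \<Sum>j\<in>J. sA (\<psi> (g i * q j)) (x i * y j)) = 0"
      by (simp only: act_mult_sum[OF I(1,2) J(1,2) \<psi>(1)])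
  qed
  then have "\<forall>j\<in>J. \<exists>c. q j = sG c 1"
    by blast
  from bchoice[OF this] obtain c where c: "\<And>j. j \<in> J \<Longrightarrow> q j = sG (c j) 1"
    by blast
  note pl = pure_tensor_linear[OF vector_space_M vector_space_G]
  \<comment> \<open>With all right factors constant, \<rho> u is some element tensor 1, and the
    counit identifies that element as u.\<close>
  have "u = (\<Sum>j\<in>J. sA (counit G (q j)) (y j))"
    using act_counit[of u] unfolding act_def J(2) contract_sum[OF vector_space_M counit_linear J(1)] by simp
  also have "\<dots> = (\<Sum>j\<in>J. sA (c j) (y j))"
    using c by (intro sum.cong) (simp_all add: counit_scale_1)
  finally have "pure_tensor sA sG u 1 = (\<Sum>j\<in>J. pure_tensor sA sG (sA (c j) (y j)) 1)"
    by (simp only: linear_sum[OF pl(5)])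
  also have "\<dots> = \<rho> u"
    unfolding J(2) by (intro sum.cong refl) (simp only: c pl(3,4))
  finally show ?thesis
    by (simp add: invariants_def)
qed

text \<open>Every form acts on a with values in the span of the x i, and acting by \<psi> after
  \<mu> is acting by one form. So the coefficients in A of \<rho> (a u) lie in that span, and the
  place is now taken on A.\<close>

lemma multiplier_subgroup:
  assumes \<mu>: "Vector_Spaces.linear sG (*) \<mu>" and a: "a \<noteq> 0" and u: "act \<mu> a = a * u"
  shows "u \<in> range (\<lambda>c. sA c 1)"
proof -
  interpret A: comm_algebra sA by (rule comm_algebra_A)
  obtain I :: "nat set" and x g where I: "finite I" "\<rho> a = (\<Sum>i\<in>I. pure_tensor sA sG (x i) (g i))"
      "independent_family sA I x" "independent_family sG I g"
    using tensor_space_independent[OF vector_space_M vector_space_G coaction_in] .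
  obtain J :: "nat set" and y q where J: "finite J" "\<rho> u = (\<Sum>j\<in>J. pure_tensor sA sG (y j) (q j))"
      "independent_family sA J y" "independent_family sG J q"
    using tensor_space_independent[OF vector_space_M vector_space_G coaction_in] .
  obtain i where i: "i \<in> I"
    using coaction_family_nonempty[OF I(1,2) a] .
  have "y j \<in> range (\<lambda>c. sA c 1)" if "j \<in> J" for j
  proof (rule tensor_factor_constant[OF comm_algebra_G comm_algebra_A _ _ I(1,4) i _ J(1,4) _ that])
    show "v * w = 0 \<Longrightarrow> v = 0 \<or> w = 0" for v w :: 'a
      by simp
    show "v * w = 0 \<Longrightarrow> v = 0 \<or> w = 0" for v w :: 'g
      by (rule connected_reduced_domain[OF group conn])
    show "x i \<noteq> 0"
      using independent_family_nonzero[OF vector_space_M I(1,3) i] .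
    fix \<chi> assume \<chi>: "Vector_Spaces.linear sA (*) \<chi>" "\<And>i. i \<in> I \<Longrightarrow> \<chi> (x i) = 0"
    show "(\<Sum>i\<in>I. \<Sum>j\<in>J. sG (\<chi> (x i * y j)) (g i * q j)) = 0"
    \<comment> \<open>The identity in k[G] is tested against each form \<psi>, where it becomes a
      statement about \<chi> applied to operators.\<close>
    proof (rule eq_if_forms_eq[OF vector_space_G])
      fix \<psi> assume \<psi>: "Vector_Spaces.linear sG (*) \<psi>"
      have "\<psi> (\<Sum>i\<in>I. \<Sum>j\<in>J. sG (\<chi> (x i * y j)) (g i * q j)) = \<chi> (act \<psi> (a * u))"
        unfolding act_mult_sum[OF I(1,2) J(1,2) \<psi>]
        by (simp add: linear_sum[OF \<psi>] linear_sum[OF \<chi>(1)] linear_scale[OF \<psi>] linear_scale[OF \<chi>(1)] mult.commute)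
      also have "\<dots> = \<chi> (act (conv \<psi> \<mu>) a)"
        unfolding u[symmetric] act_act[OF \<psi> \<mu>] ..
      also have "\<dots> = 0"
        unfolding act_def I(2) contract_sum[OF vector_space_M conv_linear[OF \<psi> \<mu>] I(1)]
        by (simp add: linear_sum[OF \<chi>(1)] linear_scale[OF \<chi>(1)] \<chi>(2))
      finally show "\<psi> (\<Sum>i\<in>I. \<Sum>j\<in>J. sG (\<chi> (x i * y j)) (g i * q j)) = \<psi> 0"
        by (simp add: linear_zero[OF \<psi>])
    qed
  qed
  then have "\<forall>j\<in>J. \<exists>c. y j = sA c 1"
    by blast
  from bchoice[OF this] obtain c where c: "\<And>j. j \<in> J \<Longrightarrow> y j = sA (c j) 1"
    by blast
  have "u = (\<Sum>j\<in>J. sA (counit G (q j)) (y j))"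
    using act_counit[of u] unfolding act_def J(2) contract_sum[OF vector_space_M counit_linear J(1)] by simp
  also have "\<dots> = sA (\<Sum>j\<in>J. counit G (q j) * c j) 1"
    unfolding M.scale_sum_left using c by (intro sum.cong) simp_all
  finally show ?thesis by blast
qed

end

theorem proposition2:
  fixes G :: "('k::alg_closed_field, 'g::comm_ring_1) group_scheme"
    and H' :: "('k, 'h'::comm_ring_1) group_scheme"
    and H :: "('k, 'h::comm_ring_1) group_scheme"
    and \<pi> :: "'g \<Rightarrow> 'h"
    and sA :: "'k \<Rightarrow> 'a::idom \<Rightarrow> 'a"
    and \<rho> :: "'a \<Rightarrow> ('k, 'a, 'g) tensor"
    and \<rho>' :: "'a \<Rightarrow> ('k, 'a, 'h') tensor"
    and a :: 'a
  assumes "affine_algebraic_group_scheme G"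
    and "affine_algebraic_group_scheme H'"
    and "acts_on_algebra G sA \<rho>"
    and "acts_on_algebra H' sA \<rho>'"
    and "commuting_comodules G H' sA \<rho> \<rho>'"
    and "connected_group G" and "reductive_group G"
    and "invariants G sA \<rho> = range (\<lambda>c. sA c 1)"
    and "closed_subgroup_scheme H \<pi> G"
    and "is_submodule H sA (restrict_comodule H \<pi> G sA \<rho>) (range (\<lambda>b. b * a))"
    and "is_submodule H' sA \<rho>' (range (\<lambda>b. b * a))"
  shows "semi_invariant H sA (restrict_comodule H \<pi> G sA \<rho>) a \<and> semi_invariant H' sA \<rho>' a"
proof
  interpret A: integral_group_action G sA \<rho>
    using assms(1,3,6,7) by unfold_locales (simp_all add: affine_algebraic_group_scheme_def reductive_group_def)
  interpret B: group_action H' sA \<rho>'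
    using assms(2,4) by unfold_locales (simp_all add: affine_algebraic_group_scheme_def)
  show "semi_invariant H' sA \<rho>' a"
  proof (rule A.semi_invariant_multiplier[OF B.coaction_linear assms(11) B.vector_space_G])
    fix \<phi> u assume \<phi>: "Vector_Spaces.linear B.sG (*) \<phi>" and a: "a \<noteq> 0"
      and "contract sA B.sG \<phi> (\<rho>' a) = a * u"
    then have "B.act \<phi> a = a * u"
      by (simp add: B.act_def)
    then have "u \<in> invariants G sA \<rho>"
      \<comment> \<open>The form \<phi> on k[H'] gives the operator E, and commuting actions make it
        commute with every form on k[G].\<close>
      using A.multiplier_commuting[OF B.act_linear[OF \<phi>] _ a]
        commuting_act[OF A.group_comodule_axioms B.group_comodule_axioms assms(5) _ \<phi>] by blast
    then show "u \<in> range (\<lambda>c. sA c 1)"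
      using assms(8) by simp
  qed
  let ?\<sigma> = "restrict_comodule H \<pi> G sA \<rho>"
  have H: "vector_space (gscale H)"
    using assms(9) by (simp add: closed_subgroup_scheme_def affine_group_scheme_def comm_algebra_def)
  have \<pi>: "Vector_Spaces.linear A.sG (gscale H) \<pi>"
    using assms(9) by (simp add: closed_subgroup_scheme_def algebra_hom_def)
  note pl = pure_tensor_linear[OF A.vector_space_M H]
  have bil: "bilinear_map sA A.sG fun_scale (\<lambda>m g. pure_tensor sA (gscale H) m (\<pi> g))"
    unfolding bilinear_map_def using pl(5) linear_compose_form[OF \<pi> pl(6)] by blast
  \<comment> \<open>A form on k[H] acts as its pullback along \<pi>, so H enters only through linear
    forms on k[G].\<close>
  have contract: "contract sA (gscale H) \<phi> (?\<sigma> x) = A.act (\<lambda>g. \<phi> (\<pi> g)) x"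
    if \<phi>: "Vector_Spaces.linear (gscale H) (*) \<phi>" for \<phi> x
  proof -
    obtain I :: "nat set" and b g where I: "finite I" "\<rho> x = (\<Sum>i\<in>I. pure_tensor sA A.sG (b i) (g i))"
      using tensor_space_obtain[OF A.vector_space_M A.vector_space_G A.coaction_in] .
    show ?thesis
      unfolding restrict_comodule_def A.act_def I(2) tensor_lift_sum[OF vector_space_fun_scale bil I(1)]
        contract_sum[OF A.vector_space_M \<phi> I(1)]
        contract_sum[OF A.vector_space_M linear_compose_form[OF \<pi> \<phi>] I(1)] ..
  qed
  have "Vector_Spaces.linear sA fun_scale ?\<sigma>"
    unfolding restrict_comodule_def[abs_def]
    by (rule linear_tensor_lift_compose[OF A.vector_space_G A.vector_space_M vector_space_fun_scale
      bil A.coaction_linear A.coaction_range])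
  then show "semi_invariant H sA ?\<sigma> a"
  proof (rule A.semi_invariant_multiplier[OF _ assms(10) H])
    fix \<phi> u assume \<phi>: "Vector_Spaces.linear (gscale H) (*) \<phi>" and a: "a \<noteq> 0"
      and "contract sA (gscale H) \<phi> (?\<sigma> a) = a * u"
    then have "A.act (\<lambda>g. \<phi> (\<pi> g)) a = a * u"
      by (simp only: contract)
    then show "u \<in> range (\<lambda>c. sA c 1)"
      by (rule A.multiplier_subgroup[OF linear_compose_form[OF \<pi> \<phi>] a])
  qed
qed

end
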